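(* For every fixed positive integer $t$, the class of $H_t$-free visibility graphs of 1.5D terrains has bounded twin-width. Furthermore, there is a polynomial-time algorithm which, given such a graph $G$ together with a left-right ordering $\prec$ of its vertices, outputs a $d$-sequence of $G$ for some $d$ depending only on $t$.
   Context: A 1.5D terrain is an $x$-monotone polygonal chain in the plane with vertices $p_1,\dots,p_n$ (ordered by increasing $x$-coordinate, consecutive ones joined by edges of the chain). Its visibility graph has vertex set $\{p_1,\dots,p_n\}$, two vertices being adjacent iff the line segment they define lies entirely above the terrain (no point of it strictly below the chain). A left-right ordering of a visibility graph of a terrain is the order $p_1\prec\dots\prec p_n$ for some terrain realizing it. A graph is $H_t$-free if there are no $2t$ distinct vertices $a_1,\dots,a_t,b_1,\dots,b_t$ with $a_ib_j$ an edge iff $i\le j$. Twin-width: contracting two vertices $u,v$ of a trigraph (black/red edges) into $w$ makes $wz$ black if $uz,vz$ were both black, absent if neither was an edge, red otherwise; a $d$-sequence is a sequence of contractions down to one vertex with all trigraphs of red degree at most $d$; the twin-width is the least such $d$. *)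

theory Defs
  imports
    "HOL-Analysis.Analysis"
    "HOL-Computational_Algebra.Polynomial"
    "Graph_Theory.Pair_Digraph"
begin

section \<open>Terrains and their visibility graphs\<close>

text \<open>A terrain is given by its vertices, listed from left to right. Finite simple graphs are
  loopless symmetric \<^typ>\<open>'a pair_pre_digraph\<close>s: an edge is a pair of opposite arcs.\<close>

definition terrain :: "(real \<times> real) list \<Rightarrow> bool" where
  "terrain ps \<longleftrightarrow> ps \<noteq> [] \<and> sorted_wrt (\<lambda>p q. fst p < fst q) ps"

text \<open>The summand \<^term>\<open>set ps\<close> only matters for the terrain with a single vertex.\<close>

definition chain :: "(real \<times> real) list \<Rightarrow> (real \<times> real) set" where
  "chain ps = set ps \<union> (\<Union>i \<in> {i. Suc i < length ps}. closed_segment (ps ! i) (ps ! Suc i))"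

definition strictly_below :: "real \<times> real \<Rightarrow> (real \<times> real) set \<Rightarrow> bool" where
  "strictly_below z C \<longleftrightarrow> (\<exists>c \<in> C. fst c = fst z \<and> snd z < snd c)"

definition sees :: "(real \<times> real) list \<Rightarrow> real \<times> real \<Rightarrow> real \<times> real \<Rightarrow> bool" where
  "sees ps p q \<longleftrightarrow> (\<forall>z \<in> closed_segment p q. \<not> strictly_below z (chain ps))"

definition visibility_graph :: "(real \<times> real) list \<Rightarrow> (real \<times> real) pair_pre_digraph" where
  "visibility_graph ps =
     \<lparr> pverts = set ps,
       parcs = {(p, q). p \<in> set ps \<and> q \<in> set ps \<and> p \<noteq> q \<and> sees ps p q} \<rparr>"

text \<open>\<open>vs\<close> lists the vertices of \<open>G\<close> in a left-right order: for some terrain \<open>ps\<close>, matching the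
  \<open>i\<close>-th entry of \<open>vs\<close> with the \<open>i\<close>-th terrain vertex is an isomorphism from \<open>G\<close> to the visibility
  graph of \<open>ps\<close>.\<close>

definition left_right_ordering :: "'a pair_pre_digraph \<Rightarrow> 'a list \<Rightarrow> bool" where
  "left_right_ordering G vs \<longleftrightarrow>
     distinct vs \<and> set vs = pverts G \<and>
     (\<exists>ps. terrain ps \<and> length ps = length vs \<and>
        parcs G = {(vs ! i, vs ! j) | i j. i < length vs \<and> j < length vs \<and>
                     (ps ! i, ps ! j) \<in> parcs (visibility_graph ps)})"

definition H_free :: "nat \<Rightarrow> 'a pair_pre_digraph \<Rightarrow> bool" where
  "H_free t G \<longleftrightarrow>
     \<not> (\<exists>a b :: nat \<Rightarrow> 'a.
          inj_on a {1..t} \<and> inj_on b {1..t} \<and> a ` {1..t} \<inter> b ` {1..t} = {} \<and>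
          a ` {1..t} \<subseteq> pverts G \<and> b ` {1..t} \<subseteq> pverts G \<and>
          (\<forall>i \<in> {1..t}. \<forall>j \<in> {1..t}. (a i, b j) \<in> parcs G \<longleftrightarrow> i \<le> j))"

section \<open>Twin-width\<close>

text \<open>Black and red edges are two-element sets of vertices.\<close>

record 'a trigraph =
  tverts :: "'a set"
  black :: "'a set set"
  red :: "'a set set"

definition trigraph_of :: "'a pair_pre_digraph \<Rightarrow> 'a trigraph" where
  "trigraph_of G = \<lparr> tverts = pverts G, black = {{x, y} | x y. (x, y) \<in> parcs G}, red = {} \<rparr>"

text \<open>The vertex that results from contracting \<open>u\<close> and \<open>v\<close> inherits the name \<open>u\<close>.\<close>

definition contract :: "'a trigraph \<Rightarrow> 'a \<Rightarrow> 'a \<Rightarrow> 'a trigraph" where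
  "contract T u v =
     \<lparr> tverts = tverts T - {v},
       black = {e \<in> black T. u \<notin> e \<and> v \<notin> e} \<union>
         {{u, z} | z. z \<in> tverts T - {u, v} \<and> {u, z} \<in> black T \<and> {v, z} \<in> black T},
       red = {e \<in> red T. u \<notin> e \<and> v \<notin> e} \<union>
         {{u, z} | z. z \<in> tverts T - {u, v} \<and>
            ({u, z} \<in> black T \<union> red T \<or> {v, z} \<in> black T \<union> red T) \<and>
            \<not> ({u, z} \<in> black T \<and> {v, z} \<in> black T)} \<rparr>"

definition red_degree_le :: "nat \<Rightarrow> 'a trigraph \<Rightarrow> bool" where
  "red_degree_le d T \<longleftrightarrow> (\<forall>x \<in> tverts T. card {y. {x, y} \<in> red T} \<le> d)"

fun trigraph_d_sequence :: "nat \<Rightarrow> 'a trigraph \<Rightarrow> ('a \<times> 'a) list \<Rightarrow> bool" where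
  "trigraph_d_sequence d T [] \<longleftrightarrow> red_degree_le d T \<and> (\<exists>x. tverts T = {x})"
| "trigraph_d_sequence d T ((u, v) # cs) \<longleftrightarrow>
     red_degree_le d T \<and> u \<in> tverts T \<and> v \<in> tverts T \<and> u \<noteq> v \<and>
     trigraph_d_sequence d (contract T u v) cs"

definition d_sequence :: "nat \<Rightarrow> 'a pair_pre_digraph \<Rightarrow> ('a \<times> 'a) list \<Rightarrow> bool" where
  "d_sequence d G cs \<longleftrightarrow> trigraph_d_sequence d (trigraph_of G) cs"

definition twin_width :: "'a pair_pre_digraph \<Rightarrow> nat" where
  "twin_width G = (LEAST d. \<exists>cs. d_sequence d G cs)"

section \<open>Polynomial-time algorithms\<close>

text \<open>The model of computation is first-order pure Lisp: call-by-value recursive functions over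
  binary trees, following N. D. Jones, Computability and Complexity from a Programming
  Perspective, 1997. Every evaluation step, including the construction of a pair and a function
  call, has unit cost. As trees can be shared in memory, each step takes constant time on a
  pointer machine (a program has fixed arities), so up to a polynomial the cost is the running
  time on a Turing machine, as long as the inputs and outputs have polynomial size.\<close>

datatype sexp = SNil | SCons (car: sexp) (cdr: sexp)
where
  "car SNil = SNil"
| "cdr SNil = SNil"

text \<open>\<^term>\<open>Call f es\<close> calls the \<open>f\<close>-th function of the program; in its body, \<^term>\<open>Arg i\<close> is the
  \<open>i\<close>-th argument. In a conditional, \<^const>\<open>SNil\<close> is false and everything else is true.\<close>

datatype expr =
    Arg nat
  | ENil
  | ECons expr expr
  | ECar expr
  | ECdr expr
  | EIf expr expr expr
  | Call nat "expr list"

type_synonym program = "expr list"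

text \<open>\<^term>\<open>eval P env e x k\<close>: in program \<open>P\<close> and with arguments \<open>env\<close>, the expression \<open>e\<close> evaluates to
  \<open>x\<close> in \<open>k\<close> steps. Non-termination and calls of undefined functions yield no result.\<close>

inductive eval :: "program \<Rightarrow> sexp list \<Rightarrow> expr \<Rightarrow> sexp \<Rightarrow> nat \<Rightarrow> bool"
  and evals :: "program \<Rightarrow> sexp list \<Rightarrow> expr list \<Rightarrow> sexp list \<Rightarrow> nat \<Rightarrow> bool"
  for P :: program
where
  Arg: "i < length env \<Longrightarrow> eval P env (Arg i) (env ! i) 1"
| ENil: "eval P env ENil SNil 1"
| ECons: "eval P env e1 x1 k1 \<Longrightarrow> eval P env e2 x2 k2 \<Longrightarrow>
    eval P env (ECons e1 e2) (SCons x1 x2) (1 + k1 + k2)"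
| ECar: "eval P env e x k \<Longrightarrow> eval P env (ECar e) (car x) (1 + k)"
| ECdr: "eval P env e x k \<Longrightarrow> eval P env (ECdr e) (cdr x) (1 + k)"
| EIf_true: "eval P env b x k1 \<Longrightarrow> x \<noteq> SNil \<Longrightarrow> eval P env e1 y k2 \<Longrightarrow>
    eval P env (EIf b e1 e2) y (1 + k1 + k2)"
| EIf_false: "eval P env b SNil k1 \<Longrightarrow> eval P env e2 y k2 \<Longrightarrow>
    eval P env (EIf b e1 e2) y (1 + k1 + k2)"
| Call: "evals P env es xs k1 \<Longrightarrow> f < length P \<Longrightarrow> eval P xs (P ! f) y k2 \<Longrightarrow>
    eval P env (Call f es) y (1 + k1 + k2)"
| Args_Nil: "evals P env [] [] 0"
| Args_Cons: "eval P env e x k1 \<Longrightarrow> evals P env es xs k2 \<Longrightarrow>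
    evals P env (e # es) (x # xs) (k1 + k2)"

text \<open>The main function is function number 0, which gets the input as its only argument.\<close>

definition runs :: "program \<Rightarrow> sexp \<Rightarrow> sexp \<Rightarrow> nat \<Rightarrow> bool" where
  "runs P x y k \<longleftrightarrow> P \<noteq> [] \<and> eval P [x] (P ! 0) y k"

text \<open>Problem \<open>R\<close> with instances in \<open>I\<close>: for an instance \<open>x \<in> I\<close>, find some \<open>y\<close> with \<open>R x y\<close>. The
  algorithm may rely on the promise that its input encodes an element of \<open>I\<close>. The \<^const>\<open>size\<close> of
  a tree is its number of inner nodes.\<close>

definition poly_time_solvable ::
    "'x set \<Rightarrow> ('x \<Rightarrow> sexp) \<Rightarrow> ('y \<Rightarrow> sexp) \<Rightarrow> ('x \<Rightarrow> 'y \<Rightarrow> bool) \<Rightarrow> bool" where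
  "poly_time_solvable I enc_in enc_out R \<longleftrightarrow>
     (\<exists>(P :: program) (p :: nat poly). \<forall>x \<in> I. \<exists>y k.
        R x y \<and> runs P (enc_in x) (enc_out y) k \<and> k \<le> poly p (size (enc_in x)))"

text \<open>Unary numbers are harmless: vertices of a graph on \<open>{..<n}\<close> then have encodings of size below
  \<open>n\<close>, and the adjacency matrix has size at least \<open>n\<^sup>2\<close> anyway.\<close>

primrec enc_nat :: "nat \<Rightarrow> sexp" where
  "enc_nat 0 = SNil"
| "enc_nat (Suc n) = SCons SNil (enc_nat n)"

definition enc_bool :: "bool \<Rightarrow> sexp" where
  "enc_bool b = (if b then SCons SNil SNil else SNil)"

primrec enc_list :: "('a \<Rightarrow> sexp) \<Rightarrow> 'a list \<Rightarrow> sexp" where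
  "enc_list f [] = SNil"
| "enc_list f (x # xs) = SCons (f x) (enc_list f xs)"

definition enc_pair :: "('a \<Rightarrow> sexp) \<Rightarrow> ('b \<Rightarrow> sexp) \<Rightarrow> 'a \<times> 'b \<Rightarrow> sexp" where
  "enc_pair f g xy = SCons (f (fst xy)) (g (snd xy))"

definition adjacency_matrix :: "nat pair_pre_digraph \<Rightarrow> bool list list" where
  "adjacency_matrix G =
     (let n = card (pverts G) in map (\<lambda>i. map (\<lambda>j. (i, j) \<in> parcs G) [0..<n]) [0..<n])"

definition enc_ordered_graph :: "nat pair_pre_digraph \<times> nat list \<Rightarrow> sexp" where
  "enc_ordered_graph =
     enc_pair (\<lambda>G. enc_list (enc_list enc_bool) (adjacency_matrix G)) (enc_list enc_nat)"

definition enc_contractions :: "(nat \<times> nat) list \<Rightarrow> sexp" where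
  "enc_contractions = enc_list (enc_pair enc_nat enc_nat)"

text \<open>As usual for algorithmic problems on graphs, the vertices of an input graph are numbered
  \<open>0, \<dots>, n - 1\<close>; the numbering is unrelated to the left-right ordering.\<close>

definition H_free_ordered_visibility_graphs :: "nat \<Rightarrow> (nat pair_pre_digraph \<times> nat list) set" where
  "H_free_ordered_visibility_graphs t =
     {(G, vs). (\<exists>n. pverts G = {..<n}) \<and> left_right_ordering G vs \<and> H_free t G}"

lemma pair_graph_visibility_graph: "pair_graph (visibility_graph ps)"
proof
  have "parcs (visibility_graph ps) \<subseteq> set ps \<times> set ps"
    by (auto simp: visibility_graph_def)
  then show "finite (parcs (visibility_graph ps))"
    by (rule finite_subset) simp
  have "sym (parcs (visibility_graph ps))"
    by (auto intro!: symI simp: visibility_graph_def sees_def closed_segment_commute)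
  then show "symmetric (visibility_graph ps)"
    by (simp add: symmetric_def arcs_ends_def arc_to_ends_def)
qed (auto simp: visibility_graph_def)

lemma inj_enc_nat: "inj enc_nat"
proof (rule injI)
  show "x = y" if "enc_nat x = enc_nat y" for x y
    using that
  proof (induction x arbitrary: y)
    case 0 then show ?case by (cases y) simp_all
  next
    case (Suc x) then show ?case by (cases y) auto
  qed
qed

lemma inj_enc_list:
  assumes "inj f"
  shows "inj (enc_list f)"
proof (rule injI)
  show "xs = ys" if "enc_list f xs = enc_list f ys" for xs ys
    using that
  proof (induction xs arbitrary: ys)
    case Nil then show ?case by (cases ys) simp_all
  next
    case (Cons x xs) then show ?case by (cases ys) (auto simp: inj_eq[OF assms])
  qed
qed

lemma inj_enc_contractions: "inj enc_contractions"
  unfolding enc_contractions_def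
  by (intro inj_enc_list injI) (simp add: enc_pair_def prod_eq_iff inj_eq[OF inj_enc_nat])

end

theory Submission
  imports Defs
begin

text \<open>The left-right order of a terrain satisfies the order claim: if \<open>a < b < c < d\<close> and \<open>ac\<close>, \<open>bd\<close>
  are edges, then \<open>ad\<close> is an edge. Only this and the absence of \<open>H\<^sub>t\<close> are used.

  Consider a partition of the order into intervals. An interval \<open>J\<close> is a start of \<open>I\<close> if some vertex
  of \<open>I\<close> has a neighbour in \<open>J\<close> but none in the intervals between \<open>I\<close> and \<open>J\<close>. Pairwise crossing
  pairs \<open>(I, J)\<close> of this kind would span a half-graph by the order claim, so a Marcus-Tardos argument
  bounds their number linearly. On average an interval thus has boundedly many starts, and two
  consecutive intervals can be merged such that their union has at most \<open>K\<close> starts on either side.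

  Two vertices of \<open>I\<close> are equivalent if they have the same neighbours in all \<open>J\<close>, except for those
  \<open>J\<close> that are a start of \<open>I\<close> and have \<open>I\<close> as a start themselves. Beyond the first neighbours of the
  vertices of \<open>I\<close>, the order claim makes neighbourhoods nested, and nested neighbourhoods have at
  most \<open>t\<close> different values; hence the number of classes is bounded. Merging intervals only coarsens the
  equivalence. Contracting each class to a vertex leaves red edges only inside an interval and between
  intervals that are starts of each other, so the red degree remains bounded.\<close>

section \<open>Ordered graphs without large pairwise crossing families\<close>

text \<open>Agreement can be demanded only where an interval \<open>I\<close> has few traces on
  \<open>J\<close>. If \<open>J\<close> is no start of \<open>I\<close>, every vertex of
  \<open>I\<close> with a neighbour in \<open>J\<close> has one in an interval before it, and
  grouping the vertices by the first such interval makes the traces nested. If \<open>J\<close> is a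
  start of \<open>I\<close> but not conversely, the same reasoning applies from the side of
  \<open>J\<close>, and \<open>s\<close> distinct columns of an adjacency matrix leave at most
  \<open>2 ^ s\<close> distinct rows. Mutual starts (\<open>dbl\<close>) escape both arguments; they
  may turn red, which the bound on the number of starts makes affordable. The exemption is stable:
  mutual starts stay mutual when one of them absorbs an adjacent interval, so equivalent vertices
  stay equivalent.

  The counting of starts concerns the union of two consecutive intervals, because it is the merged
  interval whose starts must be few; such unions overlap, whence the parameter \<open>2 * t\<close>
  instead of \<open>t\<close>. The recursion for crossing-free sets contracts since blocks have
  width \<open>t\<^sup>2\<close>, while a block with fewer than \<open>t\<close> nonempty rows and
  columns has at most \<open>(t - 1)\<^sup>2\<close> entries.\<close>

definition crossing_free :: "nat \<Rightarrow> (nat \<times> nat) set \<Rightarrow> bool" where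
  "crossing_free t H \<longleftrightarrow>
     \<not> (\<exists>a b :: nat \<Rightarrow> nat. (\<forall>s<t. (a s, b s) \<in> H) \<and>
          (\<forall>s<t. \<forall>r<s. a r < a s \<and> b r < b s) \<and> (\<forall>s<t. \<forall>r<t. a r < b s))"

lemma finite_nat_set_enum:
  fixes A :: "nat set"
  assumes "finite A" "t \<le> card A"
  obtains f where "\<And>s. s < t \<Longrightarrow> f s \<in> A" "\<And>r s. s < t \<Longrightarrow> r < s \<Longrightarrow> f r < f s"
proof
  let ?f = "\<lambda>s. sorted_list_of_set A ! s"
  show "?f s \<in> A" if "s < t" for s
    using that assms by (metis nth_mem order_less_le_trans sorted_list_of_set.length_sorted_key_list_of_set set_sorted_list_of_set)
  show "?f r < ?f s" if "s < t" "r < s" for r s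
    using that assms by (simp add: sorted_wrt_nth_less[OF sorted_list_of_set.strict_sorted_key_list_of_set])
qed

lemma large_fiber:
  fixes F :: "'a \<Rightarrow> 'b set"
  assumes "finite X" "finite U" "\<And>x. x \<in> X \<Longrightarrow> F x \<subseteq> U" "card X > t * 2 ^ card U"
  obtains S where "S \<subseteq> U" "t \<le> card {x \<in> X. F x = S}"
proof -
  have "\<exists>S\<in>Pow U. t \<le> card {x \<in> X. F x = S}"
  proof (rule ccontr)
    assume *: "\<not> ?thesis"
    have "X = (\<Union>S\<in>Pow U. {x \<in> X. F x = S})" using assms(3) by blast
    then have "card X \<le> (\<Sum>S\<in>Pow U. card {x \<in> X. F x = S})"
      using card_UN_le[of "Pow U" "\<lambda>S. {x \<in> X. F x = S}"] assms(2) by simp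
    also have "\<dots> \<le> (\<Sum>S\<in>Pow U. t)" using * by (intro sum_mono) (meson nat_le_linear)
    also have "\<dots> = t * 2 ^ card U" using assms(2) by (simp add: card_Pow)
    finally show False using assms(4) by simp
  qed
  then show thesis using that by blast
qed

text \<open>Division by 0 yields 0, so the set in the second fact carries \<open>0 < w\<close> to be
  finite for every \<open>w\<close>.\<close>

lemma block_card: "0 < w \<Longrightarrow> card {j::nat. j div w = J} = w" "finite {j::nat. 0 < w \<and> j div w = J}"
proof -
  have *: "{j. j div w = J} = {J*w..<J*w+w}" if "0 < w" for w
    using that by (auto simp: div_nat_eqI  mult.commute) (metis dividend_less_times_div mult.commute add.commute)+
  show "0 < w \<Longrightarrow> card {j::nat. j div w = J} = w" by (simp add: *)
  show "finite {j::nat. 0 < w \<and> j div w = J}" using * by (cases "0<w") auto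
qed

lemma div_less_imp: "(i::nat) div w < j div w \<Longrightarrow> i < j"
  by (meson div_le_mono leD leI)

text \<open>The Marcus-Tardos step. Diagonal blocks are set aside (\<open>n * w\<close>), because
  inside them the block indices do not force rows to precede columns. Blocks with \<open>t\<close>
  nonempty columns (\<open>W\<close>) or \<open>t\<close> nonempty rows (\<open>V\<close>) may be
  full, but there are only \<open>m * (t * 2 ^ w)\<close> of either kind. All other blocks are
  sparse and are charged to \<open>H'\<close>.\<close>

lemma crossing_free_step:
  assumes t: "2 \<le> t" and H: "H \<subseteq> {(i, j). i < j \<and> j < n}" and cf: "crossing_free t H"
    and w: "w = t\<^sup>2" and m: "m = n div w + 1"
  defines "H' \<equiv> {(i div w, j div w) | i j. (i, j) \<in> H \<and> i div w < j div w}"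
  shows "H' \<subseteq> {(i, j). i < j \<and> j < m}" "crossing_free t H'"
    "card H \<le> n * w + 2 * (m * (t * 2 ^ w) * w\<^sup>2) + card H' * (t - 1)\<^sup>2"
proof -
  have w0: "0 < w" using t w by simp
  have fin: "finite H" by (rule finite_subset[OF H]) (rule finite_subset[of _ "{..<n} \<times> {..<n}"], auto)
  show H'm: "H' \<subseteq> {(i, j). i < j \<and> j < m}"
    using H unfolding H'_def m by (auto simp: div_le_mono less_imp_le le_imp_less_Suc dest!: subsetD)
  have fin': "finite H'" by (rule finite_subset[OF H'm]) (rule finite_subset[of _ "{..<m} \<times> {..<m}"], auto)
  show "crossing_free t H'"
    unfolding crossing_free_def
  proof safe
    fix a b :: "nat \<Rightarrow> nat"
    assume ab: "\<forall>s<t. (a s, b s) \<in> H'" "\<forall>s<t. \<forall>r<s. a r < a s \<and> b r < b s" "\<forall>s<t. \<forall>r<t. a r < b s"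
    \<comment> \<open>Entries chosen arbitrarily from crossing blocks cross, since a strict order of
      block indices passes to the entries.\<close>
    have "\<forall>s. \<exists>p. s < t \<longrightarrow> p \<in> H \<and> fst p div w = a s \<and> snd p div w = b s"
      using ab(1) by (auto simp: H'_def) (metis fst_conv snd_conv)
    then obtain p where p: "\<And>s. s < t \<Longrightarrow> p s \<in> H \<and> fst (p s) div w = a s \<and> snd (p s) div w = b s"
      by metis
    have "\<not> crossing_free t H"
      unfolding crossing_free_def not_not
    proof (rule exI[of _ "fst \<circ> p"], rule exI[of _ "snd \<circ> p"], intro conjI allI impI)
      show "(fst \<circ> p) r < (snd \<circ> p) s" if "s < t" "r < t" for r s
        using p[OF that(1)] p[OF that(2)] ab(3) that by - (rule div_less_imp[where w = w], simp)
      show "(fst \<circ> p) r < (fst \<circ> p) s" if "s < t" "r < s" for r s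
        using p[OF that(1)] p[of r] ab(2) that by - (rule div_less_imp[where w = w], simp)
      show "(snd \<circ> p) r < (snd \<circ> p) s" if "s < t" "r < s" for r s
        using p[OF that(1)] p[of r] ab(2) that by - (rule div_less_imp[where w = w], simp)
    qed (use p in simp)
    with cf show False by simp
  qed
  define blk where "blk I J = {(i, j) \<in> H. i div w = I \<and> j div w = J}" for I J
  define rows where "rows I J = fst ` blk I J" for I J
  define cols where "cols I J = snd ` blk I J" for I J
  have finb: "finite (blk I J)" for I J unfolding blk_def by (rule finite_subset[OF _ fin]) auto
  have blk_sub: "blk I J \<subseteq> rows I J \<times> cols I J" for I J unfolding rows_def cols_def by force
  have rows_sub: "rows I J \<subseteq> {i. i div w = I}" and cols_sub: "cols I J \<subseteq> {j. j div w = J}" for I J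
    by (auto simp: rows_def cols_def blk_def)
  have finblock: "finite {j. j div w = J}" for J using block_card(2)[of w J] w0 by simp
  have crows: "card (rows I J) \<le> w" and ccols: "card (cols I J) \<le> w" for I J
    using card_mono[OF finblock rows_sub] card_mono[OF finblock cols_sub] block_card(1)[OF w0] by auto
  have cblk: "card (blk I J) \<le> card (rows I J) * card (cols I J)" for I J
    using card_mono[OF _ blk_sub] finb by (auto simp: rows_def cols_def card_cartesian_product)
  have cblk_w: "card (blk I J) \<le> w\<^sup>2" for I J
    using cblk[of I J] mult_mono[OF crows[of I J] ccols[of I J]] by (simp add: power2_eq_square)
  define W where "W = {(I, J) \<in> H'. t \<le> card (cols I J)}"
  define V where "V = {(I, J) \<in> H'. t \<le> card (rows I J)}"
  \<comment> \<open>Otherwise \<open>t\<close> blocks of the block column \<open>J\<close> have the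
    same set \<open>S\<close> of nonempty columns. An entry in the \<open>s\<close>-th column of
    \<open>S\<close> is taken from the \<open>s\<close>-th block: rows increase with the blocks,
    columns within \<open>S\<close>, and all rows precede the block \<open>J\<close>.\<close>
  have W_col: "card {I. (I, J) \<in> W} \<le> t * 2 ^ w" for J
  proof (rule ccontr)
    assume "\<not> ?thesis"
    then have gt: "card {I. (I, J) \<in> W} > t * 2 ^ card {j. j div w = J}" using block_card(1)[OF w0] by simp
    have fX: "finite {I. (I, J) \<in> W}"
      by (rule finite_subset[of _ "fst ` H'"]) (force simp: W_def fin')+
    obtain S where S: "S \<subseteq> {j. j div w = J}" "t \<le> card {I \<in> {I. (I, J) \<in> W}. cols I J = S}"
      by (rule large_fiber[OF fX finblock, of "\<lambda>I. cols I J" J t, OF cols_sub gt])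
    have finS: "finite S" using S(1) finblock finite_subset by blast
    obtain I where I: "\<And>s. s < t \<Longrightarrow> (I s, J) \<in> W \<and> cols (I s) J = S" "\<And>r s. s < t \<Longrightarrow> r < s \<Longrightarrow> I r < I s"
      using finite_nat_set_enum[OF _ S(2)] fX by auto
    have "t \<le> card S" using I(1)[of 0] t by (auto simp: W_def)
    then obtain b where b: "\<And>s. s < t \<Longrightarrow> b s \<in> S" "\<And>r s. s < t \<Longrightarrow> r < s \<Longrightarrow> b r < b s"
      using finite_nat_set_enum[OF finS] by metis
    have "\<forall>s. \<exists>a. s < t \<longrightarrow> (a, b s) \<in> H \<and> a div w = I s"
      using I(1) b(1) by (fastforce simp: cols_def blk_def image_iff)
    then obtain a where a: "\<And>s. s < t \<Longrightarrow> (a s, b s) \<in> H \<and> a s div w = I s" by metis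
    have IJ: "I s < J" if "s < t" for s using I(1)[OF that] H'm by (auto simp: W_def)
    have "\<not> crossing_free t H"
      unfolding crossing_free_def not_not
    proof (rule exI[of _ a], rule exI[of _ b], intro conjI allI impI)
      show "a r < b s" if "s < t" "r < t" for r s
        using a[OF that(2)] IJ[OF that(2)] S(1) b(1)[OF that(1)] by - (rule div_less_imp[where w = w], auto)
      show "a r < a s" if "s < t" "r < s" for r s
        using a[OF that(1)] a[of r] I(2)[OF that] that by - (rule div_less_imp[where w = w], simp)
    qed (use a b in simp_all)
    with cf show False by simp
  qed
  have V_row: "card {J. (I, J) \<in> V} \<le> t * 2 ^ w" for I
  proof (rule ccontr)
    assume "\<not> ?thesis"
    then have gt: "card {J. (I, J) \<in> V} > t * 2 ^ card {j. j div w = I}" using block_card(1)[OF w0] by simp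
    have fX: "finite {J. (I, J) \<in> V}"
      by (rule finite_subset[of _ "snd ` H'"]) (force simp: V_def fin')+
    obtain S where S: "S \<subseteq> {j. j div w = I}" "t \<le> card {J \<in> {J. (I, J) \<in> V}. rows I J = S}"
      by (rule large_fiber[OF fX finblock, of "\<lambda>J. rows I J" I t, OF rows_sub gt])
    have finS: "finite S" using S(1) finblock finite_subset by blast
    obtain J where J: "\<And>s. s < t \<Longrightarrow> (I, J s) \<in> V \<and> rows I (J s) = S" "\<And>r s. s < t \<Longrightarrow> r < s \<Longrightarrow> J r < J s"
      using finite_nat_set_enum[OF _ S(2)] fX by auto
    have "t \<le> card S" using J(1)[of 0] t by (auto simp: V_def)
    then obtain a where a: "\<And>s. s < t \<Longrightarrow> a s \<in> S" "\<And>r s. s < t \<Longrightarrow> r < s \<Longrightarrow> a r < a s"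
      using finite_nat_set_enum[OF finS] by metis
    have "\<forall>s. \<exists>b. s < t \<longrightarrow> (a s, b) \<in> H \<and> b div w = J s"
      using J(1) a(1) by (fastforce simp: rows_def blk_def image_iff)
    then obtain b where b: "\<And>s. s < t \<Longrightarrow> (a s, b s) \<in> H \<and> b s div w = J s" by metis
    have IJ: "I < J s" if "s < t" for s using J(1)[OF that] H'm by (auto simp: V_def)
    have "\<not> crossing_free t H"
      unfolding crossing_free_def not_not
    proof (rule exI[of _ a], rule exI[of _ b], intro conjI allI impI)
      show "a r < b s" if "s < t" "r < t" for r s
        using b[OF that(1)] IJ[OF that(1)] S(1) a(1)[OF that(2)] by - (rule div_less_imp[where w = w], auto)
      show "b r < b s" if "s < t" "r < s" for r s
        using b[OF that(1)] b[of r] J(2)[OF that] that by - (rule div_less_imp[where w = w], simp)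
    qed (use a b in simp_all)
    with cf show False by simp
  qed
  have subm: "W \<subseteq> {..<m} \<times> {..<m}" "V \<subseteq> {..<m} \<times> {..<m}" using H'm by (auto simp: W_def V_def)
  then have finWV: "finite W" "finite V" by (auto intro: finite_subset)
  have "card W \<le> (\<Sum>J<m. card {I. (I, J) \<in> W})"
  proof -
    have "W = (\<Union>J<m. (\<lambda>I. (I, J)) ` {I. (I, J) \<in> W})" using subm by auto
    then have "card W \<le> (\<Sum>J<m. card ((\<lambda>I. (I, J)) ` {I. (I, J) \<in> W}))"
      using card_UN_le[of "{..<m}" "\<lambda>J. (\<lambda>I. (I, J)) ` {I. (I, J) \<in> W}"] by simp
    then show ?thesis by (simp add: card_image inj_on_def)
  qed
  then have cW: "card W \<le> m * (t * 2 ^ w)"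
    using sum_bounded_above[of "{..<m}" "\<lambda>J. card {I. (I, J) \<in> W}" "t * 2 ^ w"] W_col by simp
  have "card V \<le> (\<Sum>I<m. card {J. (I, J) \<in> V})"
  proof -
    have "V = (\<Union>I<m. (\<lambda>J. (I, J)) ` {J. (I, J) \<in> V})" using subm by auto
    then have "card V \<le> (\<Sum>I<m. card ((\<lambda>J. (I, J)) ` {J. (I, J) \<in> V}))"
      using card_UN_le[of "{..<m}" "\<lambda>I. (\<lambda>J. (I, J)) ` {J. (I, J) \<in> V}"] by simp
    then show ?thesis by (simp add: card_image inj_on_def)
  qed
  then have cV: "card V \<le> m * (t * 2 ^ w)"
    using sum_bounded_above[of "{..<m}" "\<lambda>I. card {J. (I, J) \<in> V}" "t * 2 ^ w"] V_row by simp
  define D where "D = {(i, j) \<in> H. i div w = j div w}"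
  have finD: "finite D" by (rule finite_subset[OF _ fin]) (auto simp: D_def)
  have "D \<subseteq> Sigma {..<n} (\<lambda>i. {j. j div w = i div w})" using H by (auto simp: D_def)
  then have "card D \<le> card (Sigma {..<n} (\<lambda>i. {j. j div w = i div w}))"
    by (intro card_mono finite_SigmaI finblock) auto
  then have cD: "card D \<le> n * w"
    using block_card(1)[OF w0] finblock by (simp add: card_SigmaI)
  define R where "R = H' - W - V"
  have cU: "card (\<Union>x\<in>X. blk (fst x) (snd x)) \<le> card X * q"
    if "finite X" "\<And>x. x \<in> X \<Longrightarrow> card (blk (fst x) (snd x)) \<le> q" for X q
    using card_UN_le[OF that(1), of "\<lambda>x. blk (fst x) (snd x)"]
      sum_bounded_above[of X "\<lambda>x. card (blk (fst x) (snd x))" q] that(2) by force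
  have small: "card (blk (fst x) (snd x)) \<le> (t - 1)\<^sup>2" if "x \<in> R" for x
  proof -
    have "card (rows (fst x) (snd x)) \<le> t - 1" "card (cols (fst x) (snd x)) \<le> t - 1"
      using that by (auto simp: R_def W_def V_def split: prod.splits)
    from mult_mono[OF this] cblk[of "fst x" "snd x"] show ?thesis by (simp add: power2_eq_square)
  qed
  have "H \<subseteq> D \<union> (\<Union>x\<in>W. blk (fst x) (snd x)) \<union> (\<Union>x\<in>V. blk (fst x) (snd x)) \<union> (\<Union>x\<in>R. blk (fst x) (snd x))"
  proof
    fix x assume x: "x \<in> H"
    obtain i j where ij: "x = (i, j)" by force
    have "i div w \<le> j div w" using x H ij by (auto intro!: div_le_mono)
    then consider "i div w = j div w" | "(i div w, j div w) \<in> H'"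
      using x ij by (fastforce simp: H'_def)
    then show "x \<in> D \<union> (\<Union>x\<in>W. blk (fst x) (snd x)) \<union> (\<Union>x\<in>V. blk (fst x) (snd x)) \<union> (\<Union>x\<in>R. blk (fst x) (snd x))"
    proof cases
      case 1 then show ?thesis using x ij by (simp add: D_def)
    next
      case 2
      have "x \<in> blk (i div w) (j div w)" using x ij by (simp add: blk_def)
      moreover have "(i div w, j div w) \<in> W \<union> V \<union> R" using 2 by (auto simp: R_def)
      ultimately show ?thesis by force
    qed
  qed
  then have "card H \<le> card (D \<union> (\<Union>x\<in>W. blk (fst x) (snd x)) \<union> (\<Union>x\<in>V. blk (fst x) (snd x)) \<union> (\<Union>x\<in>R. blk (fst x) (snd x)))"
    using finWV finb finD fin' by (intro card_mono) (auto simp: R_def)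
  also have "\<dots> \<le> card D + card (\<Union>x\<in>W. blk (fst x) (snd x)) + card (\<Union>x\<in>V. blk (fst x) (snd x)) + card (\<Union>x\<in>R. blk (fst x) (snd x))"
    using card_Un_le by (meson add_le_mono1 le_trans)
  also have "\<dots> \<le> n * w + (m * (t * 2 ^ w)) * w\<^sup>2 + (m * (t * 2 ^ w)) * w\<^sup>2 + card H' * (t - 1)\<^sup>2"
  proof (intro add_mono cD)
    show "card (\<Union>x\<in>W. blk (fst x) (snd x)) \<le> (m * (t * 2 ^ w)) * w\<^sup>2"
      using le_trans[OF cU[OF finWV(1) cblk_w] mult_le_mono1[OF cW]] .
    show "card (\<Union>x\<in>V. blk (fst x) (snd x)) \<le> (m * (t * 2 ^ w)) * w\<^sup>2"
      using le_trans[OF cU[OF finWV(2) cblk_w] mult_le_mono1[OF cV]] .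
    have finR: "finite R" using fin' by (simp add: R_def)
    have "card R \<le> card H'" using fin' by (auto simp: R_def intro!: card_mono)
    then show "card (\<Union>x\<in>R. blk (fst x) (snd x)) \<le> card H' * (t - 1)\<^sup>2"
      using le_trans[OF cU[OF finR small] mult_le_mono1] by blast
  qed
  finally show "card H \<le> n * w + 2 * (m * (t * 2 ^ w) * w\<^sup>2) + card H' * (t - 1)\<^sup>2" by simp
qed

text \<open>Solves the recursion of \<open>crossing_free_step\<close> by strong induction. In
  \<open>C\<close>, the summand \<open>w\<^sup>2\<close> covers both the trivial bound
  \<open>n * n\<close> for \<open>n < w\<^sup>2\<close> and the diagonal blocks;
  \<open>4 * D\<close> covers the two kinds of dense blocks, as
  \<open>m * w \<le> n + w \<le> 2 * n\<close>.\<close>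

lemma crossing_free_linear:
  assumes t: "2 \<le> t"
  obtains C where "\<And>n H. H \<subseteq> {(i, j). i < j \<and> j < n} \<Longrightarrow> crossing_free t H \<Longrightarrow> card H \<le> C * n"
proof -
  define w where "w = t\<^sup>2"
  define D where "D = t * 2 ^ w * w\<^sup>2"
  define C where "C = w\<^sup>2 + 4 * D"
  have w4: "4 \<le> w" using power_mono[OF t, of 2] by (simp add: w_def)
  have "card H \<le> C * n" if "H \<subseteq> {(i, j). i < j \<and> j < n}" "crossing_free t H" for n H
    using that
  proof (induction n arbitrary: H rule: less_induct)
    case (less n)
    show ?case
    proof (cases "n < w\<^sup>2")
      case True
      have "card H \<le> card ({..<n} \<times> {..<n})" using less.prems(1) by (intro card_mono) auto
      also have "\<dots> \<le> w\<^sup>2 * n" using True by (simp add: card_cartesian_product)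
      finally show ?thesis by (simp add: C_def add_mult_distrib)
    next
      case False
      define m where "m = n div w + 1"
      define H' where "H' = {(i div w, j div w) | i j. (i, j) \<in> H \<and> i div w < j div w}"
      note step = crossing_free_step[OF t less.prems w_def m_def, folded H'_def]
      have nw: "w * w \<le> n" using False by (simp add: power2_eq_square)
      have mw: "m * w \<le> n + w" by (simp add: m_def)
      have "2 * m \<le> n"
      proof -
        have "4 * m \<le> m * w" using w4 by simp
        moreover have "4 * w \<le> n" using nw w4 by (meson le_trans mult_le_mono1)
        ultimately show ?thesis using mw by linarith
      qed
      moreover have "0 < n" using nw w4 by (cases n) auto
      ultimately have "m < n" by linarith
      then have IH: "card H' \<le> C * m" using less.IH step(1,2) by blast
      obtain s where s: "t = Suc s" using t by (cases t) auto
      have ws: "w = s\<^sup>2 + 2 * s + 1" by (simp add: w_def s power2_eq_square)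
      \<comment> \<open>The slack of the recursion: \<open>w\<close> exceeds
        \<open>s\<^sup>2\<close> by more than \<open>2 * s\<close>. One copy of \<open>n\<close>
        covers the rounding error \<open>s\<^sup>2 * w\<close>, another one pays for the diagonal
        and the dense blocks.\<close>
      have sw: "s\<^sup>2 * w + (s\<^sup>2 * n + n) \<le> w * n"
      proof -
        have "s\<^sup>2 * w \<le> n" using nw ws by (metis add.commute le_add1 le_trans mult_le_mono1 add.assoc)
        moreover have "1 * n \<le> s * n" using t s by (intro mult_le_mono1) simp
        moreover have "w * n = s\<^sup>2 * n + 2 * (s * n) + n" using ws by (simp add: algebra_simps)
        ultimately show ?thesis by linarith
      qed
      have "card H \<le> n * w + 2 * (m * D) + card H' * s\<^sup>2"
        using step(3) by (simp add: D_def s mult.assoc)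
      also have "\<dots> \<le> n * w + 2 * (m * D) + C * m * s\<^sup>2"
        using mult_right_mono[OF IH, of "s\<^sup>2"] by simp
      \<comment> \<open>After multiplication by \<open>w\<close>, the number \<open>m\<close> of
        blocks occurs only in \<open>m * w \<le> n + w\<close>, so no division is left.\<close>
      finally have "w * card H \<le> w * (n * w + 2 * (m * D) + C * m * s\<^sup>2)"
        by (rule mult_left_mono) simp
      also have "\<dots> = n * w\<^sup>2 + 2 * D * (m * w) + C * s\<^sup>2 * (m * w)"
        by (simp add: algebra_simps power2_eq_square)
      also have "\<dots> \<le> n * w\<^sup>2 + 2 * D * (n + w) + C * s\<^sup>2 * (n + w)"
        by (intro add_mono mult_left_mono mw) auto
      also have "\<dots> \<le> n * w\<^sup>2 + 4 * D * n + C * (s\<^sup>2 * w + s\<^sup>2 * n)"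
      proof -
        have "w \<le> n" using nw w4 by (metis le_trans le_square)
        then have "2 * D * (n + w) \<le> 4 * D * n" using mult_left_mono[of w n "2 * D"] by (simp add: algebra_simps)
        then show ?thesis by (simp add: algebra_simps)
      qed
      also have "\<dots> = C * (s\<^sup>2 * w + (s\<^sup>2 * n + n))" by (simp add: C_def algebra_simps)
      also have "\<dots> \<le> C * (w * n)" by (rule mult_left_mono[OF sw]) simp
      finally have "w * card H \<le> w * (C * n)" by (simp add: algebra_simps)
      then show ?thesis using w4 by simp
    qed
  qed
  then show thesis using that by blast
qed

section \<open>Interval partitions of ordered graphs\<close>

definition hasnb :: "('a \<Rightarrow> 'a \<Rightarrow> bool) \<Rightarrow> 'a \<Rightarrow> 'a list \<Rightarrow> bool" where
  "hasnb E c J \<longleftrightarrow> (\<exists>y\<in>set J. E c y)"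

definition hasnbs :: "('a \<Rightarrow> 'a \<Rightarrow> bool) \<Rightarrow> 'a \<Rightarrow> 'a list list \<Rightarrow> bool" where
  "hasnbs E c B \<longleftrightarrow> (\<exists>J\<in>set B. hasnb E c J)"

text \<open>Below, \<open>B\<close> always lists the intervals between \<open>I\<close> and \<open>J\<close> (or \<open>R\<close>), and \<open>R\<close> may be the list of
  intervals to the right of \<open>I\<close> or, in reverse order, to its left.\<close>

definition start :: "('a \<Rightarrow> 'a \<Rightarrow> bool) \<Rightarrow> 'a list \<Rightarrow> 'a list list \<Rightarrow> 'a list \<Rightarrow> bool" where
  "start E I B J \<longleftrightarrow> (\<exists>c\<in>set I. hasnb E c J \<and> \<not> hasnbs E c B)"

definition dbl :: "('a \<Rightarrow> 'a \<Rightarrow> bool) \<Rightarrow> 'a list \<Rightarrow> 'a list list \<Rightarrow> 'a list \<Rightarrow> bool" where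
  "dbl E I B J \<longleftrightarrow> start E I B J \<and> start E J B I"

fun cnt :: "('a \<Rightarrow> 'a \<Rightarrow> bool) \<Rightarrow> 'a list \<Rightarrow> 'a list list \<Rightarrow> 'a list list \<Rightarrow> nat" where
  "cnt E I B [] = 0"
| "cnt E I B (J # R) = (if start E I B J then 1 else 0) + cnt E I (J # B) R"

text \<open>The vertices on which equivalent vertices of \<open>I\<close> are required to agree.\<close>

fun req :: "('a \<Rightarrow> 'a \<Rightarrow> bool) \<Rightarrow> 'a list \<Rightarrow> 'a list list \<Rightarrow> 'a list list \<Rightarrow> 'a set" where
  "req E I B [] = {}"
| "req E I B (J # R) = (if dbl E I B J then {} else set J) \<union> req E I (J # B) R"

text \<open>\<open>req\<close> is split by the reason why \<open>I\<close> has few traces: on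
  \<open>req1\<close> the traces are nested as seen from \<open>I\<close>; on \<open>req2\<close>
  they are nested as seen from the other interval.\<close>

fun req1 :: "('a \<Rightarrow> 'a \<Rightarrow> bool) \<Rightarrow> 'a list \<Rightarrow> 'a list list \<Rightarrow> 'a list list \<Rightarrow> 'a set" where
  "req1 E I B [] = {}"
| "req1 E I B (J # R) = (if start E I B J then {} else set J) \<union> req1 E I (J # B) R"

fun req2 :: "('a \<Rightarrow> 'a \<Rightarrow> bool) \<Rightarrow> 'a list \<Rightarrow> 'a list list \<Rightarrow> 'a list list \<Rightarrow> 'a set" where
  "req2 E I B [] = {}"
| "req2 E I B (J # R) = (if start E I B J \<and> \<not> start E J B I then set J else {}) \<union> req2 E I (J # B) R"

lemma req_split: "req E I B R = req1 E I B R \<union> req2 E I B R"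
  by (induction R arbitrary: B) (auto simp: dbl_def)

text \<open>The intervals in between matter only through their union, so they may be listed in
  either direction and be glued together.\<close>

lemma start_cong:
  assumes "set I = set I'" "\<Union>(set ` set B) = \<Union>(set ` set B')" "set J = set J'"
  shows "start E I B J = start E I' B' J'"
proof -
  have "hasnbs E c B \<longleftrightarrow> (\<exists>y\<in>\<Union>(set ` set B). E c y)" for c B
    by (auto simp: hasnbs_def hasnb_def)
  then show ?thesis
    unfolding start_def hasnb_def by (simp only: assms)
qed

lemma dbl_cong: "set I = set I' \<Longrightarrow> \<Union>(set ` set B) = \<Union>(set ` set B') \<Longrightarrow> set J = set J' \<Longrightarrow>
    dbl E I B J = dbl E I' B' J'"
  unfolding dbl_def by (metis start_cong)

lemma cnt_cong: "set I = set I' \<Longrightarrow> \<Union>(set ` set B) = \<Union>(set ` set B') \<Longrightarrow> cnt E I B R = cnt E I' B' R"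
proof (induction R arbitrary: B B')
  case (Cons J R)
  have "start E I B J = start E I' B' J" using Cons.prems by (intro start_cong) auto
  moreover have "cnt E I (J # B) R = cnt E I' (J # B') R" using Cons.prems by (intro Cons.IH) auto
  ultimately show ?case by simp
qed simp

lemma req_cong: "set I = set I' \<Longrightarrow> \<Union>(set ` set B) = \<Union>(set ` set B') \<Longrightarrow> req E I B R = req E I' B' R"
proof (induction R arbitrary: B B')
  case (Cons J R)
  have "dbl E I B J = dbl E I' B' J" using Cons.prems by (intro dbl_cong) auto
  moreover have "req E I (J # B) R = req E I' (J # B') R" using Cons.prems by (intro Cons.IH) auto
  ultimately show ?case by simp
qed simp

lemma req1_subset: "req1 E I B R \<subseteq> \<Union>(set ` set R)"
proof (induction R arbitrary: B)
  case (Cons J R)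
  then show ?case using Cons[of "J # B"] by auto
qed simp

lemma req_append: "req E I B (R @ R') = req E I B R \<union> req E I (rev R @ B) R'"
  by (induction R arbitrary: B) auto

lemma req1_append: "req1 E I B (R @ R') = req1 E I B R \<union> req1 E I (rev R @ B) R'"
  by (induction R arbitrary: B) auto

lemma cnt_append: "cnt E I B (R @ R') = cnt E I B R + cnt E I (rev R @ B) R'"
  by (induction R arbitrary: B) auto

subsection \<open>Merging two consecutive intervals\<close>

lemma start_merge_row: "start E (I @ I') B J \<longleftrightarrow> start E I B J \<or> start E I' B J"
  by (auto simp: start_def)

text \<open>A vertex of \<open>J\<close> that has a neighbour in \<open>I'\<close> and none in
  \<open>B\<close> either has one in \<open>I\<close> too, or reaches \<open>I'\<close> past
  \<open>I\<close>.\<close>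

lemma start_merge_col: "start E J B (I @ I') \<longleftrightarrow> start E J B I \<or> start E J (I # B) I'"
  unfolding start_def hasnbs_def hasnb_def by simp blast

lemma start_col_right: "start E J B I' \<Longrightarrow> start E J B (I @ I')"
  by (auto simp: start_def hasnb_def)

lemma start_antimono: "start E I (X # B) J \<Longrightarrow> start E I B J"
  by (auto simp: start_def hasnbs_def)

lemma cnt_merge: "cnt E J B (X @ (I @ I') # R) \<le> cnt E J B (X @ I # I' # R)"
proof -
  have "cnt E J ((I @ I') # rev X @ B) R = cnt E J (I' # I # rev X @ B) R"
    by (rule cnt_cong) auto
  then show ?thesis
    by (auto simp: cnt_append start_merge_col)
qed

text \<open>Seen from a third interval \<open>J\<close>: if \<open>I\<close> or \<open>I'\<close> is
  a mutual start with \<open>J\<close>, so is their union, hence no new vertex enters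
  \<open>req\<close>.\<close>

lemma req_merge: "req E J B (X @ (I @ I') # R) \<subseteq> req E J B (X @ I # I' # R)"
proof -
  have "req E J ((I @ I') # rev X @ B) R = req E J (I' # I # rev X @ B) R"
    by (rule req_cong) auto
  moreover have "dbl E J A I \<Longrightarrow> dbl E J A (I @ I')" "dbl E J (I # A) I' \<Longrightarrow> dbl E J A (I @ I')" for A
    by (auto simp: dbl_def start_merge_col start_merge_row dest: start_antimono)
  ultimately show ?thesis
    by (auto simp: req_append)
qed

text \<open>Seen from the merged interval itself, where \<open>I'\<close> lies between
  \<open>I\<close> and \<open>R\<close>. Dropping \<open>I'\<close> from the intervals in between
  only makes it easier to be a start, so mutual starts of \<open>I\<close> are kept; the next lemma
  treats those of the nearer half \<open>I'\<close>.\<close>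

lemma req_merge_left: "req E (I @ I') B R \<subseteq> req E I (I' # B) R"
proof (induction R arbitrary: B)
  case (Cons J R)
  have "dbl E I (I' # B) J \<Longrightarrow> dbl E (I @ I') B J"
    by (auto simp: dbl_def start_merge_col start_merge_row dest: start_antimono)
  moreover have "req E I (J # I' # B) R = req E I (I' # J # B) R" by (rule req_cong) auto
  ultimately show ?case using Cons[of "J # B"] by auto
qed simp

lemma req_merge_right: "req E (I @ I') B R \<subseteq> req E I' B R"
proof (induction R arbitrary: B)
  case (Cons J R)
  have "dbl E I' B J \<Longrightarrow> dbl E (I @ I') B J"
    by (auto simp: dbl_def start_merge_row intro: start_col_right)
  then show ?case using Cons[of "J # B"] by auto
qed simp

subsection \<open>Counting neighbourhoods\<close>

lemma card_image_Un_le: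
  assumes "finite X"
  shows "card ((\<lambda>c. {y \<in> A \<union> B. E c y}) ` X) \<le> card ((\<lambda>c. {y \<in> A. E c y}) ` X) * card ((\<lambda>c. {y \<in> B. E c y}) ` X)"
proof -
  have "(\<lambda>c. {y \<in> A \<union> B. E c y}) ` X \<subseteq>
      (\<lambda>(p, q). p \<union> q) ` (((\<lambda>c. {y \<in> A. E c y}) ` X) \<times> ((\<lambda>c. {y \<in> B. E c y}) ` X))"
    by (force simp: image_iff)
  then have "card ((\<lambda>c. {y \<in> A \<union> B. E c y}) ` X) \<le>
      card (((\<lambda>c. {y \<in> A. E c y}) ` X) \<times> ((\<lambda>c. {y \<in> B. E c y}) ` X))"
    using assms by (intro surj_card_le) auto
  then show ?thesis by (simp add: card_cartesian_product)
qed

lemma card_image_restrict_le: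
  assumes "finite X" "A \<subseteq> B"
  shows "card ((\<lambda>c. {y \<in> A. E c y}) ` X) \<le> card ((\<lambda>c. {y \<in> B. E c y}) ` X)"
proof -
  have "(\<lambda>c. {y \<in> A. E c y}) ` X = (\<lambda>S. S \<inter> A) ` ((\<lambda>c. {y \<in> B. E c y}) ` X)"
    using assms(2) by (auto simp: image_image intro!: image_cong)
  then show ?thesis using card_image_le[OF finite_imageI[OF assms(1)]] by simp
qed

text \<open>A row is determined by the set of distinct columns that contain its index.\<close>

lemma card_rows_le_pow_card_columns:
  assumes "finite A" "finite B"
  shows "card ((\<lambda>c. {y \<in> B. E c y}) ` A) \<le> 2 ^ card ((\<lambda>y. {c \<in> A. E c y}) ` B)"
proof -
  let ?Y = "(\<lambda>y. {c \<in> A. E c y}) ` B"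
  have "(\<lambda>c. {y \<in> B. E c y}) ` A \<subseteq> (\<lambda>F. {y \<in> B. {c \<in> A. E c y} \<in> F}) ` Pow ?Y"
  proof
    fix S assume "S \<in> (\<lambda>c. {y \<in> B. E c y}) ` A"
    then obtain c where c: "c \<in> A" "S = {y \<in> B. E c y}" by blast
    then have "S = {y \<in> B. {c \<in> A. E c y} \<in> {F \<in> ?Y. c \<in> F}}" by auto
    then show "S \<in> (\<lambda>F. {y \<in> B. {c \<in> A. E c y} \<in> F}) ` Pow ?Y" by blast
  qed
  then have "card ((\<lambda>c. {y \<in> B. E c y}) ` A) \<le> card (Pow ?Y)"
    using assms by (intro surj_card_le) auto
  then show ?thesis using assms by (simp add: card_Pow)
qed

subsection \<open>Consequences of the order claim\<close>

definition parted :: "('a \<Rightarrow> int) \<Rightarrow> 'a list list \<Rightarrow> bool" where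
  "parted pos P \<longleftrightarrow> sorted_wrt (\<lambda>I J. \<forall>a\<in>set I. \<forall>b\<in>set J. pos a < pos b) P"

definition half_graph_free :: "('a \<Rightarrow> 'a \<Rightarrow> bool) \<Rightarrow> ('a \<Rightarrow> int) \<Rightarrow> nat \<Rightarrow> bool" where
  "half_graph_free E pos t \<longleftrightarrow>
     \<not> (\<exists>a b :: nat \<Rightarrow> 'a. \<forall>i<t. \<forall>j<t. pos (a i) < pos (b j) \<and> (E (a i) (b j) \<longleftrightarrow> i \<le> j))"

text \<open>The number of traces on one side: \<open>K * t + 1\<close> on \<open>req1\<close>, times
  \<open>2 ^ (K * t + 1)\<close> for each of at most \<open>K\<close> intervals in
  \<open>req2\<close>. The square combines both sides.\<close>

definition class_bound :: "nat \<Rightarrow> nat \<Rightarrow> nat" where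
  "class_bound t K = ((K * t + 1) * (2 ^ (K * t + 1)) ^ K)\<^sup>2"

text \<open>Positions are integers so that the reversed order is given by negation; all statements
  about the left side come from this mirror image.\<close>

locale ordered_graph =
  fixes E :: "'a \<Rightarrow> 'a \<Rightarrow> bool" and pos :: "'a \<Rightarrow> int" and V :: "'a set" and t :: nat
  assumes sym: "E a b \<Longrightarrow> E b a"
    and order_claim: "pos a < pos b \<Longrightarrow> pos b < pos c \<Longrightarrow> pos c < pos d \<Longrightarrow> E a c \<Longrightarrow> E b d \<Longrightarrow> E a d"
    and half_graph_free: "half_graph_free E pos t"
    and inj_pos: "inj_on pos V"
begin

lemma mirror: "ordered_graph E (\<lambda>a. - pos a) V t"
proof
  show "E a d" if "- pos a < - pos b" "- pos b < - pos c" "- pos c < - pos d" "E a c" "E b d" for a b c d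
    using order_claim[of d c b a] that sym by simp
  show "half_graph_free E (\<lambda>a. - pos a) t"
    unfolding half_graph_free_def
  proof safe
    fix a b :: "nat \<Rightarrow> 'a"
    assume *: "\<forall>i<t. \<forall>j<t. - pos (a i) < - pos (b j) \<and> (E (a i) (b j) \<longleftrightarrow> i \<le> j)"
    \<comment> \<open>Reversing the order exchanges the two sides of a half-graph, and reversing the
      indices restores \<open>i \<le> j\<close>.\<close>
    have "\<forall>i<t. \<forall>j<t. pos (b (t - 1 - i)) < pos (a (t - 1 - j)) \<and> (E (b (t - 1 - i)) (a (t - 1 - j)) \<longleftrightarrow> i \<le> j)"
    proof (intro allI impI)
      fix i j assume "i < t" "j < t"
      then have "t - 1 - j < t" "t - 1 - i < t" "t - 1 - j \<le> t - 1 - i \<longleftrightarrow> i \<le> j" by arith+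
      moreover have "E (b (t - 1 - i)) (a (t - 1 - j)) = E (a (t - 1 - j)) (b (t - 1 - i))"
        using sym by blast
      ultimately show "pos (b (t - 1 - i)) < pos (a (t - 1 - j)) \<and> (E (b (t - 1 - i)) (a (t - 1 - j)) \<longleftrightarrow> i \<le> j)"
        using * by simp
    qed
    then show False using half_graph_free unfolding half_graph_free_def by - (erule notE, rule exI, rule exI)
  qed
  show "inj_on (\<lambda>a. - pos a) V" using inj_pos by (simp add: inj_on_def)
qed (rule sym)

lemma parted_mirror: "parted pos P \<Longrightarrow> parted (\<lambda>a. - pos a) (rev P)"
  unfolding parted_def sorted_wrt_rev by (erule sorted_wrt_mono_rel[rotated]) simp

text \<open>The leftmost vertex \<open>c0\<close> has the largest trace and becomes
  \<open>a 0\<close>; the vertices with a different trace go into the induction. The inequality on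
  \<open>m\<close> is strict because the smallest trace may be empty and then yields no
  edge.\<close>

lemma chain_half_graph:
  assumes "finite X" "m < card ((\<lambda>c. {y \<in> Q. E c y}) ` X)"
    and nested: "\<And>c c'. c \<in> X \<Longrightarrow> c' \<in> X \<Longrightarrow> pos c \<le> pos c' \<Longrightarrow> {y \<in> Q. E c' y} \<subseteq> {y \<in> Q. E c y}"
  shows "\<exists>a b :: nat \<Rightarrow> 'a. \<forall>i<m. a i \<in> X \<and> b i \<in> Q \<and> (\<forall>j<m. E (a i) (b j) \<longleftrightarrow> i \<le> j)"
  using assms
proof (induction m arbitrary: X)
  case 0 then show ?case by simp
next
  case (Suc m)
  define F where "F c = {y \<in> Q. E c y}" for c
  have "X \<noteq> {}" using Suc.prems(2) by auto
  then obtain c0 where c0: "c0 \<in> X" "\<And>c. c \<in> X \<Longrightarrow> pos c0 \<le> pos c"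
    using arg_min_if_finite[OF Suc.prems(1), of pos] by (metis leI)
  then have F0: "F c \<subseteq> F c0" if "c \<in> X" for c using Suc.prems(3)[of c0 c] that by (simp add: F_def)
  define X' where "X' = {c \<in> X. F c \<noteq> F c0}"
  have "F ` X \<subseteq> insert (F c0) (F ` X')" by (auto simp: X'_def)
  moreover have finX': "finite X'" using Suc.prems(1) by (simp add: X'_def)
  ultimately have "card (F ` X) \<le> card (insert (F c0) (F ` X'))" by (intro card_mono) auto
  also have "\<dots> \<le> Suc (card (F ` X'))" using finX' by (simp add: card_insert_if)
  finally have mX': "m < card (F ` X')" using Suc.prems(2) by (simp add: F_def[abs_def])
  have "\<exists>a b. \<forall>i<m. a i \<in> X' \<and> b i \<in> Q \<and> (\<forall>j<m. E (a i) (b j) \<longleftrightarrow> i \<le> j)"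
    using mX' Suc.prems(3) by (intro Suc.IH[OF finX']) (simp_all add: F_def[abs_def] X'_def)
  then obtain a b where ab: "\<forall>i<m. a i \<in> X' \<and> b i \<in> Q \<and> (\<forall>j<m. E (a i) (b j) \<longleftrightarrow> i \<le> j)" by blast
  \<comment> \<open>Among the traces of \<open>X'\<close> that of its leftmost vertex
    \<open>c1\<close> is largest, so a single \<open>y\<close> outside it is missed by all of
    \<open>X'\<close>.\<close>
  have "\<exists>y\<in>F c0. \<forall>c\<in>X'. y \<notin> F c"
  proof -
    have "X' \<noteq> {}" using mX' by auto
    then obtain c1 where c1: "c1 \<in> X'" "\<And>c. c \<in> X' \<Longrightarrow> pos c1 \<le> pos c"
      using arg_min_if_finite[OF finX', of pos] by (metis leI)
    then have "F c \<subseteq> F c1" if "c \<in> X'" for c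
      using Suc.prems(3)[of c1 c] that by (auto simp: F_def X'_def)
    moreover have "F c1 \<subset> F c0" using c1(1) F0 by (auto simp: X'_def)
    ultimately show ?thesis by blast
  qed
  then obtain y where y: "y \<in> F c0" "\<And>c. c \<in> X' \<Longrightarrow> y \<notin> F c" by blast
  have yQ: "y \<in> Q" "E c0 y" "\<And>c. c \<in> X' \<Longrightarrow> \<not> E c y" using y by (auto simp: F_def)
  have c0b: "E c0 (b j)" if "j < m" for j
    using ab that F0[of "a j"] by (auto simp: F_def X'_def)
  let ?a = "case_nat c0 a" and ?b = "case_nat y b"
  have "\<forall>i<Suc m. ?a i \<in> X \<and> ?b i \<in> Q \<and> (\<forall>j<Suc m. E (?a i) (?b j) \<longleftrightarrow> i \<le> j)"
    using ab yQ c0b c0(1) by (auto simp: less_Suc_eq_0_disj X'_def split: nat.splits)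
  then show ?case by blast
qed

text \<open>All vertices of \<open>X\<close> have a neighbour before \<open>Q\<close>, so by the order claim their
  neighbourhoods in \<open>Q\<close> form a chain.\<close>

lemma chain_card:
  assumes "X \<subseteq> V" "finite X" "\<And>c. c \<in> X \<Longrightarrow> \<exists>y\<in>J. E c y"
    and "\<And>c y. c \<in> X \<Longrightarrow> y \<in> J \<union> Q \<Longrightarrow> pos c < pos y"
    and "\<And>y q. y \<in> J \<Longrightarrow> q \<in> Q \<Longrightarrow> pos y < pos q"
  shows "card ((\<lambda>c. {y \<in> Q. E c y}) ` X) \<le> t"
proof (rule ccontr)
  assume "\<not> ?thesis"
  moreover have "{y \<in> Q. E c' y} \<subseteq> {y \<in> Q. E c y}" if "c \<in> X" "c' \<in> X" "pos c \<le> pos c'" for c c'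
  proof (cases "c = c'")
    case False
    then have lt: "pos c < pos c'" using that assms(1) inj_pos by (metis inj_onD order_less_le subset_iff)
    obtain y where y: "y \<in> J" "E c y" using assms(3) \<open>c \<in> X\<close> by blast
    show ?thesis using order_claim[OF lt _ _ y(2)] y(1) assms(4,5) that(2) by blast
  qed simp
  ultimately obtain a b where "\<forall>i<t. a i \<in> X \<and> b i \<in> Q \<and> (\<forall>j<t. E (a i) (b j) \<longleftrightarrow> i \<le> j)"
    using chain_half_graph[OF assms(2), of t Q] by (metis (no_types, lifting) leI)
  then have "\<forall>i<t. \<forall>j<t. pos (a i) < pos (b j) \<and> (E (a i) (b j) \<longleftrightarrow> i \<le> j)"
    using assms(4) by simp
  then show False using half_graph_free unfolding half_graph_free_def by - (erule notE, rule exI, rule exI)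
qed

text \<open>The vertices of \<open>X\<close> are grouped by the first interval in which they have a
  neighbour. Such an interval is a start, and beyond it \<open>chain_card\<close> allows the group
  at most \<open>t\<close> traces. The summand 1 is the empty trace of the vertices with no
  neighbour in \<open>R\<close>.\<close>

lemma card_req1:
  assumes "X \<subseteq> set I" "set I \<subseteq> V" "\<And>c. c \<in> X \<Longrightarrow> \<not> hasnbs E c B"
    and "\<And>c J y. c \<in> set I \<Longrightarrow> J \<in> set R \<Longrightarrow> y \<in> set J \<Longrightarrow> pos c < pos y"
    and "parted pos R"
  shows "card ((\<lambda>c. {y \<in> req1 E I B R. E c y}) ` X) \<le> cnt E I B R * t + 1"
  using assms
proof (induction R arbitrary: B X)
  case Nil
  have "(\<lambda>c. {y \<in> req1 E I B []. E c y}) ` X \<subseteq> {{}}" by auto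
  then have "card ((\<lambda>c. {y \<in> req1 E I B []. E c y}) ` X) \<le> card {{} :: 'a set}" by (intro card_mono) auto
  then show ?case by simp
next
  case (Cons J R)
  let ?Q = "req1 E I (J # B) R"
  have finX: "finite X" using Cons.prems(1) finite_subset by blast
  note req1_sub = req1_subset[of E I]
  have parts: "parted pos R" "\<And>y q. y \<in> set J \<Longrightarrow> q \<in> ?Q \<Longrightarrow> pos y < pos q"
    using Cons.prems(5) req1_sub[of "J # B" R] by (auto simp: parted_def)
  have IH: "card ((\<lambda>c. {y \<in> ?Q. E c y}) ` Y) \<le> cnt E I (J # B) R * t + 1"
    if "Y \<subseteq> X" "\<And>c. c \<in> Y \<Longrightarrow> \<not> hasnb E c J" for Y
  proof (rule Cons.IH)
    show "pos c < pos y" if "c \<in> set I" "J' \<in> set R" "y \<in> set J'" for c J' y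
      using Cons.prems(4)[OF that(1) _ that(3)] that(2) by simp
  qed (use Cons.prems(1-3) that parts(1) in \<open>auto simp: hasnbs_def\<close>)
  show ?case
  proof (cases "start E I B J")
    case False
    then have no: "\<not> hasnb E c J" if "c \<in> X" for c using that Cons.prems(1,3) by (auto simp: start_def)
    then have "(\<lambda>c. {y \<in> req1 E I B (J # R). E c y}) ` X = (\<lambda>c. {y \<in> ?Q. E c y}) ` X"
      by (intro image_cong) (auto simp: hasnb_def split: if_splits)
    then show ?thesis using IH[of X] no False by simp
  next
    case True
    define Y where "Y = {c \<in> X. hasnb E c J}"
    have "X = (X - Y) \<union> Y" by (auto simp: Y_def)
    then have "(\<lambda>c. {y \<in> ?Q. E c y}) ` X =
        (\<lambda>c. {y \<in> ?Q. E c y}) ` (X - Y) \<union> (\<lambda>c. {y \<in> ?Q. E c y}) ` Y" by blast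
    then have "card ((\<lambda>c. {y \<in> ?Q. E c y}) ` X) \<le>
        card ((\<lambda>c. {y \<in> ?Q. E c y}) ` (X - Y)) + card ((\<lambda>c. {y \<in> ?Q. E c y}) ` Y)"
      by (simp only: card_Un_le)
    moreover have "card ((\<lambda>c. {y \<in> ?Q. E c y}) ` (X - Y)) \<le> cnt E I (J # B) R * t + 1"
      by (rule IH) (auto simp: Y_def)
    moreover have "card ((\<lambda>c. {y \<in> ?Q. E c y}) ` Y) \<le> t"
    proof (rule chain_card[where J = "set J"])
      show "Y \<subseteq> V" "finite Y" using Cons.prems(1,2) finX by (auto simp: Y_def)
      show "pos c < pos y" if cy: "c \<in> Y" "y \<in> set J \<union> ?Q" for c y
      proof -
        obtain J' where "J' \<in> set (J # R)" "y \<in> set J'" using cy(2) req1_sub[of "J # B" R] by auto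
        then show ?thesis using Cons.prems(1,4) cy(1) by (auto simp: Y_def)
      qed
    qed (use parts in \<open>auto simp: Y_def hasnb_def\<close>)
    moreover have "card ((\<lambda>c. {y \<in> req1 E I B (J # R). E c y}) ` X) = card ((\<lambda>c. {y \<in> ?Q. E c y}) ` X)"
      using True by simp
    ultimately show ?thesis using True by simp
  qed
qed

text \<open>If \<open>J\<close> is a start of \<open>I\<close> but \<open>I\<close> is none of
  \<open>J\<close>, then \<open>I\<close> belongs to \<open>req1\<close> of \<open>J\<close> on its
  left side. In the mirrored order \<open>card_req1\<close> bounds the traces of \<open>J\<close> on
  \<open>I\<close>, hence exponentially those of \<open>I\<close> on \<open>J\<close>. These bounds
  multiply over at most \<open>cnt E I B R\<close> such intervals \<open>J\<close>; the list
  \<open>L\<close> is carried along as it is part of the left side of \<open>J\<close>.\<close>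

lemma card_req2:
  assumes "parted pos (rev L @ I # rev B @ R)" "\<Union>(set ` set (rev L @ I # rev B @ R)) \<subseteq> V"
    and bound: "\<And>L' J R'. rev L @ I # rev B @ R = rev L' @ J # R' \<Longrightarrow> cnt E J [] L' \<le> K"
  shows "card ((\<lambda>c. {y \<in> req2 E I B R. E c y}) ` set I) \<le> (2 ^ (K * t + 1)) ^ cnt E I B R"
  using assms
proof (induction R arbitrary: B)
  case Nil
  have "(\<lambda>c. {y \<in> req2 E I B []. E c y}) ` set I \<subseteq> {{}}" by auto
  then have "card ((\<lambda>c. {y \<in> req2 E I B []. E c y}) ` set I) \<le> card {{} :: 'a set}" by (intro card_mono) auto
  then show ?case by simp
next
  case (Cons J R)
  let ?Q = "req2 E I (J # B) R"
  have IH: "card ((\<lambda>c. {y \<in> ?Q. E c y}) ` set I) \<le> (2 ^ (K * t + 1)) ^ cnt E I (J # B) R"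
    using Cons.prems by (intro Cons.IH) (simp_all add: Cons.prems(3))
  show ?case
  proof (cases "start E I B J \<and> \<not> start E J B I")
    case False
    then have "req2 E I B (J # R) = ?Q" by auto
    moreover have "(2::nat) ^ (K * t + 1) \<ge> 1" by simp
    ultimately show ?thesis using IH False
      by (auto intro: le_trans[OF IH] power_increasing)
  next
    case True
    interpret m: ordered_graph E "\<lambda>a. - pos a" V t by (rule mirror)
    have "parted (\<lambda>a. - pos a) (rev (rev L @ I # rev B @ J # R))"
      by (rule parted_mirror[OF Cons.prems(1)])
    then have pm: "parted (\<lambda>a. - pos a) (rev R @ J # B @ I # L)" by simp
    have "card ((\<lambda>y. {c \<in> req1 E J [] (B @ I # L). E y c}) ` set J) \<le> cnt E J [] (B @ I # L) * t + 1"
    proof (rule m.card_req1)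
      show "- pos y < - pos c" if "y \<in> set J" "J' \<in> set (B @ I # L)" "c \<in> set J'" for y J' c
        using pm that unfolding parted_def sorted_wrt_append sorted_wrt.simps by blast
    qed (use pm Cons.prems(2) in \<open>auto simp: hasnbs_def parted_def sorted_wrt_append\<close>)
    also have "cnt E J [] (B @ I # L) \<le> K"
      using Cons.prems(3)[of "B @ I # L" J R] by simp
    finally have 1: "card ((\<lambda>y. {c \<in> req1 E J [] (B @ I # L). E y c}) ` set J) \<le> K * t + 1"
      by simp
    have "\<not> start E J (rev B) I" using True start_cong[of J J "rev B" B I I E] by simp
    then have "set I \<subseteq> req1 E J [] (B @ I # L)" by (auto simp: req1_append)
    from card_image_restrict_le[OF _ this, of "set J" E] 1
    have "card ((\<lambda>y. {c \<in> set I. E y c}) ` set J) \<le> K * t + 1" by simp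
    moreover have "{c \<in> set I. E y c} = {c \<in> set I. E c y}" for y using sym by blast
    ultimately have "card ((\<lambda>y. {c \<in> set I. E c y}) ` set J) \<le> K * t + 1" by simp
    then have "card ((\<lambda>c. {y \<in> set J. E c y}) ` set I) \<le> 2 ^ (K * t + 1)"
      using card_rows_le_pow_card_columns[of "set I" "set J" E]
      by (meson finite_set le_trans one_le_numeral power_increasing)
    then have "card ((\<lambda>c. {y \<in> set J. E c y}) ` set I) * card ((\<lambda>c. {y \<in> ?Q. E c y}) ` set I)
        \<le> 2 ^ (K * t + 1) * (2 ^ (K * t + 1)) ^ cnt E I (J # B) R"
      using IH by (rule mult_le_mono)
    then show ?thesis
      using card_image_Un_le[of "set I" "set J" ?Q E] True by simp
  qed
qed

lemma card_req:
  assumes "parted pos (rev L @ I # R)" "\<Union>(set ` set (rev L @ I # R)) \<subseteq> V"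
    and bound: "\<And>L' J R'. rev L @ I # R = rev L' @ J # R' \<Longrightarrow> cnt E J [] L' \<le> K \<and> cnt E J [] R' \<le> K"
  shows "card ((\<lambda>c. {y \<in> req E I [] R. E c y}) ` set I) \<le> (K * t + 1) * (2 ^ (K * t + 1)) ^ K"
proof -
  have K: "cnt E I [] R \<le> K" using bound by blast
  have "card ((\<lambda>c. {y \<in> req1 E I [] R. E c y}) ` set I) \<le> cnt E I [] R * t + 1"
    using assms(1,2) by (intro card_req1) (auto simp: hasnbs_def parted_def sorted_wrt_append)
  also have "\<dots> \<le> K * t + 1" using K by simp
  finally have 1: "card ((\<lambda>c. {y \<in> req1 E I [] R. E c y}) ` set I) \<le> K * t + 1" .
  have "card ((\<lambda>c. {y \<in> req2 E I [] R. E c y}) ` set I) \<le> (2 ^ (K * t + 1)) ^ cnt E I [] R"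
    using assms by (intro card_req2[where L = L]) auto
  also have "\<dots> \<le> (2 ^ (K * t + 1)) ^ K" using K by (intro power_increasing) auto
  finally have 2: "card ((\<lambda>c. {y \<in> req2 E I [] R. E c y}) ` set I) \<le> (2 ^ (K * t + 1)) ^ K" .
  show ?thesis
    using card_image_Un_le[of "set I" "req1 E I [] R" "req2 E I [] R" E] mult_le_mono[OF 1 2]
    by (simp add: req_split)
qed

lemma card_classes:
  assumes "parted pos (rev L @ I # R)" "\<Union>(set ` set (rev L @ I # R)) \<subseteq> V"
    and bound: "\<And>L' J R'. rev L @ I # R = rev L' @ J # R' \<Longrightarrow> cnt E J [] L' \<le> K \<and> cnt E J [] R' \<le> K"
  shows "card ((\<lambda>c. {y \<in> req E I [] R \<union> req E I [] L. E c y}) ` set I) \<le> class_bound t K"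
proof -
  interpret m: ordered_graph E "\<lambda>a. - pos a" V t by (rule mirror)
  have "card ((\<lambda>c. {y \<in> req E I [] L. E c y}) ` set I) \<le> (K * t + 1) * (2 ^ (K * t + 1)) ^ K"
  proof (rule m.card_req)
    show "parted (\<lambda>a. - pos a) (rev R @ I # L)" using parted_mirror[OF assms(1)] by simp
    show "\<Union>(set ` set (rev R @ I # L)) \<subseteq> V" using assms(2) by auto
    show "cnt E J [] L' \<le> K \<and> cnt E J [] R' \<le> K" if "rev R @ I # L = rev L' @ J # R'" for L' J R'
    proof -
      have "rev L @ I # R = rev (rev R @ I # L)" by simp
      also have "\<dots> = rev R' @ J # L'" by (simp only: that) simp
      finally show ?thesis using bound by blast
    qed
  qed
  from mult_le_mono[OF card_req[OF assms] this]
  show ?thesis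
    using card_image_Un_le[of "set I" "req E I [] R" "req E I [] L" E]
    by (simp add: class_bound_def power2_eq_square)
qed

end

section \<open>Consecutive intervals whose union has few starts\<close>

lemma cnt_card: "cnt E I B R = card {j. j < length R \<and> start E I (take j R @ B) (R ! j)}"
proof (induction R arbitrary: B)
  case (Cons J R)
  have "start E I (take (Suc j) (J # R) @ B) x = start E I (take j R @ J # B) x" for j x
    by (rule start_cong) auto
  then have "{j. j < length (J # R) \<and> start E I (take j (J # R) @ B) ((J # R) ! j)} =
      {j. j = 0 \<and> start E I B J} \<union> Suc ` {j. j < length R \<and> start E I (take j R @ J # B) (R ! j)}"
    by (auto simp: less_Suc_eq_0_disj image_iff)
  also have "card \<dots> = card {j. j = (0::nat) \<and> start E I B J} +
      card (Suc ` {j. j < length R \<and> start E I (take j R @ J # B) (R ! j)})"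
    by (intro card_Un_disjoint) auto
  also have "\<dots> = cnt E I B (J # R)"
    by (auto simp: Cons card_image)
  finally show ?case by simp
qed simp

context ordered_graph
begin

definition right_count :: "'a list list \<Rightarrow> nat \<Rightarrow> nat" where
  "right_count P i = cnt E (P ! i @ P ! Suc i) [] (drop (i + 2) P)"

definition start_pairs :: "'a list list \<Rightarrow> (nat \<times> nat) set" where
  "start_pairs P = {(i, j). Suc i < j \<and> j < length P \<and>
     start E (P ! i @ P ! Suc i) (take (j - (i + 2)) (drop (i + 2) P)) (P ! j)}"

lemma right_count_card: "right_count P i = card {j. (i, j) \<in> start_pairs P}"
proof -
  have "{j. (i, j) \<in> start_pairs P} = (\<lambda>j. i + 2 + j) `
      {j. j < length (drop (i + 2) P) \<and> start E (P ! i @ P ! Suc i) (take j (drop (i + 2) P) @ []) (drop (i + 2) P ! j)}"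
    (is "?A = ?f ` ?B")
  proof
    show "?A \<subseteq> ?f ` ?B"
    proof
      fix j assume "j \<in> ?A"
      moreover from this have "Suc (Suc (j - 2)) = j" by (auto simp: start_pairs_def)
      ultimately have "j - (i + 2) \<in> ?B" "j = ?f (j - (i + 2))" by (auto simp: start_pairs_def)
      then show "j \<in> ?f ` ?B" by blast
    qed
  qed (auto simp: start_pairs_def)
  then show ?thesis unfolding right_count_def cnt_card by (simp add: card_image inj_on_def)
qed

text \<open>Every second pair of the family is used, so that the unions
  \<open>P ! i @ P ! Suc i\<close> involved are disjoint and precede all the starts. With
  \<open>c s\<close> in the union and \<open>y s\<close> its neighbour in the start, the order claim
  turns the crossing edges into the edges for \<open>i < j\<close>.\<close>

lemma start_pairs_crossing_free:
  assumes "parted pos P"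
  shows "crossing_free (2 * t) (start_pairs P)"
  unfolding crossing_free_def
proof safe
  fix a b :: "nat \<Rightarrow> nat"
  assume ab: "\<forall>s<2 * t. (a s, b s) \<in> start_pairs P" and inc: "\<forall>s<2 * t. \<forall>r<s. a r < a s \<and> b r < b s"
    and sep: "\<forall>s<2 * t. \<forall>r<2 * t. a r < b s"
  have "\<exists>c y. s < t \<longrightarrow> c \<in> set (P ! a (2 * s)) \<union> set (P ! Suc (a (2 * s))) \<and> y \<in> set (P ! b (2 * s)) \<and> E c y \<and>
      \<not> hasnbs E c (take (b (2 * s) - (a (2 * s) + 2)) (drop (a (2 * s) + 2) P))" for s
    using ab[rule_format, of "2 * s"] unfolding start_pairs_def start_def hasnb_def by auto
  then obtain c y where cy: "\<And>s. s < t \<Longrightarrow> c s \<in> set (P ! a (2 * s)) \<union> set (P ! Suc (a (2 * s)))"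
    "\<And>s. s < t \<Longrightarrow> y s \<in> set (P ! b (2 * s))" "\<And>s. s < t \<Longrightarrow> E (c s) (y s)"
    "\<And>s. s < t \<Longrightarrow> \<not> hasnbs E (c s) (take (b (2 * s) - (a (2 * s) + 2)) (drop (a (2 * s) + 2) P))"
    by metis
  have less: "pos u < pos v" if "u \<in> set (P ! i)" "v \<in> set (P ! j)" "i < j" "j < length P" for u v i j
    using assms that unfolding parted_def by (auto simp: sorted_wrt_iff_nth_less)
  have len: "b (2 * s) < length P" "Suc (a (2 * s)) < b (2 * s)" if "s < t" for s
    using ab that by (auto simp: start_pairs_def)
  have cpos: "\<exists>i. (i = a (2 * s) \<or> i = Suc (a (2 * s))) \<and> c s \<in> set (P ! i)" if "s < t" for s
    using cy(1)[OF that] by auto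
  have a2: "Suc (a (2 * r)) < a (2 * s)" if "s < t" "r < s" for r s
  proof -
    have "a (2 * r) < a (2 * r+1)" "a (2 * r+1) < a (2 * s)" using inc that by auto
    then show ?thesis by simp
  qed
  have ab2: "Suc (a (2 * r)) < b (2 * s)" if "s < t" "r < t" for r s
  proof -
    have "a (2 * r) < a (2 * r+1)" "a (2 * r+1) < b (2 * s)" using inc sep that by auto
    then show ?thesis by simp
  qed
  have b2: "b (2 * r) < b (2 * s)" if "s < t" "r < s" for r s using inc that by simp
  have cc: "pos (c r) < pos (c s)" if "s < t" "r < s" for r s
  proof -
    obtain i j where ij: "i = a (2 * r) \<or> i = Suc (a (2 * r))" "c r \<in> set (P ! i)"
        "j = a (2 * s) \<or> j = Suc (a (2 * s))" "c s \<in> set (P ! j)"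
      using cpos[of r] cpos[of s] \<open>s < t\<close> \<open>r < s\<close> by auto
    then show ?thesis using a2[OF that] len[OF that(1)] by (intro less[OF ij(2,4)]) auto
  qed
  have cyp: "pos (c r) < pos (y s)" if "s < t" "r < t" for r s
  proof -
    obtain i where i: "i = a (2 * r) \<or> i = Suc (a (2 * r))" "c r \<in> set (P ! i)" using cpos[of r] \<open>r < t\<close> by auto
    then show ?thesis using ab2[OF that] len(1)[OF that(1)] by (intro less[OF i(2) cy(2)[OF that(1)]]) auto
  qed
  have yy: "pos (y r) < pos (y s)" if "s < t" "r < s" for r s
    using less[OF cy(2)[of r] cy(2)[OF that(1)] b2[OF that] len(1)[OF that(1)]] that by simp
  have "\<forall>i<t. \<forall>j<t. pos (c i) < pos (y j) \<and> (E (c i) (y j) \<longleftrightarrow> i \<le> j)"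
  proof (intro allI impI conjI)
    fix i j assume ij: "i < t" "j < t"
    show "pos (c i) < pos (y j)" using cyp ij by simp
    show "E (c i) (y j) \<longleftrightarrow> i \<le> j"
    proof (cases i j rule: linorder_cases)
      case less
      then show ?thesis using order_claim[OF cc[OF ij(2) less] cyp[OF ij] yy[OF ij(2) less] cy(3)[OF ij(1)] cy(3)[OF ij(2)]]
        by simp
    next
      case equal then show ?thesis using cy(3) ij by simp
    next
      case greater
      \<comment> \<open>For \<open>j < i\<close> the interval of \<open>y j\<close> lies between the
        union containing \<open>c i\<close> and its start, where \<open>c i\<close> has no
        neighbour.\<close>
      let ?i = "a (2 * i) + 2" and ?j = "b (2 * j)"
      have "?i \<le> ?j" using ab2[OF ij(2,1)] by simp
      moreover from this have "Suc (Suc (?j - 2)) = ?j" by simp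
      moreover have "?j < b (2 * i)" using b2[OF ij(1) greater] .
      ultimately have "take (b (2 * i) - ?i) (drop ?i P) ! (?j - ?i) = P ! ?j" "?j - ?i < length (take (b (2 * i) - ?i) (drop ?i P))"
        using len(1)[OF ij(1)] by auto
      then have "P ! ?j \<in> set (take (b (2 * i) - ?i) (drop ?i P))" by (metis nth_mem)
      then have "\<not> E (c i) (y j)" using cy(4)[OF ij(1)] cy(2)[OF ij(2)] unfolding hasnbs_def hasnb_def by blast
      then show ?thesis using greater by simp
    qed
  qed
  then show False using half_graph_free unfolding half_graph_free_def by - (erule notE, rule exI, rule exI)
qed

lemma sum_right_count:
  assumes "parted pos P" and C: "\<And>n H. H \<subseteq> {(i, j). i < j \<and> j < n} \<Longrightarrow> crossing_free (2 * t) H \<Longrightarrow> card H \<le> C * n"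
  shows "(\<Sum>i<length P - 1. right_count P i) \<le> C * length P"
proof -
  have "finite (start_pairs P)"
    by (rule finite_subset[of _ "{..<length P} \<times> {..<length P}"]) (auto simp: start_pairs_def)
  moreover have "(SIGMA i:{..<length P - 1}. {j. (i, j) \<in> start_pairs P}) \<subseteq> start_pairs P" by auto
  ultimately have "card (SIGMA i:{..<length P - 1}. {j. (i, j) \<in> start_pairs P}) \<le> card (start_pairs P)"
    by (rule card_mono)
  moreover have "\<forall>i\<in>{..<length P - 1}. finite {j. (i, j) \<in> start_pairs P}"
    by (auto simp: start_pairs_def)
  ultimately have "(\<Sum>i<length P - 1. right_count P i) \<le> card (start_pairs P)"
    by (simp add: right_count_card card_SigmaI)
  also have "\<dots> \<le> C * length P"
    by (rule C) (use start_pairs_crossing_free[OF assms(1)] in \<open>auto simp: start_pairs_def\<close>)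
  finally show ?thesis .
qed

text \<open>Averaging: over the \<open>n - 1\<close> consecutive pairs the left and right counts add
  up to at most \<open>2 * C * n\<close>, which is at most \<open>4 * C\<close> times
  \<open>n - 1\<close> because \<open>n \<ge> 2\<close>. So some pair has both counts together at
  most \<open>4 * C\<close>.\<close>

lemma mergeable_pair:
  assumes "parted pos P" "2 \<le> length P"
    and C: "\<And>n H. H \<subseteq> {(i, j). i < j \<and> j < n} \<Longrightarrow> crossing_free (2 * t) H \<Longrightarrow> card H \<le> C * n"
  shows "\<exists>L I I' R. P = rev L @ I # I' # R \<and> cnt E (I @ I') [] R \<le> 4 * C \<and> cnt E (I @ I') [] L \<le> 4 * C"
proof -
  interpret m: ordered_graph E "\<lambda>a. - pos a" V t by (rule mirror)
  \<comment> \<open>The pair starting at index \<open>i\<close> of \<open>P\<close> starts at index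
    \<open>length P - 2 - i\<close> of \<open>rev P\<close>.\<close>
  let ?n = "length P" and ?l = "\<lambda>i. m.right_count (rev P) (length P - 2 - i)"
  have "(\<Sum>i<?n - 1. m.right_count (rev P) i) \<le> C * ?n"
    using m.sum_right_count[OF parted_mirror[OF assms(1)] C] by simp
  moreover have "(\<Sum>i<?n - 1. ?l i) = (\<Sum>i<?n - 1. m.right_count (rev P) i)"
    by (subst sum.nat_diff_reindex[symmetric]) (auto intro!: sum.cong simp: Suc_diff_Suc numeral_2_eq_2)
  ultimately have sum: "(\<Sum>i<?n - 1. right_count P i + ?l i) \<le> 2 * C * ?n"
    using sum_right_count[OF assms(1) C] by (simp add: sum.distrib)
  have "\<exists>i<?n - 1. right_count P i + ?l i \<le> 4 * C"
  proof (rule ccontr)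
    assume "\<not> ?thesis"
    then have "\<And>i. i \<in> {..<?n - 1} \<Longrightarrow> 4 * C + 1 \<le> right_count P i + ?l i" by (auto simp: not_le Suc_le_eq)
    then have "(?n - 1) * (4 * C + 1) \<le> (\<Sum>i<?n - 1. right_count P i + ?l i)"
      using sum_bounded_below[of "{..<?n - 1}" "4 * C + 1"] by (metis (no_types, lifting) card_lessThan of_nat_id)
    moreover have "2 * C * ?n \<le> (?n - 1) * (4 * C)"
    proof -
      have "?n \<le> 2 * (?n - 1)" using assms(2) by simp
      then have "2 * C * ?n \<le> 2 * C * (2 * (?n - 1))" by (rule mult_le_mono2)
      then show ?thesis by (simp add: algebra_simps)
    qed
    ultimately have "(?n - 1) * (4 * C + 1) \<le> (?n - 1) * (4 * C)" using sum by linarith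
    then show False using assms(2) by simp
  qed
  then obtain i where i: "i < ?n - 1" "right_count P i + ?l i \<le> 4 * C" by blast
  have P: "P = rev (rev (take i P)) @ P ! i # P ! Suc i # drop (i + 2) P"
    using i(1) by (simp add: Cons_nth_drop_Suc)
  have "?l i = cnt E (P ! i @ P ! Suc i) [] (rev (take i P))"
  proof -
    have "rev P ! (?n - 2 - i) = P ! Suc i" "rev P ! Suc (?n - 2 - i) = P ! i"
      using i(1) by (auto simp: rev_nth Suc_diff_Suc numeral_2_eq_2)
    moreover have "?n - 2 - i + 2 = ?n - i" using i(1) by simp
    then have "drop (?n - 2 - i + 2) (rev P) = rev (take i P)"
      by (simp only: rev_take)
    ultimately show ?thesis unfolding m.right_count_def by (simp add: cnt_cong[of "P ! Suc i @ P ! i" "P ! i @ P ! Suc i"] Un_commute)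
  qed
  then show ?thesis using P i(2) unfolding right_count_def by (metis add_leD1 add_leD2)
qed

end

section \<open>The contraction algorithm\<close>

text \<open>A part \<open>(I, A)\<close> consists of an interval \<open>I\<close> of the left-right order and of the vertices \<open>A\<close>
  of \<open>I\<close> that have not been contracted into others yet. The first of the two lists of parts is
  always reversed: its head is next to the head of the second one.\<close>

type_synonym 'a part = "'a list \<times> 'a list"

text \<open>The first admissible pair is merged. The value \<open>[]\<close> stands for failure,
  which \<open>mergeable_pair\<close> will rule out.\<close>

fun merge_step :: "('a \<Rightarrow> 'a \<Rightarrow> bool) \<Rightarrow> nat \<Rightarrow> 'a part list \<Rightarrow> 'a part list \<Rightarrow> 'a part list" where
  "merge_step E K L (p # q # R) =
     (if cnt E (fst p @ fst q) [] (map fst R) \<le> K \<and> cnt E (fst p @ fst q) [] (map fst L) \<le> K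
      then rev L @ (fst p @ fst q, snd p @ snd q) # R
      else merge_step E K (p # L) (q # R))"
| "merge_step E K L _ = []"

text \<open>The relation depends on the original graph and the full intervals but not on the
  surviving vertices, so contractions never change it; only merges do.\<close>

definition eqv :: "('a \<Rightarrow> 'a \<Rightarrow> bool) \<Rightarrow> 'a list list \<Rightarrow> 'a list \<Rightarrow> 'a list list \<Rightarrow> 'a \<Rightarrow> 'a \<Rightarrow> bool" where
  "eqv E L I R c c' \<longleftrightarrow> (\<forall>y \<in> req E I [] R \<union> req E I [] L. E c y = E c' y)"

text \<open>\<open>acc\<close> holds the survivors so far, which are pairwise inequivalent. A vertex
  \<open>c\<close> with an equivalent survivor \<open>u\<close> is contracted into it and loses its
  name.\<close>

fun part_outs :: "('a \<Rightarrow> 'a \<Rightarrow> bool) \<Rightarrow> 'a list \<Rightarrow> 'a list \<Rightarrow> ('a \<times> 'a) list" where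
  "part_outs r acc [] = []"
| "part_outs r acc (c # A) = (case filter (\<lambda>u. r u c) acc of
     [] \<Rightarrow> part_outs r (c # acc) A | u # _ \<Rightarrow> (u, c) # part_outs r acc A)"

fun part_reps :: "('a \<Rightarrow> 'a \<Rightarrow> bool) \<Rightarrow> 'a list \<Rightarrow> 'a list \<Rightarrow> 'a list" where
  "part_reps r acc [] = acc"
| "part_reps r acc (c # A) = (case filter (\<lambda>u. r u c) acc of
     [] \<Rightarrow> part_reps r (c # acc) A | u # _ \<Rightarrow> part_reps r acc A)"

fun outs :: "('a \<Rightarrow> 'a \<Rightarrow> bool) \<Rightarrow> 'a part list \<Rightarrow> 'a part list \<Rightarrow> ('a \<times> 'a) list" where
  "outs E L [] = []"
| "outs E L (p # R) = part_outs (eqv E (map fst L) (fst p) (map fst R)) [] (snd p) @ outs E (p # L) R"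

fun reps :: "('a \<Rightarrow> 'a \<Rightarrow> bool) \<Rightarrow> 'a part list \<Rightarrow> 'a part list \<Rightarrow> 'a part list" where
  "reps E L [] = []"
| "reps E L (p # R) = (fst p, part_reps (eqv E (map fst L) (fst p) (map fst R)) [] (snd p)) # reps E (p # L) R"

lemma map_fst_reps: "map fst (reps E L R) = map fst R"
  by (induction E L R rule: reps.induct) auto

lemma length_reps [simp]: "length (reps E L R) = length R"
  by (metis length_map map_fst_reps)

lemma length_merge_step: "R \<noteq> [] \<Longrightarrow> length (merge_step E K L R) < length L + length R"
  by (induction E K L R rule: merge_step.induct) auto

function contractions :: "('a \<Rightarrow> 'a \<Rightarrow> bool) \<Rightarrow> nat \<Rightarrow> 'a part list \<Rightarrow> ('a \<times> 'a) list" where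
  "contractions E K P = (if length P \<le> 1 then []
     else outs E [] (merge_step E K [] P) @ contractions E K (reps E [] (merge_step E K [] P)))"
  by auto
termination
proof (relation "Wellfounded.measure (\<lambda>(E, K, P). length P)")
  show "((E, K, reps E [] (merge_step E K [] P)), E, K, P) \<in> Wellfounded.measure (\<lambda>(E, K, P). length P)"
    if "\<not> length P \<le> 1" for E :: "'a \<Rightarrow> 'a \<Rightarrow> bool" and K P
    using length_merge_step[of P E K "[]"] that by (cases P) auto
qed simp

declare contractions.simps [simp del]

subsection \<open>Quotient trigraphs\<close>

definition edge_set :: "'a set \<Rightarrow> ('a \<Rightarrow> 'a \<Rightarrow> bool) \<Rightarrow> 'a set set" where
  "edge_set D p = {{x, y} | x y. x \<in> D \<and> y \<in> D \<and> x \<noteq> y \<and> p x y}"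

definition all_adj :: "('a \<Rightarrow> 'a \<Rightarrow> bool) \<Rightarrow> 'a set \<Rightarrow> ('a \<Rightarrow> 'a) \<Rightarrow> 'a \<Rightarrow> 'a \<Rightarrow> bool" where
  "all_adj E V \<rho> x y \<longleftrightarrow> (\<forall>a\<in>V. \<forall>b\<in>V. \<rho> a = x \<longrightarrow> \<rho> b = y \<longrightarrow> E a b)"

definition some_adj :: "('a \<Rightarrow> 'a \<Rightarrow> bool) \<Rightarrow> 'a set \<Rightarrow> ('a \<Rightarrow> 'a) \<Rightarrow> 'a \<Rightarrow> 'a \<Rightarrow> bool" where
  "some_adj E V \<rho> x y \<longleftrightarrow> (\<exists>a\<in>V. \<exists>b\<in>V. \<rho> a = x \<and> \<rho> b = y \<and> E a b)"

text \<open>Closed form of a trigraph reached by contractions: \<open>\<rho>\<close> sends a vertex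
  of the graph to the trigraph vertex that has absorbed it, and a pair of classes is black if
  complete, red if mixed. The history of contractions can thus be forgotten.\<close>

definition quotient :: "('a \<Rightarrow> 'a \<Rightarrow> bool) \<Rightarrow> 'a set \<Rightarrow> ('a \<Rightarrow> 'a) \<Rightarrow> 'a trigraph" where
  "quotient E V \<rho> = \<lparr> tverts = \<rho> ` V, black = edge_set (\<rho> ` V) (all_adj E V \<rho>),
     red = edge_set (\<rho> ` V) (\<lambda>x y. some_adj E V \<rho> x y \<and> \<not> all_adj E V \<rho> x y) \<rparr>"

lemma edge_set_iff:
  assumes "\<And>x y. p x y = p y x"
  shows "{x, y} \<in> edge_set D p \<longleftrightarrow> x \<in> D \<and> y \<in> D \<and> x \<noteq> y \<and> p x y"
  unfolding edge_set_def using assms by (auto simp: doubleton_eq_iff)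

lemma edge_set_contract:
  assumes "u \<in> D" "v \<in> D" "u \<noteq> v" "\<And>x y. p x y = p y x" "\<And>x y. p' x y = p' y x"
    and "\<And>x y. x \<in> D - {u, v} \<Longrightarrow> y \<in> D - {u, v} \<Longrightarrow> p' x y = p x y"
    and "\<And>z. z \<in> D - {u, v} \<Longrightarrow> p' u z = q z"
  shows "edge_set (D - {v}) p' =
    {e \<in> edge_set D p. u \<notin> e \<and> v \<notin> e} \<union> {{u, z} | z. z \<in> D - {u, v} \<and> q z}"
proof (intro set_eqI iffI)
  fix e assume "e \<in> edge_set (D - {v}) p'"
  then obtain x y where e: "e = {x, y}" and xy: "x \<in> D - {v}" "y \<in> D - {v}" "x \<noteq> y" "p' x y"
    by (auto simp: edge_set_def)
  consider "x = u" | "y = u" | "x \<noteq> u" "y \<noteq> u" by blast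
  then show "e \<in> {e \<in> edge_set D p. u \<notin> e \<and> v \<notin> e} \<union> {{u, z} | z. z \<in> D - {u, v} \<and> q z}"
  proof cases
    case 1 then show ?thesis using e xy assms(7)[of y] by auto
  next
    case 2
    then have "e = {u, x}" "x \<in> D - {u, v}" "q x" using e xy assms(7)[of x] assms(5) by auto
    then show ?thesis by blast
  next
    case 3
    then show ?thesis using e xy assms(6)[of x y] by (auto simp: edge_set_iff[of p, OF assms(4)])
  qed
next
  fix e assume "e \<in> {e \<in> edge_set D p. u \<notin> e \<and> v \<notin> e} \<union> {{u, z} | z. z \<in> D - {u, v} \<and> q z}"
  then consider x y where "e = {x, y}" "x \<in> D" "y \<in> D" "x \<noteq> y" "p x y" "u \<notin> {x, y}" "v \<notin> {x, y}"
    | z where "e = {u, z}" "z \<in> D - {u, v}" "q z"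
    by (auto simp: edge_set_def)
  then show "e \<in> edge_set (D - {v}) p'"
  proof cases
    case 1 then show ?thesis using assms(6)[of x y] by (auto simp: edge_set_iff[of p', OF assms(5)])
  next
    case 2 then show ?thesis using assms(1,3) assms(7)[OF 2(2)] by (auto simp: edge_set_iff[of p', OF assms(5)])
  qed
qed

text \<open>The merged class is complete to \<open>z\<close> iff both old classes are, and has an
  edge to \<open>z\<close> iff one of them has; this is exactly how \<open>contract\<close> colours
  the new edges.\<close>

lemma contract_quotient:
  assumes sym: "\<And>a b. E a b \<Longrightarrow> E b a" and uv: "u \<in> \<rho> ` V" "v \<in> \<rho> ` V" "u \<noteq> v"
  shows "contract (quotient E V \<rho>) u v = quotient E V (\<lambda>a. if \<rho> a = v then u else \<rho> a)"
    (is "_ = quotient E V ?\<rho>'")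
proof -
  let ?B = "edge_set (\<rho> ` V) (all_adj E V \<rho>)" and ?R = "edge_set (\<rho> ` V) (\<lambda>x y. some_adj E V \<rho> x y \<and> \<not> all_adj E V \<rho> x y)"
  have all_sym: "all_adj E V \<sigma> x y = all_adj E V \<sigma> y x" for \<sigma> x y
    unfolding all_adj_def using sym by blast
  have some_sym: "some_adj E V \<sigma> x y = some_adj E V \<sigma> y x" for \<sigma> x y
    unfolding some_adj_def using sym by blast
  have verts: "?\<rho>' ` V = \<rho> ` V - {v}" using uv by (auto simp: image_iff)
  have same: "all_adj E V ?\<rho>' x y = all_adj E V \<rho> x y" "some_adj E V ?\<rho>' x y = some_adj E V \<rho> x y"
    if "x \<in> \<rho> ` V - {u, v}" "y \<in> \<rho> ` V - {u, v}" for x y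
  proof -
    have "?\<rho>' a = x \<longleftrightarrow> \<rho> a = x" "?\<rho>' a = y \<longleftrightarrow> \<rho> a = y" for a using that by auto
    then show "all_adj E V ?\<rho>' x y = all_adj E V \<rho> x y" "some_adj E V ?\<rho>' x y = some_adj E V \<rho> x y"
      unfolding all_adj_def some_adj_def by simp_all
  qed
  have new: "all_adj E V ?\<rho>' u z \<longleftrightarrow> all_adj E V \<rho> u z \<and> all_adj E V \<rho> v z"
    "some_adj E V ?\<rho>' u z \<longleftrightarrow> some_adj E V \<rho> u z \<or> some_adj E V \<rho> v z"
    if "z \<in> \<rho> ` V - {u, v}" for z
  proof -
    have "?\<rho>' a = z \<longleftrightarrow> \<rho> a = z" "?\<rho>' a = u \<longleftrightarrow> \<rho> a = u \<or> \<rho> a = v" for a using that by auto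
    then show "all_adj E V ?\<rho>' u z \<longleftrightarrow> all_adj E V \<rho> u z \<and> all_adj E V \<rho> v z"
      "some_adj E V ?\<rho>' u z \<longleftrightarrow> some_adj E V \<rho> u z \<or> some_adj E V \<rho> v z"
      unfolding all_adj_def some_adj_def by (simp_all only:) blast+
  qed
  have black_iff: "{x, y} \<in> ?B \<longleftrightarrow>
      x \<in> \<rho> ` V \<and> y \<in> \<rho> ` V \<and> x \<noteq> y \<and> all_adj E V \<rho> x y" for x y
    by (rule edge_set_iff) (rule all_sym)
  have red_iff: "{x, y} \<in> ?R \<longleftrightarrow>
      x \<in> \<rho> ` V \<and> y \<in> \<rho> ` V \<and> x \<noteq> y \<and> some_adj E V \<rho> x y \<and> \<not> all_adj E V \<rho> x y" for x y
    by (rule edge_set_iff) (metis all_sym some_sym)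
  \<comment> \<open>Classes are nonempty, so completeness is never vacuous and every black pair
    contains an edge.\<close>
  have all_some: "all_adj E V \<rho> x y \<Longrightarrow> x \<in> \<rho> ` V \<Longrightarrow> y \<in> \<rho> ` V \<Longrightarrow> some_adj E V \<rho> x y" for x y
    unfolding all_adj_def some_adj_def by blast
  have zD: "z \<in> \<rho> ` V" "u \<noteq> z" "v \<noteq> z" if "z \<in> \<rho> ` V - {u, v}" for z using that by auto
  have "edge_set (\<rho> ` V - {v}) (all_adj E V ?\<rho>') =
      {e \<in> ?B. u \<notin> e \<and> v \<notin> e} \<union>
      {{u, z} | z. z \<in> \<rho> ` V - {u, v} \<and> all_adj E V \<rho> u z \<and> all_adj E V \<rho> v z}"
  proof (rule edge_set_contract[OF uv])
    show "all_adj E V ?\<rho>' x y = all_adj E V \<rho> x y" if "x \<in> \<rho> ` V - {u, v}" "y \<in> \<rho> ` V - {u, v}" for x y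
      by (rule same(1)[OF that])
    show "all_adj E V ?\<rho>' u z = (all_adj E V \<rho> u z \<and> all_adj E V \<rho> v z)" if "z \<in> \<rho> ` V - {u, v}" for z
      by (rule new(1)[OF that])
  qed (rule all_sym)+
  moreover have "edge_set (\<rho> ` V - {v}) (\<lambda>x y. some_adj E V ?\<rho>' x y \<and> \<not> all_adj E V ?\<rho>' x y) =
      {e \<in> ?R. u \<notin> e \<and> v \<notin> e} \<union>
      {{u, z} | z. z \<in> \<rho> ` V - {u, v} \<and> (some_adj E V \<rho> u z \<or> some_adj E V \<rho> v z) \<and>
         \<not> (all_adj E V \<rho> u z \<and> all_adj E V \<rho> v z)}"
  proof (rule edge_set_contract[OF uv])
    show "(some_adj E V \<sigma> x y \<and> \<not> all_adj E V \<sigma> x y) = (some_adj E V \<sigma> y x \<and> \<not> all_adj E V \<sigma> y x)" for \<sigma> x y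
      using all_sym[of \<sigma> x y] some_sym[of \<sigma> x y] by simp
    then show "(some_adj E V \<sigma> x y \<and> \<not> all_adj E V \<sigma> x y) = (some_adj E V \<sigma> y x \<and> \<not> all_adj E V \<sigma> y x)" for \<sigma> x y .
    show "(some_adj E V ?\<rho>' x y \<and> \<not> all_adj E V ?\<rho>' x y) = (some_adj E V \<rho> x y \<and> \<not> all_adj E V \<rho> x y)"
      if "x \<in> \<rho> ` V - {u, v}" "y \<in> \<rho> ` V - {u, v}" for x y
      using same[OF that] by simp
    show "(some_adj E V ?\<rho>' u z \<and> \<not> all_adj E V ?\<rho>' u z) =
        ((some_adj E V \<rho> u z \<or> some_adj E V \<rho> v z) \<and> \<not> (all_adj E V \<rho> u z \<and> all_adj E V \<rho> v z))"
      if "z \<in> \<rho> ` V - {u, v}" for z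
      using new[OF that] by simp
  qed
  moreover have "all_adj E V \<rho> u z \<and> all_adj E V \<rho> v z \<longleftrightarrow>
      {u, z} \<in> ?B \<and> {v, z} \<in> ?B"
    if "z \<in> \<rho> ` V - {u, v}" for z
    using zD[OF that] by (simp add: black_iff uv)
  moreover have "(some_adj E V \<rho> u z \<or> some_adj E V \<rho> v z) \<and> \<not> (all_adj E V \<rho> u z \<and> all_adj E V \<rho> v z) \<longleftrightarrow>
      ({u, z} \<in> ?B \<union> ?R \<or>
       {v, z} \<in> ?B \<union> ?R) \<and>
      \<not> ({u, z} \<in> ?B \<and> {v, z} \<in> ?B)"
    if "z \<in> \<rho> ` V - {u, v}" for z
    using zD[OF that] all_some[of u z] all_some[of v z] by (auto simp: black_iff red_iff uv)
  ultimately show ?thesis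
    unfolding contract_def quotient_def verts by (simp cong: conj_cong)
qed

subsection \<open>The invariant\<close>

lemma eqv_refl: "eqv E L I R c c"
  and eqv_sym: "eqv E L I R c d \<Longrightarrow> eqv E L I R d c"
  and eqv_trans: "eqv E L I R c d \<Longrightarrow> eqv E L I R d e \<Longrightarrow> eqv E L I R c e"
  by (auto simp: eqv_def)

lemma split_unique:
  "xs @ a # ys = us @ b # vs \<Longrightarrow> (us = xs \<and> b = a \<and> vs = ys) \<or>
     (\<exists>w. us = xs @ a # w \<and> ys = w @ b # vs) \<or> (\<exists>w. xs = us @ b # w \<and> vs = w @ a # ys)"
proof (induction xs arbitrary: us)
  case Nil then show ?case by (cases us) auto
next
  case (Cons x xs) then show ?case by (cases us) auto
qed

lemma split_cases:
  assumes "rev L @ I # R = rev L' @ J # R'"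
  shows "(J = I \<and> L' = L \<and> R' = R) \<or> J \<in> set L \<union> set R"
  using split_unique[OF assms]
proof (elim disjE exE conjE)
  fix w assume w: "rev L = rev L' @ J # w"
  have "J \<in> set (rev L)" unfolding w by simp
  then show ?thesis by simp
qed auto

text \<open>For an interval to the right of a merge, the reversed list on its left contains
  \<open>I'\<close> before \<open>I\<close>, whereas the merged interval is
  \<open>I @ I'\<close>.\<close>

lemma cnt_swap: "cnt E J B (X @ (I @ I') # R) = cnt E J B (X @ (I' @ I) # R)"
proof -
  have "cnt E J ((I @ I') # rev X @ B) R = cnt E J ((I' @ I) # rev X @ B) R"
    by (rule cnt_cong) auto
  moreover have "start E J A (I @ I') = start E J A (I' @ I)" for A by (rule start_cong) auto
  ultimately show ?thesis by (simp add: cnt_append)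
qed

lemma req_swap: "req E J B (X @ (I @ I') # R) = req E J B (X @ (I' @ I) # R)"
proof -
  have "req E J ((I @ I') # rev X @ B) R = req E J ((I' @ I) # rev X @ B) R"
    by (rule req_cong) auto
  moreover have "dbl E J A (I @ I') = dbl E J A (I' @ I)" for A by (rule dbl_cong) auto
  ultimately show ?thesis by (auto simp: req_append)
qed

context ordered_graph
begin

definition bounded_counts :: "nat \<Rightarrow> 'a list list \<Rightarrow> bool" where
  "bounded_counts K P \<longleftrightarrow> (\<forall>L I R. P = rev L @ I # R \<longrightarrow> cnt E I [] L \<le> K \<and> cnt E I [] R \<le> K)"

definition classes :: "nat \<Rightarrow> 'a list list \<Rightarrow> ('a \<Rightarrow> 'a) \<Rightarrow> bool" where
  "classes M P \<rho> \<longleftrightarrow> (\<forall>a\<in>V. \<rho> (\<rho> a) = \<rho> a) \<and>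
     (\<forall>L I R. P = rev L @ I # R \<longrightarrow>
        (\<forall>a\<in>set I. \<rho> a \<in> set I \<and> eqv E L I R a (\<rho> a)) \<and> card (\<rho> ` set I) \<le> M)"

definition partition :: "'a list list \<Rightarrow> bool" where
  "partition P \<longleftrightarrow> parted pos P \<and> \<Union>(set ` set P) = V"

lemma partition_disjoint:
  assumes "partition (rev L @ I # R)" "a \<in> set I"
  shows "J \<in> set L \<union> set R \<Longrightarrow> a \<notin> set J"
  using assms unfolding partition_def parted_def by (force simp: sorted_wrt_append)

lemma partition_split:
  assumes "partition P" "a \<in> V"
  obtains L I R where "P = rev L @ I # R" "a \<in> set I"
proof -
  obtain I where "I \<in> set P" "a \<in> set I" using assms by (auto simp: partition_def)
  moreover from this(1) obtain L R where "P = L @ I # R" by (meson split_list)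
  ultimately show thesis using that[of "rev L" I R] by simp
qed

lemma class_in_part:
  assumes "partition P" "classes M P \<rho>" "c \<in> V" "\<rho> c \<in> set I" "I \<in> set P"
  shows "c \<in> set I"
proof -
  obtain L J R where J: "P = rev L @ J # R" "c \<in> set J" using partition_split[OF assms(1,3)] .
  then have "\<rho> c \<in> set J" using assms(2) unfolding classes_def by blast
  moreover have "I \<in> set L \<union> set R \<or> I = J" using assms(5) J(1) by auto
  ultimately show ?thesis using partition_disjoint[of L J R "\<rho> c" I] assms(1,4) J by blast
qed

text \<open>\<open>D\<close> gathers the classes of all mutual starts on one side;
  \<open>cnt\<close> counts all starts and therefore dominates the mutual ones.\<close>

lemma dbl_card:
  assumes "\<And>J. J \<in> set R \<Longrightarrow> card (\<rho> ` set J) \<le> M"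
  shows "\<exists>D. card D \<le> cnt E I B R * M \<and> finite D \<and>
    (\<forall>R1 J R2. R = R1 @ J # R2 \<longrightarrow> dbl E I (rev R1 @ B) J \<longrightarrow> \<rho> ` set J \<subseteq> D)"
  using assms
proof (induction R arbitrary: B)
  case Nil then show ?case by (intro exI[of _ "{}"]) simp
next
  case (Cons J R)
  have "\<exists>D. card D \<le> cnt E I (J # B) R * M \<and> finite D \<and>
      (\<forall>R1 J' R2. R = R1 @ J' # R2 \<longrightarrow> dbl E I (rev R1 @ J # B) J' \<longrightarrow> \<rho> ` set J' \<subseteq> D)"
    using Cons.prems by (intro Cons.IH) simp
  then obtain D where D: "card D \<le> cnt E I (J # B) R * M" "finite D"
    "\<And>R1 J' R2. R = R1 @ J' # R2 \<Longrightarrow> dbl E I (rev R1 @ J # B) J' \<Longrightarrow> \<rho> ` set J' \<subseteq> D"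
    by blast
  define D' where "D' = (if dbl E I B J then \<rho> ` set J else {}) \<union> D"
  have "card D' \<le> card (if dbl E I B J then \<rho> ` set J else {}) + card D"
    unfolding D'_def by (rule card_Un_le)
  also have "\<dots> \<le> cnt E I B (J # R) * M"
    using D(1) Cons.prems[of J] by (auto simp: dbl_def add_mult_distrib)
  finally have "card D' \<le> cnt E I B (J # R) * M" .
  moreover have "finite D'" using D(2) by (simp add: D'_def)
  moreover have "\<rho> ` set J' \<subseteq> D'" if "J # R = R1 @ J' # R2" "dbl E I (rev R1 @ B) J'" for R1 J' R2
  proof (cases R1)
    case Nil then show ?thesis using that by (simp add: D'_def)
  next
    case (Cons J0 R0) then show ?thesis using that D(3)[of R0 J' R2] by (auto simp: D'_def)
  qed
  ultimately show ?case by blast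
qed

text \<open>The ends are replaced one after the other: \<open>J\<close> lies in \<open>req\<close>
  of \<open>I\<close>, which moves \<open>a\<close> to its representative, and \<open>I\<close> lies
  in \<open>req\<close> of \<open>J\<close>, which then moves \<open>b\<close>. Both are available
  because \<open>dbl\<close> treats the two intervals alike.\<close>

lemma homogeneous:
  assumes "classes M P \<rho>" "P = rev L @ I # X @ J # R" "\<not> dbl E I (rev X) J"
    and "a \<in> set I" "b \<in> set J"
  shows "E a b = E (\<rho> a) (\<rho> b)"
proof -
  have P2: "P = rev (rev X @ I # L) @ J # R" using assms(2) by simp
  have "eqv E L I (X @ J # R) a (\<rho> a)" using assms(1,2,4) unfolding classes_def by blast
  moreover have "set J \<subseteq> req E I [] (X @ J # R)" using assms(3) by (auto simp: req_append)
  ultimately have 1: "E a b = E (\<rho> a) b" using assms(5) by (auto simp: eqv_def)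
  have "eqv E (rev X @ I # L) J R b (\<rho> b)" "\<rho> a \<in> set I"
    using assms(1,2,4,5) P2 unfolding classes_def by blast+
  moreover have "\<not> dbl E J (rev (rev X)) I"
    using assms(3) dbl_cong[of J J "rev X" "rev (rev X)" I I E] by (auto simp: dbl_def)
  then have "set I \<subseteq> req E J [] (rev X @ I # L)" by (auto simp: req_append)
  ultimately have "E b (\<rho> a) = E (\<rho> b) (\<rho> a)" by (auto simp: eqv_def)
  then show ?thesis using 1 sym by blast
qed

text \<open>Red neighbours lie in the same interval or in one of at most \<open>K\<close> mutual
  starts on either side, that is, in \<open>2 * K + 1\<close> intervals with at most
  \<open>M\<close> classes each.\<close>

lemma red_degree:
  assumes "partition P" "bounded_counts K P" "classes M P \<rho>"
  shows "red_degree_le (M * (2 * K + 1)) (quotient E V \<rho>)"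
  unfolding red_degree_le_def
proof
  fix x assume "x \<in> tverts (quotient E V \<rho>)"
  then obtain a where a: "a \<in> V" "x = \<rho> a" by (auto simp: quotient_def)
  obtain L I R where P: "P = rev L @ I # R" "a \<in> set I" using partition_split[OF assms(1) a(1)] .
  have cM: "card (\<rho> ` set J) \<le> M" if J: "J \<in> set P" for J
  proof -
    obtain X Y where "P = X @ J # Y" using split_list[OF J] by blast
    then have "P = rev (rev X) @ J # Y" by simp
    then show ?thesis using assms(3) unfolding classes_def by blast
  qed
  obtain DR where DR: "card DR \<le> cnt E I [] R * M" "finite DR"
    "\<And>R1 J R2. R = R1 @ J # R2 \<Longrightarrow> dbl E I (rev R1 @ []) J \<Longrightarrow> \<rho> ` set J \<subseteq> DR"
  proof -
    have "\<And>J. J \<in> set R \<Longrightarrow> card (\<rho> ` set J) \<le> M" using cM P(1) by simp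
    from dbl_card[OF this, of R I "[]"] show thesis using that by blast
  qed
  obtain DL where DL: "card DL \<le> cnt E I [] L * M" "finite DL"
    "\<And>R1 J R2. L = R1 @ J # R2 \<Longrightarrow> dbl E I (rev R1 @ []) J \<Longrightarrow> \<rho> ` set J \<subseteq> DL"
  proof -
    have "\<And>J. J \<in> set L \<Longrightarrow> card (\<rho> ` set J) \<le> M" using cM P(1) by simp
    from dbl_card[OF this, of L I "[]"] show thesis using that by blast
  qed
  have "{y. {x, y} \<in> red (quotient E V \<rho>)} \<subseteq> \<rho> ` set I \<union> DR \<union> DL"
  proof
    fix y assume "y \<in> {y. {x, y} \<in> red (quotient E V \<rho>)}"
    moreover have "all_adj E V \<rho> x y = all_adj E V \<rho> y x" "some_adj E V \<rho> x y = some_adj E V \<rho> y x" for x y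
      unfolding all_adj_def some_adj_def using sym by blast+
    ultimately have y: "y \<in> \<rho> ` V" "some_adj E V \<rho> x y" "\<not> all_adj E V \<rho> x y"
      unfolding quotient_def by (simp_all add: edge_set_iff)
    then obtain b where b: "b \<in> V" "y = \<rho> b" by blast
    obtain L' J R' where J: "P = rev L' @ J # R'" "b \<in> set J" using partition_split[OF assms(1) b(1)] .
    have inI: "\<rho> a \<in> set I" using P assms(3) unfolding classes_def by blast
    have yJ: "\<rho> b \<in> set J" using J assms(3) unfolding classes_def by blast
    \<comment> \<open>If adjacency between \<open>I\<close> and \<open>J\<close> depended on
      representatives only, the two classes would be complete or without edges to each other, and
      \<open>x y\<close> would not be red.\<close>
    have hom: False if h: "\<And>a' b'. a' \<in> set I \<Longrightarrow> b' \<in> set J \<Longrightarrow> E a' b' = E (\<rho> a') (\<rho> b')"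
    proof -
      have "E a' b' = E x y" if ab: "a' \<in> V" "b' \<in> V" "\<rho> a' = x" "\<rho> b' = y" for a' b'
      proof -
        have "I \<in> set P" using P(1) by simp
        moreover have "J \<in> set P" using J(1) by simp
        ultimately have "a' \<in> set I" "b' \<in> set J"
          using class_in_part[OF assms(1,3) ab(1), of I] class_in_part[OF assms(1,3) ab(2), of J]
            inI yJ ab(3,4) a(2) b(2) by auto
        from h[OF this] show ?thesis using ab(3,4) by simp
      qed
      then show False using y(2,3) unfolding some_adj_def all_adj_def by blast
    qed
    have "rev L @ I # R = rev L' @ J # R'" using P(1) J(1) by simp
    from split_unique[OF this] show "y \<in> \<rho> ` set I \<union> DR \<union> DL"
    proof (elim disjE exE conjE)
      assume "J = I" then show ?thesis using b J(2) by blast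
    next
      fix w assume w: "R = w @ J # R'"
      have "dbl E I (rev w) J"
        using homogeneous[OF assms(3), of L I w J R'] P(1) w hom by blast
      then show ?thesis using DR(3)[OF w] b J(2) by auto
    next
      fix w assume w: "rev L = rev L' @ J # w" "R' = w @ I # R"
      have L: "L = rev w @ J # L'" using arg_cong[OF w(1), of rev] by simp
      have "dbl E J (rev w) I"
      proof (rule ccontr)
        assume "\<not> dbl E J (rev w) I"
        then have "E b' a' = E (\<rho> b') (\<rho> a')" if "a' \<in> set I" "b' \<in> set J" for a' b'
          using homogeneous[OF assms(3), of L' J w I R] J(1) w(2) that by blast
        then show False using hom sym by blast
      qed
      then have "dbl E I (rev (rev w) @ []) J"
        using dbl_cong[of J J "rev w" "rev (rev w)" I I E] by (auto simp: dbl_def)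
      then show ?thesis using DL(3)[OF L] b J(2) by auto
    qed
  qed
  then have "card {y. {x, y} \<in> red (quotient E V \<rho>)} \<le> card (\<rho> ` set I \<union> DR \<union> DL)"
    using DR(2) DL(2) by (intro card_mono) auto
  also have "\<dots> \<le> card (\<rho> ` set I) + card DR + card DL"
    using card_Un_le by (meson add_le_mono1 le_trans)
  also have "\<dots> \<le> M + K * M + K * M"
  proof (intro add_mono)
    show "card (\<rho> ` set I) \<le> M" using cM P(1) by simp
    have *: "cnt E I [] R \<le> K" "cnt E I [] L \<le> K" using assms(2) P(1) unfolding bounded_counts_def by blast+
    show "card DR \<le> K * M" "card DL \<le> K * M"
      using le_trans[OF DR(1) mult_le_mono1[OF *(1)]] le_trans[OF DL(1) mult_le_mono1[OF *(2)]] by auto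
  qed
  finally show "card {y. {x, y} \<in> red (quotient E V \<rho>)} \<le> M * (2 * K + 1)"
    by (simp add: algebra_simps)
qed

section \<open>Contracting the equivalent vertices of each part\<close>

lemma contract_class:
  assumes "partition P" "bounded_counts K P" "classes M P \<rho>" "P = rev L @ I # R"
    and u: "u \<in> \<rho> ` set I" and v: "v \<in> \<rho> ` set I" and "u \<noteq> v" and uv: "eqv E L I R u v"
  defines "\<rho>' \<equiv> \<lambda>a. if \<rho> a = v then u else \<rho> a"
  shows "classes M P \<rho>'" "\<rho>' ` set I = \<rho> ` set I - {v}" "\<And>a. a \<in> V - set I \<Longrightarrow> \<rho>' a = \<rho> a"
    "trigraph_d_sequence (M * (2 * K + 1)) (quotient E V \<rho>') cs \<Longrightarrow>
     trigraph_d_sequence (M * (2 * K + 1)) (quotient E V \<rho>) ((u, v) # cs)"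
proof -
  have IV: "set I \<subseteq> V" "I \<in> set P" using assms(1,4) by (auto simp: partition_def)
  have idem: "\<rho> (\<rho> a) = \<rho> a" if "a \<in> V" for a using assms(3) that by (simp add: classes_def)
  have uI: "u \<in> set I" "v \<in> set I" using u v assms(3,4) unfolding classes_def by blast+
  have fixed: "\<rho> u = u" "\<rho> v = v" using u v idem IV by auto
  show img: "\<rho>' ` set I = \<rho> ` set I - {v}"
    using u v \<open>u \<noteq> v\<close> by (auto simp: \<rho>'_def)
  show out: "\<rho>' a = \<rho> a" if "a \<in> V - set I" for a
  proof -
    have "\<rho> a \<noteq> v" using class_in_part[OF assms(1,3) _ _ IV(2), of a] that uI by blast
    then show ?thesis by (simp add: \<rho>'_def)
  qed
  show "classes M P \<rho>'"
    unfolding classes_def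
  proof (intro conjI ballI allI impI)
    show "\<rho>' (\<rho>' a) = \<rho>' a" if "a \<in> V" for a
      using idem[OF that] fixed \<open>u \<noteq> v\<close> by (simp add: \<rho>'_def)
    fix L' J R' assume J: "P = rev L' @ J # R'"
    have old: "\<And>a. a \<in> set J \<Longrightarrow> \<rho> a \<in> set J \<and> eqv E L' J R' a (\<rho> a)" "card (\<rho> ` set J) \<le> M"
      using assms(3) J unfolding classes_def by blast+
    have JV: "set J \<subseteq> V" using assms(1) J by (auto simp: partition_def)
    have "rev L @ I # R = rev L' @ J # R'" using assms(4) J by simp
    then consider "J = I" "L' = L" "R' = R" | "J \<in> set L \<union> set R"
      using split_cases[of L I R L' J R'] by blast
    then have "(\<forall>a\<in>set J. \<rho>' a \<in> set J \<and> eqv E L' J R' a (\<rho>' a)) \<and> card (\<rho>' ` set J) \<le> M"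
    proof cases
      case 1
      have "\<rho>' a \<in> set J \<and> eqv E L' J R' a (\<rho>' a)" if "a \<in> set J" for a
        using old(1)[OF that] uI uv eqv_trans[of E L I R a v u] eqv_sym[of E L I R u v] 1
        by (cases "\<rho> a = v") (simp_all add: \<rho>'_def)
      moreover have "card (\<rho>' ` set J) \<le> card (\<rho> ` set J)"
        using img 1 by (intro card_mono) auto
      ultimately show ?thesis using old(2) by simp
    next
      case 2
      have "a \<notin> set I" if "a \<in> set J" for a
        using partition_disjoint[of L I R a J] assms(1,4) 2 that by blast
      then have eq: "\<rho>' a = \<rho> a" if "a \<in> set J" for a using out[of a] JV that by blast
      then have "\<rho>' ` set J = \<rho> ` set J" by (rule image_cong[OF refl])
      then show ?thesis using old eq by simp
    qed
    then show "card (\<rho>' ` set J) \<le> M" "\<And>a. a \<in> set J \<Longrightarrow> \<rho>' a \<in> set J"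
      "\<And>a. a \<in> set J \<Longrightarrow> eqv E L' J R' a (\<rho>' a)" by blast+
  qed
  have uV: "u \<in> \<rho> ` V" "v \<in> \<rho> ` V" using u v IV by auto
  show "trigraph_d_sequence (M * (2 * K + 1)) (quotient E V \<rho>) ((u, v) # cs)"
    if "trigraph_d_sequence (M * (2 * K + 1)) (quotient E V \<rho>') cs"
    using that red_degree[OF assms(1-3)] contract_quotient[OF sym uV \<open>u \<noteq> v\<close>] uV \<open>u \<noteq> v\<close>
    by (simp add: \<rho>'_def quotient_def)
qed

text \<open>The claim on contraction sequences is stated for every continuation \<open>cs\<close>,
  so that the outputs of successive parts and rounds compose by concatenation.\<close>

definition contracted where
  "contracted P K M L I R \<rho> \<rho>' A out \<longleftrightarrow> classes M P \<rho>' \<and> \<rho>' ` set I = set A \<and> distinct A \<and>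
    (\<forall>x\<in>set A. \<forall>y\<in>set A. eqv E L I R x y \<longrightarrow> x = y) \<and> (\<forall>a\<in>V - set I. \<rho>' a = \<rho> a) \<and>
    (\<forall>cs. trigraph_d_sequence (M * (2 * K + 1)) (quotient E V \<rho>') cs \<longrightarrow>
       trigraph_d_sequence (M * (2 * K + 1)) (quotient E V \<rho>) (out @ cs))"

lemma contract_part:
  assumes "partition P" "bounded_counts K P" "P = rev L @ I # R"
    and "classes M P \<rho>" "\<rho> ` set I = set acc \<union> set A" "distinct (acc @ A)"
    and "\<And>x y. x \<in> set acc \<Longrightarrow> y \<in> set acc \<Longrightarrow> eqv E L I R x y \<Longrightarrow> x = y"
  shows "\<exists>\<rho>'. contracted P K M L I R \<rho> \<rho>' (part_reps (eqv E L I R) acc A) (part_outs (eqv E L I R) acc A)"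
  using assms(4-)
proof (induction A arbitrary: acc \<rho>)
  case Nil
  then show ?case by (intro exI[of _ \<rho>]) (simp add: contracted_def)
next
  case (Cons c A)
  show ?case
  proof (cases "filter (\<lambda>u. eqv E L I R u c) acc")
    case Nil
    then have n1: "\<not> eqv E L I R u c" if "u \<in> set acc" for u using that by (simp add: filter_empty_conv)
    have n2: "\<not> eqv E L I R c u" if "u \<in> set acc" for u
      using n1[OF that] eqv_sym[of E L I R c u] by blast
    have sep: "x = y" if "x \<in> set (c # acc)" "y \<in> set (c # acc)" "eqv E L I R x y" for x y
      using that n1 n2 Cons.prems(4) by auto
    have eqs: "part_reps (eqv E L I R) acc (c # A) = part_reps (eqv E L I R) (c # acc) A"
      "part_outs (eqv E L I R) acc (c # A) = part_outs (eqv E L I R) (c # acc) A"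
      using Nil by simp_all
    show ?thesis
      unfolding eqs using Cons.prems(2,3) by (intro Cons.IH[OF Cons.prems(1) _ _ sep]) auto
  next
    case (Cons u us)
    then have "u \<in> set (filter (\<lambda>u. eqv E L I R u c) acc)" by simp
    then have u: "u \<in> set acc" "eqv E L I R u c" by auto
    let ?\<rho> = "\<lambda>a. if \<rho> a = c then u else \<rho> a"
    have uc: "u \<in> \<rho> ` set I" "c \<in> \<rho> ` set I" "u \<noteq> c" using u Cons.prems(2,3) by auto
    note cc = contract_class[OF assms(1,2) Cons.prems(1) assms(3) uc u(2)]
    have "?\<rho> ` set I = set acc \<union> set A" unfolding cc(2) using Cons.prems(2,3) by auto
    moreover have "distinct (acc @ A)" using Cons.prems(3) by simp
    ultimately obtain \<rho>' where \<rho>': "contracted P K M L I R ?\<rho> \<rho>' (part_reps (eqv E L I R) acc A) (part_outs (eqv E L I R) acc A)"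
      using Cons.IH[OF cc(1) _ _ Cons.prems(4)] by blast
    have eqs: "part_reps (eqv E L I R) acc (c # A) = part_reps (eqv E L I R) acc A"
      "part_outs (eqv E L I R) acc (c # A) = (u, c) # part_outs (eqv E L I R) acc A"
      using Cons by simp_all
    have "contracted P K M L I R \<rho> \<rho>' (part_reps (eqv E L I R) acc A) ((u, c) # part_outs (eqv E L I R) acc A)"
      using \<rho>' cc(3,4) unfolding contracted_def append_Cons
      by (simp del: trigraph_d_sequence.simps)
    then show ?thesis unfolding eqs by blast
  qed
qed

definition contracted_all where
  "contracted_all K M L R \<rho> \<rho>' \<longleftrightarrow> classes M (map fst (rev L @ R)) \<rho>' \<and>
    (\<forall>p\<in>set (reps E L R). \<rho>' ` set (fst p) = set (snd p) \<and> distinct (snd p)) \<and>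
    (\<forall>R1 p R2. R = R1 @ p # R2 \<longrightarrow> (\<forall>x\<in>\<rho>' ` set (fst p). \<forall>y\<in>\<rho>' ` set (fst p).
       eqv E (map fst (rev R1 @ L)) (fst p) (map fst R2) x y \<longrightarrow> x = y)) \<and>
    (\<forall>p\<in>set L. \<forall>a\<in>set (fst p). \<rho>' a = \<rho> a) \<and>
    (\<forall>cs. trigraph_d_sequence (M * (2 * K + 1)) (quotient E V \<rho>') cs \<longrightarrow>
       trigraph_d_sequence (M * (2 * K + 1)) (quotient E V \<rho>) (outs E L R @ cs))"

text \<open>Contracting inside one part leaves \<open>\<rho>\<close> unchanged on all other parts.
  So the survivors of later parts are still those listed, and the inequivalence achieved in earlier
  parts is not lost.\<close>

lemma contract_parts:
  assumes "partition (map fst (rev L @ R))" "bounded_counts K (map fst (rev L @ R))"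
    and "classes M (map fst (rev L @ R)) \<rho>"
    and "\<And>p. p \<in> set R \<Longrightarrow> \<rho> ` set (fst p) = set (snd p) \<and> distinct (snd p)"
  shows "\<exists>\<rho>'. contracted_all K M L R \<rho> \<rho>'"
  using assms
proof (induction R arbitrary: L \<rho>)
  case Nil
  then show ?case by (intro exI[of _ \<rho>]) (simp add: contracted_all_def)
next
  case (Cons p R)
  let ?P = "map fst (rev L @ p # R)" and ?L = "map fst L" and ?R = "map fst R"
  have P: "?P = rev ?L @ fst p # ?R" by (simp add: rev_map)
  let ?r = "eqv E ?L (fst p) ?R"
  obtain \<rho>1 where \<rho>1: "contracted ?P K M ?L (fst p) ?R \<rho> \<rho>1 (part_reps ?r [] (snd p)) (part_outs ?r [] (snd p))"
    using contract_part[OF Cons.prems(1,2) P Cons.prems(3), of "[]" "snd p"] Cons.prems(4)[of p] by auto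
  have disj: "a \<notin> set (fst p)" if "a \<in> set (fst q)" "q \<in> set L \<union> set R" for a q
    using partition_disjoint[of ?L "fst p" ?R a "fst q"] Cons.prems(1) that P by auto
  have inV: "set (fst q) \<subseteq> V" if "q \<in> set L \<union> set (p # R)" for q
    using Cons.prems(1) that by (auto simp: partition_def)
  have keep: "\<rho>1 a = \<rho> a" if "a \<in> set (fst q)" "q \<in> set L \<union> set R" for a q
    using \<rho>1 disj[OF that] inV[of q] that unfolding contracted_def by auto
  have "\<rho>1 ` set (fst q) = set (snd q) \<and> distinct (snd q)" if "q \<in> set R" for q
  proof -
    have "\<rho>1 ` set (fst q) = \<rho> ` set (fst q)" using keep that by (intro image_cong) auto
    then show ?thesis using Cons.prems(4)[of q] that by simp
  qed
  moreover have "classes M ?P \<rho>1" using \<rho>1 by (simp add: contracted_def)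
  ultimately have "\<exists>\<rho>'. contracted_all K M (p # L) R \<rho>1 \<rho>'"
    using Cons.prems(1,2) by (intro Cons.IH) simp_all
  then obtain \<rho>' where all: "contracted_all K M (p # L) R \<rho>1 \<rho>'" ..
  have "\<forall>q\<in>set (p # L). \<forall>a\<in>set (fst q). \<rho>' a = \<rho>1 a"
    using all unfolding contracted_all_def by blast
  then have \<rho>': "classes M ?P \<rho>'"
    "\<And>q. q \<in> set (reps E (p # L) R) \<Longrightarrow> \<rho>' ` set (fst q) = set (snd q) \<and> distinct (snd q)"
    "\<And>q a. q \<in> set (p # L) \<Longrightarrow> a \<in> set (fst q) \<Longrightarrow> \<rho>' a = \<rho>1 a"
    "\<And>cs. trigraph_d_sequence (M * (2 * K + 1)) (quotient E V \<rho>') cs \<Longrightarrow>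
       trigraph_d_sequence (M * (2 * K + 1)) (quotient E V \<rho>1) (outs E (p # L) R @ cs)"
    using all unfolding contracted_all_def by auto
  have sep: "x = y" if "R = R1 @ q # R2" "x \<in> \<rho>' ` set (fst q)" "y \<in> \<rho>' ` set (fst q)"
      "eqv E (map fst (rev R1 @ p # L)) (fst q) (map fst R2) x y" for R1 q R2 x y
    using all that unfolding contracted_all_def by blast
  have "\<rho>' ` set (fst p) = \<rho>1 ` set (fst p)" by (intro image_cong refl \<rho>'(3)[of p]) simp
  then have p: "\<rho>' ` set (fst p) = set (part_reps ?r [] (snd p))" using \<rho>1 by (simp add: contracted_def)
  show ?case
    unfolding contracted_all_def
  proof (intro exI[of _ \<rho>'] conjI ballI allI impI)
    show "classes M ?P \<rho>'" by fact
    show "\<rho>' ` set (fst q) = set (snd q)" "distinct (snd q)" if "q \<in> set (reps E L (p # R))" for q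
      using that p \<rho>'(2)[of q] \<rho>1 by (auto simp: contracted_def)
    show "x = y" if "p # R = R1 @ q # R2" "x \<in> \<rho>' ` set (fst q)" "y \<in> \<rho>' ` set (fst q)"
      "eqv E (map fst (rev R1 @ L)) (fst q) (map fst R2) x y" for R1 q R2 x y
    proof (cases R1)
      case Nil then show ?thesis using that p \<rho>1 by (simp add: contracted_def)
    next
      case (Cons p' R1')
      then show ?thesis using that by (intro sep[of R1' q R2 x y]) simp_all
    qed
    show "\<rho>' a = \<rho> a" if "q \<in> set L" "a \<in> set (fst q)" for q a
      using \<rho>'(3)[of q a] keep[of a q] that by simp
    show "trigraph_d_sequence (M * (2 * K + 1)) (quotient E V \<rho>) (outs E L (p # R) @ cs)"
      if "trigraph_d_sequence (M * (2 * K + 1)) (quotient E V \<rho>') cs" for cs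
      using \<rho>'(4)[OF that] \<rho>1 by (simp add: contracted_def)
  qed
qed

lemma classes_mono:
  assumes "classes M P \<rho>" "M \<le> M'"
  shows "classes M' P \<rho>"
  unfolding classes_def
proof (intro conjI allI impI)
  fix L I R assume P: "P = rev L @ I # R"
  show "\<forall>a\<in>set I. \<rho> a \<in> set I \<and> eqv E L I R a (\<rho> a)" "card (\<rho> ` set I) \<le> M'"
    using assms P unfolding classes_def by (blast intro: le_trans)+
qed (use assms(1) in \<open>simp add: classes_def\<close>)

text \<open>The invariant between rounds. The last clause makes the empty sequence correct at the
  end: with a single part both \<open>req\<close> sets are empty, all its vertices are equivalent
  and only one has survived.\<close>

definition state where
  "state K P \<rho> \<longleftrightarrow> partition (map fst P) \<and> bounded_counts K (map fst P) \<and>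
    classes (class_bound t K) (map fst P) \<rho> \<and>
    (\<forall>p\<in>set P. \<rho> ` set (fst p) = set (snd p) \<and> distinct (snd p)) \<and>
    (\<forall>p x y. P = [p] \<longrightarrow> x \<in> \<rho> ` set (fst p) \<longrightarrow> y \<in> \<rho> ` set (fst p) \<longrightarrow> x = y)"

text \<open>The survivors of an interval are pairwise inequivalent, so they have distinct traces on
  \<open>req\<close>. Hence \<open>card_classes\<close> bounds their number by
  \<open>class_bound t K\<close> whatever bound \<open>M\<close> held before, and the doubling by a
  merge does not accumulate.\<close>

lemma state_reps:
  assumes "partition (map fst P)" "bounded_counts K (map fst P)" "contracted_all K M [] P \<rho> \<rho>'"
  shows "state K (reps E [] P) \<rho>'"
proof -
  have cl: "classes M (map fst P) \<rho>'" using assms(3) by (simp add: contracted_all_def)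
  have sep: "x = y" if h: "map fst P = rev L @ I # R" "x \<in> \<rho>' ` set I" "y \<in> \<rho>' ` set I" "eqv E L I R x y" for L I R x y
  proof -
    obtain P1 P' where P': "P = P1 @ P'" "rev L = map fst P1" "I # R = map fst P'"
      using h(1) by (auto simp: map_eq_append_conv)
    then obtain p P2 where p: "P' = p # P2" "I = fst p" "R = map fst P2" by (cases P') auto
    have "L = map fst (rev P1)" using arg_cong[OF P'(2), of rev] by (simp add: rev_map)
    then have "eqv E (map fst (rev P1 @ [])) (fst p) (map fst P2) x y" using h(4) p by simp
    moreover have "P = P1 @ p # P2" "x \<in> \<rho>' ` set (fst p)" "y \<in> \<rho>' ` set (fst p)"
      using P'(1) p h(2,3) by simp_all
    ultimately show ?thesis using assms(3) unfolding contracted_all_def by blast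
  qed
  have "card (\<rho>' ` set I) \<le> class_bound t K" if I: "map fst P = rev L @ I # R" for L I R
  proof -
    let ?f = "\<lambda>c. {y \<in> req E I [] R \<union> req E I [] L. E c y}"
    have "inj_on ?f (\<rho>' ` set I)"
    proof (rule inj_onI)
      fix x y assume xy: "x \<in> \<rho>' ` set I" "y \<in> \<rho>' ` set I" "?f x = ?f y"
      then have "eqv E L I R x y" unfolding eqv_def by blast
      then show "x = y" by (rule sep[OF I xy(1,2)])
    qed
    then have "card (\<rho>' ` set I) = card (?f ` \<rho>' ` set I)" by (simp add: card_image)
    also have "\<rho>' ` set I \<subseteq> set I" using cl I unfolding classes_def by blast
    then have "card (?f ` \<rho>' ` set I) \<le> card (?f ` set I)" by (intro card_mono image_mono) auto
    also have "\<dots> \<le> class_bound t K"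
    proof (rule card_classes)
      show "parted pos (rev L @ I # R)" "\<Union>(set ` set (rev L @ I # R)) \<subseteq> V"
        using assms(1) unfolding partition_def I by auto
      show "cnt E J [] L' \<le> K \<and> cnt E J [] R' \<le> K" if "rev L @ I # R = rev L' @ J # R'" for L' J R'
        using assms(2) that unfolding bounded_counts_def I by blast
    qed
    finally show ?thesis .
  qed
  then have "classes (class_bound t K) (map fst P) \<rho>'"
    using cl unfolding classes_def by blast
  moreover have last: "x = y" if "reps E [] P = [p]" "x \<in> \<rho>' ` set (fst p)" "y \<in> \<rho>' ` set (fst p)" for p x y
  proof -
    have "map fst P = rev [] @ fst p # []" using arg_cong[OF that(1), of "map fst"] by (simp add: map_fst_reps)
    then show ?thesis by (rule sep[OF _ that(2,3)]) (simp add: eqv_def)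
  qed
  moreover have "\<forall>p\<in>set (reps E [] P). \<rho>' ` set (fst p) = set (snd p) \<and> distinct (snd p)"
    using assms(3) by (simp add: contracted_all_def)
  ultimately show ?thesis
    unfolding state_def map_fst_reps by - (intro conjI assms(1,2) allI impI; (assumption | (rule last; assumption)))
qed

section \<open>Effect of a merge on the invariant\<close>

lemma partition_merge: "partition (rev L @ I # I' # R) \<Longrightarrow> partition (rev L @ (I @ I') # R)"
  unfolding partition_def parted_def by (auto simp: sorted_wrt_append)

lemma bounded_counts_merge:
  assumes "bounded_counts K (rev L @ I # I' # R)" "cnt E (I @ I') [] R \<le> K" "cnt E (I @ I') [] L \<le> K"
  shows "bounded_counts K (rev L @ (I @ I') # R)"
  unfolding bounded_counts_def
proof (intro allI impI)
  fix L' J R' assume "rev L @ (I @ I') # R = rev L' @ J # R'"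
  from split_unique[OF this] show "cnt E J [] L' \<le> K \<and> cnt E J [] R' \<le> K"
  proof (elim disjE exE conjE)
    fix w assume w: "rev L' = rev L @ (I @ I') # w" "R = w @ J # R'"
    have L': "L' = rev w @ (I @ I') # L" using arg_cong[OF w(1), of rev] by simp
    have "rev L @ I # I' # R = rev (rev w @ I' # I # L) @ J # R'" using w(2) by simp
    then have "cnt E J [] (rev w @ I' # I # L) \<le> K" "cnt E J [] R' \<le> K"
      using assms(1) unfolding bounded_counts_def by blast+
    then show ?thesis
      using cnt_merge[of E J "[]" "rev w" I' I L] unfolding L' cnt_swap[of E J "[]" "rev w" I I'] by simp
  next
    fix w assume w: "rev L = rev L' @ J # w" "R' = w @ (I @ I') # R"
    have "rev L @ I # I' # R = rev L' @ J # w @ I # I' # R" using w(1) by simp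
    then have "cnt E J [] (w @ I # I' # R) \<le> K" "cnt E J [] L' \<le> K"
      using assms(1) unfolding bounded_counts_def by blast+
    then show ?thesis using cnt_merge[of E J "[]" w I I' R] w(2) by simp
  qed (use assms(2,3) in simp)
qed

lemma eqv_mono:
  "eqv E L I R a b \<Longrightarrow> req E I' [] R' \<union> req E I' [] L' \<subseteq> req E I [] R \<union> req E I [] L \<Longrightarrow> eqv E L' I' R' a b"
  unfolding eqv_def by blast

text \<open>The map \<open>\<rho>\<close> is kept. The equivalence only gets coarser, since
  \<open>req\<close> shrinks for the merged interval as well as for all others, and the merged
  interval has the classes of two old ones.\<close>

lemma classes_merge:
  assumes "classes M (rev L @ I # I' # R) \<rho>"
  shows "classes (2 * M) (rev L @ (I @ I') # R) \<rho>"
  unfolding classes_def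
proof (intro conjI allI impI)
  have old: "\<And>L' J R' a. rev L @ I # I' # R = rev L' @ J # R' \<Longrightarrow> a \<in> set J \<Longrightarrow> \<rho> a \<in> set J \<and> eqv E L' J R' a (\<rho> a)"
    "\<And>L' J R'. rev L @ I # I' # R = rev L' @ J # R' \<Longrightarrow> card (\<rho> ` set J) \<le> M"
    using assms unfolding classes_def by blast+
  fix L' J R' assume "rev L @ (I @ I') # R = rev L' @ J # R'"
  from split_unique[OF this]
  have "(\<forall>a\<in>set J. \<rho> a \<in> set J \<and> eqv E L' J R' a (\<rho> a)) \<and> card (\<rho> ` set J) \<le> 2 * M"
  proof (elim disjE exE conjE)
    assume J: "rev L' = rev L" "J = I @ I'" "R' = R"
    have P1: "rev L @ I # I' # R = rev L @ I # (I' # R)"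
      and P2: "rev L @ I # I' # R = rev (I # L) @ I' # R" by simp_all
    have swap: "req E (I @ I') [] L = req E (I' @ I) [] L" by (rule req_cong) auto
    have sub1: "req E (I @ I') [] R \<union> req E (I @ I') [] L \<subseteq> req E I [] (I' # R) \<union> req E I [] L"
      using req_merge_left[of E I I' "[]" R] req_merge_right[of E I' I "[]" L] swap by auto
    have sub2: "req E (I @ I') [] R \<union> req E (I @ I') [] L \<subseteq> req E I' [] R \<union> req E I' [] (I # L)"
      using req_merge_right[of E I I' "[]" R] req_merge_left[of E I' I "[]" L] swap by auto
    have "\<rho> a \<in> set J \<and> eqv E L' J R' a (\<rho> a)" if "a \<in> set J" for a
    proof (cases "a \<in> set I")
      case True
      then show ?thesis using old(1)[OF P1] eqv_mono[OF _ sub1] J by auto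
    next
      case False
      then have "a \<in> set I'" using that J by simp
      then show ?thesis using old(1)[OF P2] eqv_mono[OF _ sub2] J by auto
    qed
    moreover have "card (\<rho> ` set J) \<le> card (\<rho> ` set I) + card (\<rho> ` set I')"
      using card_Un_le[of "\<rho> ` set I" "\<rho> ` set I'"] J(2) by (simp add: image_Un)
    ultimately show ?thesis using old(2)[OF P1] old(2)[OF P2] by fastforce
  next
    fix w assume w: "rev L' = rev L @ (I @ I') # w" "R = w @ J # R'"
    have L': "L' = rev w @ (I @ I') # L" using arg_cong[OF w(1), of rev] by simp
    have P: "rev L @ I # I' # R = rev (rev w @ I' # I # L) @ J # R'" using w(2) by simp
    have "req E J [] R' \<union> req E J [] L' \<subseteq> req E J [] R' \<union> req E J [] (rev w @ I' # I # L)"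
      using req_merge[of E J "[]" "rev w" I' I L] unfolding L' req_swap[of E J "[]" "rev w" I I'] by blast
    then show ?thesis using old[OF P] eqv_mono by (metis le_trans mult_2 le_add1)
  next
    fix w assume w: "rev L = rev L' @ J # w" "R' = w @ (I @ I') # R"
    have P: "rev L @ I # I' # R = rev L' @ J # (w @ I # I' # R)" using w(1) by simp
    have "req E J [] R' \<union> req E J [] L' \<subseteq> req E J [] (w @ I # I' # R) \<union> req E J [] L'"
      using req_merge[of E J "[]" w I I' R] unfolding w(2) by blast
    then show ?thesis using old[OF P] eqv_mono by (metis le_trans mult_2 le_add1)
  qed
  then show "\<forall>a\<in>set J. \<rho> a \<in> set J \<and> eqv E L' J R' a (\<rho> a)" "card (\<rho> ` set J) \<le> 2 * M" by simp_all
qed (use assms in \<open>simp add: classes_def\<close>)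

end

section \<open>Correctness of the contraction sequence\<close>

lemma merge_step_spec:
  "merge_step E K L R \<noteq> [] \<Longrightarrow> \<exists>L' p q R'. rev L @ R = rev L' @ p # q # R' \<and>
     cnt E (fst p @ fst q) [] (map fst R') \<le> K \<and> cnt E (fst p @ fst q) [] (map fst L') \<le> K \<and>
     merge_step E K L R = rev L' @ (fst p @ fst q, snd p @ snd q) # R'"
proof (induction E K L R rule: merge_step.induct)
  case (1 E K L p q R)
  show ?case
  proof (cases "cnt E (fst p @ fst q) [] (map fst R) \<le> K \<and> cnt E (fst p @ fst q) [] (map fst L) \<le> K")
    case True
    then show ?thesis by (intro exI[of _ L] exI[of _ p] exI[of _ q] exI[of _ R]) simp
  next
    case False
    then show ?thesis using 1 by auto
  qed
qed auto

lemma merge_step_nonempty: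
  "cnt E (fst p @ fst q) [] (map fst R) \<le> K \<Longrightarrow> cnt E (fst p @ fst q) [] (map fst (rev X @ L)) \<le> K \<Longrightarrow>
   merge_step E K L (X @ p # q # R) \<noteq> []"
proof (induction X arbitrary: L)
  case (Cons x X)
  obtain y Y where "X @ p # q # R = y # Y" by (cases X) auto
  then show ?case using Cons.IH[of "x # L"] Cons.prems by auto
qed simp

context ordered_graph
begin

text \<open>During a round an interval has up to \<open>2 * class_bound t K\<close> classes, the
  value right after the merge, and \<open>red_degree\<close> gives the bound for this value. After
  the round \<open>state_reps\<close> restores \<open>class_bound t K\<close>.\<close>

lemma contractions_correct:
  assumes C: "\<And>n H. H \<subseteq> {(i, j). i < j \<and> j < n} \<Longrightarrow> crossing_free (2 * t) H \<Longrightarrow> card H \<le> C * n"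
    and "V \<noteq> {}" and K: "K = 4 * C" and "state K P \<rho>"
  shows "trigraph_d_sequence (2 * class_bound t K * (2 * K + 1)) (quotient E V \<rho>) (contractions E K P)"
  using assms(4)
proof (induction "length P" arbitrary: P \<rho> rule: less_induct)
  case less
  let ?M = "2 * class_bound t K"
  have st: "partition (map fst P)" "bounded_counts K (map fst P)" "classes ?M (map fst P) \<rho>"
    "classes (class_bound t K) (map fst P) \<rho>"
    "\<And>p. p \<in> set P \<Longrightarrow> \<rho> ` set (fst p) = set (snd p) \<and> distinct (snd p)"
    "\<And>p x y. P = [p] \<Longrightarrow> x \<in> \<rho> ` set (fst p) \<Longrightarrow> y \<in> \<rho> ` set (fst p) \<Longrightarrow> x = y"
    using less.prems unfolding state_def by (auto intro: classes_mono)
  show ?case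
  proof (cases "length P \<le> 1")
    case True
    have "P \<noteq> []" using st(1) \<open>V \<noteq> {}\<close> by (auto simp: partition_def)
    then obtain p where p: "P = [p]" using True by (cases P) auto
    then have V: "V = set (fst p)" using st(1) by (simp add: partition_def)
    obtain a where "a \<in> V" using \<open>V \<noteq> {}\<close> by blast
    then have "\<rho> ` V = {\<rho> a}" using st(6)[OF p] V by blast
    then show ?thesis
      using True red_degree[OF st(1-3)] by (simp add: contractions.simps[of E K P] quotient_def)
  next
    case False
    have "parted pos (map fst P)" "2 \<le> length (map fst P)" using st(1) False by (auto simp: partition_def)
    from mergeable_pair[OF this C] obtain L I I' R where
      ex: "map fst P = rev L @ I # I' # R" "cnt E (I @ I') [] R \<le> K" "cnt E (I @ I') [] L \<le> K"
      unfolding K by blast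
    then obtain X p q R1 where X: "P = X @ p # q # R1" "rev L = map fst X" "I = fst p" "I' = fst q" "R = map fst R1"
      by (auto simp: map_eq_append_conv map_eq_Cons_conv)
    have "L = map fst (rev X @ [])" using arg_cong[OF X(2), of rev] by (simp add: rev_map)
    then have ne: "merge_step E K [] P \<noteq> []"
      using ex(2,3) X unfolding X(1) by (intro merge_step_nonempty) simp_all
    let ?P1 = "merge_step E K [] P"
    \<comment> \<open>The pair merged here may differ from the one provided by
      \<open>mergeable_pair\<close>, which only shows that the search succeeds.\<close>
    from merge_step_spec[OF ne] obtain L' p q R' where
      m: "P = rev L' @ p # q # R'" "cnt E (fst p @ fst q) [] (map fst R') \<le> K"
        "cnt E (fst p @ fst q) [] (map fst L') \<le> K" "?P1 = rev L' @ (fst p @ fst q, snd p @ snd q) # R'"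
      by auto
    have mP: "map fst P = rev (map fst L') @ fst p # fst q # map fst R'" using m(1) by (simp add: rev_map)
    have mP1: "map fst ?P1 = rev (map fst L') @ (fst p @ fst q) # map fst R'" using m(4) by (simp add: rev_map)
    have part1: "partition (map fst ?P1)" unfolding mP1 by (rule partition_merge) (use st(1) mP in simp)
    have bc1: "bounded_counts K (map fst ?P1)"
      unfolding mP1 by (rule bounded_counts_merge) (use st(2) mP m(2,3) in simp_all)
    have cl1: "classes ?M (map fst ?P1) \<rho>"
      unfolding mP1 by (rule classes_merge) (use st(4) mP in simp)
    have disj: "set (snd p) \<inter> set (snd q) = {}"
    proof -
      have "map fst P = rev (map fst L') @ fst p # (fst q # map fst R')"
        "map fst P = rev (fst p # map fst L') @ fst q # map fst R'" using mP by simp_all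
      then have "\<rho> ` set (fst p) \<subseteq> set (fst p)" "\<rho> ` set (fst q) \<subseteq> set (fst q)"
        using st(3) unfolding classes_def by blast+
      then show ?thesis
        using partition_disjoint[of "map fst L'" "fst p" "fst q # map fst R'" _ "fst q"] st(1,5) m(1) mP by auto
    qed
    have alive1: "\<rho> ` set (fst r) = set (snd r) \<and> distinct (snd r)" if r: "r \<in> set ?P1" for r
    proof -
      have "\<rho> ` set (fst p) = set (snd p) \<and> distinct (snd p)" "\<rho> ` set (fst q) = set (snd q) \<and> distinct (snd q)"
        using st(5)[of p] st(5)[of q] m(1) by simp_all
      moreover have "r = (fst p @ fst q, snd p @ snd q) \<or> r \<in> set P"
        using r unfolding m(4) by (auto simp: m(1))
      ultimately show ?thesis using st(5)[of r] disj by (elim disjE) (simp_all only: fst_conv snd_conv set_append image_Un distinct_append simp_thms)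
    qed
    obtain \<rho>' where \<rho>': "contracted_all K ?M [] ?P1 \<rho> \<rho>'"
      using contract_parts[of "[]" ?P1 K ?M \<rho>] part1 bc1 cl1 alive1 by auto
    have "length (reps E [] ?P1) < length P" using m(1,4) by simp
    then have "trigraph_d_sequence (?M * (2 * K + 1)) (quotient E V \<rho>') (contractions E K (reps E [] ?P1))"
      by (rule less.hyps) (rule state_reps[OF part1 bc1 \<rho>'])
    moreover have "contractions E K P = outs E [] ?P1 @ contractions E K (reps E [] ?P1)"
      using False by (subst contractions.simps) simp
    ultimately show ?thesis using \<rho>' unfolding contracted_all_def by simp
  qed
qed

text \<open>A single vertex has at most one start on either side, namely its nearest neighbour; all
  later intervals are hidden behind it. This is where \<open>1 \<le> K\<close> is used.\<close>

lemma initial_state: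
  assumes "V = set vs" "sorted_wrt (\<lambda>a b. pos a < pos b) vs" "1 \<le> K" "1 \<le> class_bound t K"
  shows "state K (map (\<lambda>v. ([v], [v])) vs) id"
proof -
  have fulls: "map fst (map (\<lambda>v. ([v], [v])) vs) = map (\<lambda>v. [v]) vs" by simp
  have part: "partition (map (\<lambda>v. [v]) vs)"
    unfolding partition_def parted_def using assms(1,2) by (simp add: sorted_wrt_map)
  have single: "\<exists>v. I = [v]" if "map (\<lambda>v. [v]) vs = rev L @ I # R" for L I R
  proof -
    have "I \<in> set (map (\<lambda>v. [v]) vs)" unfolding that by simp
    then show ?thesis by auto
  qed
  have zero: "cnt E [v] B R = 0" if "hasnbs E v B" for v B R
    using that by (induction R arbitrary: B) (auto simp: start_def hasnbs_def)
  have one: "cnt E [v] B R \<le> 1" for v B R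
  proof (induction R arbitrary: B)
    case (Cons J R)
    show ?case
    proof (cases "start E [v] B J")
      case True
      then have "hasnbs E v (J # B)" by (auto simp: start_def hasnbs_def)
      then show ?thesis using True zero by simp
    next
      case False then show ?thesis using Cons[of "J # B"] by simp
    qed
  qed simp
  have "bounded_counts K (map (\<lambda>v. [v]) vs)"
    unfolding bounded_counts_def using single one assms(3) by (metis le_trans)
  moreover have "classes (class_bound t K) (map (\<lambda>v. [v]) vs) id"
    unfolding classes_def using single assms(4) by (fastforce simp: eqv_refl)
  ultimately show ?thesis
    using part unfolding state_def fulls by (auto simp: map_eq_Cons_conv)
qed

end

section \<open>Terrains\<close>

definition slope :: "real \<times> real \<Rightarrow> real \<times> real \<Rightarrow> real" where
  "slope p q = (snd q - snd p) / (fst q - fst p)"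

lemma closed_segment_slope:
  assumes "fst p < fst q"
  shows "z \<in> closed_segment p q \<longleftrightarrow>
    fst p \<le> fst z \<and> fst z \<le> fst q \<and> snd z = snd p + slope p q * (fst z - fst p)"
proof
  assume "z \<in> closed_segment p q"
  then obtain u where u: "0 \<le> u" "u \<le> 1" "z = (1 - u) *\<^sub>R p + u *\<^sub>R q" by (auto simp: closed_segment_def)
  have z: "fst z = fst p + u * (fst q - fst p)" "snd z = snd p + u * (snd q - snd p)"
    unfolding u(3) by (simp_all add: algebra_simps)
  define w where "w = u * (fst q - fst p)"
  have "0 \<le> w" unfolding w_def using u assms by simp
  moreover have "w \<le> fst q - fst p"
    unfolding w_def using u assms by (intro mult_left_le_one_le) simp_all
  ultimately have "fst p \<le> fst z" "fst z \<le> fst q" using z(1)[folded w_def] by linarith+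
  moreover have "snd z = snd p + slope p q * (fst z - fst p)" using z assms by (simp add: slope_def)
  ultimately show "fst p \<le> fst z \<and> fst z \<le> fst q \<and> snd z = snd p + slope p q * (fst z - fst p)"
    by simp
next
  assume z: "fst p \<le> fst z \<and> fst z \<le> fst q \<and> snd z = snd p + slope p q * (fst z - fst p)"
  define u where "u = (fst z - fst p) / (fst q - fst p)"
  have "0 \<le> u" "u \<le> 1" using z assms by (auto simp: u_def)
  moreover have "fst z = (1 - u) * fst p + u * fst q"
  proof -
    have "(1 - u) * fst p + u * fst q = fst p + u * (fst q - fst p)" by (simp add: algebra_simps)
    also have "u * (fst q - fst p) = fst z - fst p" using assms by (simp add: u_def)
    finally show ?thesis by simp
  qed
  moreover have "snd z = (1 - u) * snd p + u * snd q"
  proof -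
    have "(1 - u) * snd p + u * snd q = snd p + u * (snd q - snd p)" by (simp add: algebra_simps)
    also have "u * (snd q - snd p) = slope p q * (fst z - fst p)" by (simp add: u_def slope_def)
    finally show ?thesis using z by simp
  qed
  ultimately show "z \<in> closed_segment p q"
    unfolding closed_segment_def by (auto intro!: exI[of _ u] prod_eqI)
qed

lemma sees_slope:
  assumes "fst p < fst q"
  shows "sees ps p q \<longleftrightarrow> (\<forall>c\<in>chain ps. fst p \<le> fst c \<longrightarrow> fst c \<le> fst q \<longrightarrow> snd c \<le> snd p + slope p q * (fst c - fst p))"
proof
  assume s: "sees ps p q"
  show "\<forall>c\<in>chain ps. fst p \<le> fst c \<longrightarrow> fst c \<le> fst q \<longrightarrow> snd c \<le> snd p + slope p q * (fst c - fst p)"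
  proof (intro ballI impI)
    fix c assume c: "c \<in> chain ps" "fst p \<le> fst c" "fst c \<le> fst q"
    have "(fst c, snd p + slope p q * (fst c - fst p)) \<in> closed_segment p q"
      using c assms by (simp add: closed_segment_slope)
    then show "snd c \<le> snd p + slope p q * (fst c - fst p)"
      using s c(1) unfolding sees_def strictly_below_def by fastforce
  qed
next
  assume "\<forall>c\<in>chain ps. fst p \<le> fst c \<longrightarrow> fst c \<le> fst q \<longrightarrow> snd c \<le> snd p + slope p q * (fst c - fst p)"
  then show "sees ps p q"
    unfolding sees_def strictly_below_def using closed_segment_slope[OF assms] by fastforce
qed

text \<open>As \<open>b\<close> is not above the line \<open>ac\<close> and \<open>c\<close> not
  above the line \<open>bd\<close>, the slope of \<open>ad\<close> lies between those of
  \<open>ac\<close> and \<open>bd\<close>. So the segment \<open>ad\<close> stays weakly above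
  \<open>ac\<close> up to \<open>c\<close> and weakly above \<open>bd\<close> after
  \<open>c\<close>, where these two bound the terrain.\<close>

lemma sees_order_claim:
  assumes x: "fst a < fst b" "fst b < fst c" "fst c < fst d" and bc: "b \<in> chain ps" "c \<in> chain ps"
    and ac: "sees ps a c" and bd: "sees ps b d"
  shows "sees ps a d"
proof -
  have xs: "fst a < fst c" "fst b < fst d" "fst a < fst d" using x by auto
  define m1 where "m1 = slope a c"
  define m2 where "m2 = slope b d"
  have c1: "snd c = snd a + m1 * (fst c - fst a)" using xs(1) by (simp add: m1_def slope_def)
  have d2: "snd d = snd b + m2 * (fst d - fst b)" using xs(2) by (simp add: m2_def slope_def)
  have b1: "snd b \<le> snd a + m1 * (fst b - fst a)"
    using ac bc(1) x xs sees_slope[OF xs(1)] by (simp add: m1_def)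
  have c2: "snd c \<le> snd b + m2 * (fst c - fst b)"
    using bd bc(2) x xs sees_slope[OF xs(2)] by (simp add: m2_def)
  have "m1 * (fst c - fst b) \<le> m2 * (fst c - fst b)" using c1 b1 c2 by (simp add: algebra_simps)
  then have m: "m1 \<le> m2" using x(2) by simp
  have "m1 * (fst d - fst a) \<le> snd d - snd a"
    using c1 d2 c2 mult_right_mono[OF m, of "fst d - fst c"] x by (simp add: algebra_simps)
  then have s1: "m1 \<le> slope a d" using xs(3) by (simp add: slope_def pos_le_divide_eq)
  have "snd d - snd a \<le> m2 * (fst d - fst a)"
    using b1 d2 mult_right_mono[OF m, of "fst b - fst a"] x by (simp add: algebra_simps)
  then have s2: "slope a d \<le> m2" using xs(3) by (simp add: slope_def pos_divide_le_eq)
  have d3: "snd d = snd a + slope a d * (fst d - fst a)" using xs(3) by (simp add: slope_def)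
  show ?thesis
    unfolding sees_slope[OF xs(3)]
  proof (intro ballI impI)
    fix z assume z: "z \<in> chain ps" "fst a \<le> fst z" "fst z \<le> fst d"
    show "snd z \<le> snd a + slope a d * (fst z - fst a)"
    proof (cases "fst z \<le> fst c")
      case True
      then have "snd z \<le> snd a + m1 * (fst z - fst a)"
        using ac z sees_slope[OF xs(1)] by (simp add: m1_def)
      also have "\<dots> \<le> snd a + slope a d * (fst z - fst a)"
        using mult_right_mono[OF s1, of "fst z - fst a"] z by simp
      finally show ?thesis .
    next
      case False
      then have "snd z \<le> snd b + m2 * (fst z - fst b)"
        using bd z x sees_slope[OF xs(2)] by (simp add: m2_def)
      also have "\<dots> = snd d - m2 * (fst d - fst z)" using d2 by (simp add: algebra_simps)
      also have "\<dots> \<le> snd d - slope a d * (fst d - fst z)"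
        using mult_right_mono[OF s2, of "fst d - fst z"] z by simp
      also have "\<dots> = snd a + slope a d * (fst z - fst a)" using d3 by (simp add: algebra_simps)
      finally show ?thesis .
    qed
  qed
qed

section \<open>From left-right orderings to ordered graphs\<close>

lemma sees_commute: "sees ps p q = sees ps q p"
  by (simp add: sees_def closed_segment_commute)

text \<open>\<open>pos\<close> is the index in \<open>vs\<close>. Edges have both ends in
  \<open>vs\<close>, so the order claim can be read off the terrain and extends to arbitrary
  elements of the vertex type.\<close>

lemma ordered_graph_left_right_ordering:
  assumes lr: "left_right_ordering G vs" and "H_free t G"
  obtains pos where "ordered_graph (\<lambda>a b. (a, b) \<in> parcs G) pos (pverts G) t"
    "sorted_wrt (\<lambda>a b. pos a < pos b) vs"
proof -
  define n where "n = length vs"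
  have vs: "distinct vs" "set vs = pverts G" using lr by (auto simp: left_right_ordering_def)
  obtain ps where ps: "terrain ps" "length ps = n"
    and arcs: "parcs G = {(vs ! i, vs ! j) | i j. i < n \<and> j < n \<and> (ps ! i, ps ! j) \<in> parcs (visibility_graph ps)}"
    using lr by (auto simp: left_right_ordering_def n_def)
  define E where "E a b \<longleftrightarrow> (a, b) \<in> parcs G" for a b
  define pos where "pos a = int (inv_into {..<n} ((!) vs) a)" for a
  have inj: "inj_on ((!) vs) {..<n}" using vs(1) by (auto simp: inj_on_def n_def nth_eq_iff_index_eq)
  have pos_nth: "pos (vs ! i) = int i" if "i < n" for i
    using inj that by (simp add: pos_def inv_into_f_f)
  have E_nth: "E (vs ! i) (vs ! j) \<longleftrightarrow> i \<noteq> j \<and> sees ps (ps ! i) (ps ! j)" if "i < n" "j < n" for i j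
  proof -
    have "ps ! i = ps ! j \<longleftrightarrow> i = j"
      using ps that sorted_wrt_nth_less[of "\<lambda>p q. fst p < fst q" ps] unfolding terrain_def
      by (metis less_irrefl linorder_neqE_nat)
    moreover have "E (vs ! i) (vs ! j) \<longleftrightarrow> (ps ! i, ps ! j) \<in> parcs (visibility_graph ps)"
      using that vs(1) unfolding E_def arcs by (auto simp: n_def nth_eq_iff_index_eq)
    ultimately show ?thesis using that ps(2) by (simp add: visibility_graph_def)
  qed
  have E_V: "\<exists>i<n. \<exists>j<n. a = vs ! i \<and> b = vs ! j" if "E a b" for a b
    using that unfolding E_def arcs by blast
  have "ordered_graph E pos (pverts G) t"
  proof
    show "E b a" if ab: "E a b" for a b
    proof -
      obtain i j where ij: "i < n" "j < n" "a = vs ! i" "b = vs ! j" using E_V[OF ab] by blast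
      then show ?thesis using ab E_nth[OF ij(1,2)] E_nth[OF ij(2,1)] sees_commute[of ps "ps ! i"] by simp
    qed
    show "inj_on pos (pverts G)"
      using pos_nth by (auto simp: inj_on_def in_set_conv_nth n_def simp flip: vs(2))
    show "E a d" if "pos a < pos b" "pos b < pos c" "pos c < pos d" "E a c" "E b d" for a b c d
    proof -
      obtain i j k l where ijkl: "i < n" "j < n" "k < n" "l < n" "a = vs ! i" "b = vs ! j" "c = vs ! k" "d = vs ! l"
        using E_V[OF \<open>E a c\<close>] E_V[OF \<open>E b d\<close>] by auto
      then have lt: "i < j" "j < k" "k < l" using that(1-3) pos_nth by auto
      have inc: "fst (ps ! p) < fst (ps ! q)" if "p < q" "q < n" for p q
        using ps that sorted_wrt_nth_less unfolding terrain_def by fastforce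
      have "ps ! j \<in> chain ps" "ps ! k \<in> chain ps" using ijkl ps(2) by (auto simp: chain_def)
      moreover have "sees ps (ps ! i) (ps ! k)" "sees ps (ps ! j) (ps ! l)"
        using that(4,5) E_nth ijkl by auto
      ultimately have "sees ps (ps ! i) (ps ! l)"
        using sees_order_claim[OF inc[OF lt(1)] inc[OF lt(2)] inc[OF lt(3)]] ijkl by blast
      then show ?thesis using E_nth[of i l] ijkl lt by simp
    qed
    show "half_graph_free E pos t"
      unfolding half_graph_free_def
    proof safe
      fix a b :: "nat \<Rightarrow> 'a"
      assume ab: "\<forall>i<t. \<forall>j<t. pos (a i) < pos (b j) \<and> (E (a i) (b j) \<longleftrightarrow> i \<le> j)"
      \<comment> \<open>\<open>H_free\<close> numbers the vertices from 1,
        \<open>half_graph_free\<close> from 0.\<close>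
      let ?a = "\<lambda>i. a (i - 1)" and ?b = "\<lambda>i. b (i - 1)"
      have E: "E (?a i) (?b j) \<longleftrightarrow> i \<le> j" if "i \<in> {1..t}" "j \<in> {1..t}" for i j
      proof -
        have "i - 1 < t" "j - 1 < t" "i - 1 \<le> j - 1 \<longleftrightarrow> i \<le> j" using that by auto
        then show ?thesis using ab by blast
      qed
      \<comment> \<open>The edge between \<open>?a j\<close> and \<open>?b j\<close> becomes one
        between \<open>?a i\<close> and \<open>?b j\<close>; exchanging \<open>i\<close> and
        \<open>j\<close> gives equality.\<close>
      have "?a i = ?a j \<Longrightarrow> i \<le> j" if "i \<in> {1..t}" "j \<in> {1..t}" for i j
        using E[OF that] E[OF that(2,2)] by simp
      then have "inj_on ?a {1..t}" by (intro inj_onI le_antisym) metis+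
      moreover have "?b i = ?b j \<Longrightarrow> i \<le> j" if "i \<in> {1..t}" "j \<in> {1..t}" for i j
        using E[OF that] E[OF that(1,1)] by simp
      then have "inj_on ?b {1..t}" by (intro inj_onI le_antisym) metis+
      moreover have "?a i \<noteq> ?b j" if "i \<in> {1..t}" "j \<in> {1..t}" for i j
      proof -
        have "i - 1 < t" "j - 1 < t" using that by auto
        then show ?thesis using ab by force
      qed
      then have "?a ` {1..t} \<inter> ?b ` {1..t} = {}" by blast
      moreover have "?a i \<in> pverts G" "?b i \<in> pverts G" if "i \<in> {1..t}" for i
        using E[OF that that] E_V[of "?a i" "?b i"] vs(2) n_def by (auto simp: set_conv_nth)
      then have "?a ` {1..t} \<subseteq> pverts G" "?b ` {1..t} \<subseteq> pverts G" by blast+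
      ultimately have "\<not> H_free t G"
        unfolding H_free_def not_not using E unfolding E_def by - (rule exI[of _ ?a], rule exI[of _ ?b], blast)
      with assms(2) show False by simp
    qed
  qed
  moreover have "sorted_wrt (\<lambda>a b. pos a < pos b) vs"
    unfolding sorted_wrt_iff_nth_less using pos_nth by (simp add: n_def)
  ultimately show thesis using that unfolding E_def[abs_def] by blast
qed

lemma trigraph_of_left_right_ordering:
  assumes "left_right_ordering G vs"
  shows "trigraph_of G = quotient (\<lambda>a b. (a, b) \<in> parcs G) (pverts G) id"
proof -
  obtain ps where vs: "distinct vs" "set vs = pverts G" and
    arcs: "parcs G = {(vs ! i, vs ! j) | i j. i < length vs \<and> j < length vs \<and>
      (ps ! i, ps ! j) \<in> parcs (visibility_graph ps)}"
    using assms by (auto simp: left_right_ordering_def)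
  have "a \<in> pverts G \<and> b \<in> pverts G \<and> a \<noteq> b" if ab: "(a, b) \<in> parcs G" for a b
  proof -
    obtain i j where ij: "i < length vs" "j < length vs" "a = vs ! i" "b = vs ! j"
      "(ps ! i, ps ! j) \<in> parcs (visibility_graph ps)"
      using ab unfolding arcs by blast
    then have "i \<noteq> j" by (auto simp: visibility_graph_def)
    then show ?thesis
      using nth_mem[OF ij(1)] nth_mem[OF ij(2)] ij(1-4) vs by (simp add: nth_eq_iff_index_eq)
  qed
  moreover have "all_adj (\<lambda>a b. (a, b) \<in> parcs G) (pverts G) id x y \<longleftrightarrow> (x, y) \<in> parcs G"
    "some_adj (\<lambda>a b. (a, b) \<in> parcs G) (pverts G) id x y \<longleftrightarrow> (x, y) \<in> parcs G"
    if "x \<in> pverts G" "y \<in> pverts G" for x y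
    using that by (simp_all add: all_adj_def some_adj_def)
  ultimately have "{{x, y} | x y. (x, y) \<in> parcs G} =
      edge_set (pverts G) (all_adj (\<lambda>a b. (a, b) \<in> parcs G) (pverts G) id)"
    "edge_set (pverts G) (\<lambda>x y. some_adj (\<lambda>a b. (a, b) \<in> parcs G) (pverts G) id x y \<and>
       \<not> all_adj (\<lambda>a b. (a, b) \<in> parcs G) (pverts G) id x y) = {}"
    unfolding edge_set_def by blast+
  then show ?thesis by (simp add: trigraph_of_def quotient_def)
qed

lemma class_bound_pos: "0 < class_bound t K"
  unfolding class_bound_def by (intro zero_less_power mult_pos_pos) simp_all

text \<open>Stated for an arbitrary vertex type, since it serves both the points of a terrain and
  the numbered vertices of an algorithmic input.\<close>

lemma d_sequence_contractions:
  assumes "1 \<le> t"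
  shows "\<exists>K d. \<forall>(G :: 'a pair_pre_digraph) vs. left_right_ordering G vs \<longrightarrow> H_free t G \<longrightarrow>
    d_sequence d G (contractions (\<lambda>a b. (a, b) \<in> parcs G) K (map (\<lambda>v. ([v], [v])) vs))"
proof -
  obtain C where C: "\<And>n H. H \<subseteq> {(i, j). i < j \<and> j < n} \<Longrightarrow> crossing_free (2 * t) H \<Longrightarrow> card H \<le> C * n"
    using crossing_free_linear[of "2 * t"] assms by auto
  \<comment> \<open>With \<open>Suc C\<close> instead of \<open>C\<close> the threshold
    \<open>K\<close> is positive, as \<open>initial_state\<close> demands.\<close>
  have C1: "card H \<le> Suc C * n" if "H \<subseteq> {(i, j). i < j \<and> j < n}" "crossing_free (2 * t) H" for n H
    using C[OF that] by simp
  define K where "K = 4 * Suc C"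
  have "d_sequence (2 * class_bound t K * (2 * K + 1)) G
      (contractions (\<lambda>a b. (a, b) \<in> parcs G) K (map (\<lambda>v. ([v], [v])) vs))"
    if lr: "left_right_ordering G vs" and hf: "H_free t G" for G :: "'a pair_pre_digraph" and vs
  proof -
    obtain pos where "ordered_graph (\<lambda>a b. (a, b) \<in> parcs G) pos (pverts G) t"
      and sorted: "sorted_wrt (\<lambda>a b. pos a < pos b) vs"
      using ordered_graph_left_right_ordering[OF lr hf] .
    then interpret ordered_graph "\<lambda>a b. (a, b) \<in> parcs G" pos "pverts G" t by simp
    have "vs \<noteq> []" "set vs = pverts G" using lr by (auto simp: left_right_ordering_def terrain_def)
    then have "pverts G \<noteq> {}" "pverts G = set vs" by auto
    moreover from this(2) have "state K (map (\<lambda>v. ([v], [v])) vs) id"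
      by (rule initial_state[OF _ sorted]) (simp_all add: K_def Suc_le_eq class_bound_pos)
    ultimately show ?thesis
      using contractions_correct[OF C1 _ K_def] by (simp add: d_sequence_def trigraph_of_left_right_ordering[OF lr])
  qed
  then show ?thesis by blast
qed

lemma left_right_ordering_visibility_graph:
  assumes "terrain ps"
  shows "left_right_ordering (visibility_graph ps) ps"
proof -
  have "distinct ps"
    unfolding distinct_conv_nth
  proof (intro allI impI)
    fix i j assume "i < length ps" "j < length ps" "i \<noteq> j"
    then show "ps ! i \<noteq> ps ! j"
      using assms sorted_wrt_nth_less[of "\<lambda>p q. fst p < fst q" ps] unfolding terrain_def
      by (metis less_irrefl linorder_neqE_nat)
  qed
  moreover have "parcs (visibility_graph ps) \<subseteq> {(ps ! i, ps ! j) | i j. i < length ps \<and> j < length ps \<and>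
      (ps ! i, ps ! j) \<in> parcs (visibility_graph ps)}"
  proof
    fix e assume e: "e \<in> parcs (visibility_graph ps)"
    then have "fst e \<in> set ps" "snd e \<in> set ps" by (auto simp: visibility_graph_def)
    then obtain i j where "i < length ps" "j < length ps" "e = (ps ! i, ps ! j)"
      by (metis in_set_conv_nth prod.collapse)
    then show "e \<in> {(ps ! i, ps ! j) | i j. i < length ps \<and> j < length ps \<and>
      (ps ! i, ps ! j) \<in> parcs (visibility_graph ps)}" using e by blast
  qed
  ultimately show ?thesis
    using assms unfolding left_right_ordering_def by (auto simp: visibility_graph_def)
qed

section \<open>Running time\<close>

subsection \<open>Evaluation with a bound on the cost\<close>

text \<open>An upper bound instead of the exact number of steps allows costs to be rounded up at
  every function call.\<close>

definition ev :: "program \<Rightarrow> sexp list \<Rightarrow> expr \<Rightarrow> sexp \<Rightarrow> nat \<Rightarrow> bool" where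
  "ev P env e x c \<longleftrightarrow> (\<exists>k\<le>c. eval P env e x k)"

definition evl :: "program \<Rightarrow> sexp list \<Rightarrow> expr list \<Rightarrow> sexp list \<Rightarrow> nat \<Rightarrow> bool" where
  "evl P env es xs c \<longleftrightarrow> (\<exists>k\<le>c. evals P env es xs k)"

definition evc :: "program \<Rightarrow> nat \<Rightarrow> sexp list \<Rightarrow> sexp \<Rightarrow> nat \<Rightarrow> bool" where
  "evc P f xs y c \<longleftrightarrow> f < length P \<and> ev P xs (P ! f) y c"

lemma ev_weaken: "ev P env e x c \<Longrightarrow> x = y \<Longrightarrow> c \<le> d \<Longrightarrow> ev P env e y d"
  by (auto simp: ev_def intro: le_trans)

lemma evc_weaken: "evc P f xs y c \<Longrightarrow> c \<le> d \<Longrightarrow> evc P f xs y d"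
  by (auto simp: evc_def intro: ev_weaken)

lemma ev_Arg: "i < length env \<Longrightarrow> ev P env (Arg i) (env ! i) 1"
  unfolding ev_def using eval_evals.Arg by blast

lemma ev_Args:
  "ev P (a # env) (Arg 0) a 1"
  "ev P (a # b # env) (Arg 1) b 1"
  "ev P (a # b # c # env) (Arg 2) c 1"
  "ev P (a # b # c # d # env) (Arg 3) d 1"
  "ev P (a # b # c # d # e # env) (Arg 4) e 1"
  "ev P (a # b # c # d # e # f # env) (Arg 5) f 1"
  using ev_Arg[of 0 "a # env"] ev_Arg[of 1 "a # b # env"] ev_Arg[of 2 "a # b # c # env"]
    ev_Arg[of 3 "a # b # c # d # env"] ev_Arg[of 4 "a # b # c # d # e # env"]
    ev_Arg[of 5 "a # b # c # d # e # f # env"] by simp_all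

lemma ev_ENil: "ev P env ENil SNil 1"
  unfolding ev_def using eval_evals.ENil by blast

lemma ev_ECons: "ev P env e1 x1 k1 \<Longrightarrow> ev P env e2 x2 k2 \<Longrightarrow> ev P env (ECons e1 e2) (SCons x1 x2) (1 + k1 + k2)"
  unfolding ev_def
  by (elim exE conjE, rule exI, rule conjI[rotated], rule eval_evals.ECons, assumption+) simp

lemma ev_car: "ev P env e x k \<Longrightarrow> ev P env (ECar e) (car x) (1 + k)"
  unfolding ev_def
  by (elim exE conjE, rule exI, rule conjI[rotated], rule eval_evals.ECar, assumption+) simp

lemma ev_cdr: "ev P env e x k \<Longrightarrow> ev P env (ECdr e) (cdr x) (1 + k)"
  unfolding ev_def
  by (elim exE conjE, rule exI, rule conjI[rotated], rule eval_evals.ECdr, assumption+) simp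

lemma ev_ECar: "ev P env e (SCons x y) k \<Longrightarrow> ev P env (ECar e) x (1 + k)"
  and ev_ECdr: "ev P env e (SCons x y) k \<Longrightarrow> ev P env (ECdr e) y (1 + k)"
  using ev_car[of P env e "SCons x y"] ev_cdr[of P env e "SCons x y"] by simp_all

lemma ev_If:
  assumes "ev P env b x k1" "ev P env (if x = SNil then e2 else e1) y k2"
  shows "ev P env (EIf b e1 e2) y (1 + k1 + k2)"
proof -
  obtain i j where ij: "i \<le> k1" "eval P env b x i" "j \<le> k2" "eval P env (if x = SNil then e2 else e1) y j"
    using assms by (auto simp: ev_def)
  have "eval P env (EIf b e1 e2) y (1 + i + j)"
    using ij(2,4) eval_evals.EIf_false[of P env b i e2 y j e1] eval_evals.EIf_true[of P env b x i e1 y j e2]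
    by (cases "x = SNil") simp_all
  then show ?thesis using ij(1,3) unfolding ev_def by (intro exI[of _ "1 + i + j"]) simp
qed

lemma ev_ifs: "x \<noteq> SNil \<Longrightarrow> ev P env e1 y k \<Longrightarrow> ev P env (if x = SNil then e2 else e1) y k"
  "x = SNil \<Longrightarrow> ev P env e2 y k \<Longrightarrow> ev P env (if x = SNil then e2 else e1) y k"
  by simp_all

lemma ev_Call: "evl P env es xs k1 \<Longrightarrow> evc P f xs y k2 \<Longrightarrow> ev P env (Call f es) y (1 + k1 + k2)"
  unfolding ev_def evl_def evc_def
  by (elim exE conjE, rule exI, rule conjI[rotated], rule eval_evals.Call, assumption+) simp

lemma evl_Nil: "evl P env [] [] 0"
  unfolding evl_def using eval_evals.Args_Nil by blast

lemma evl_Cons: "ev P env e x k1 \<Longrightarrow> evl P env es xs k2 \<Longrightarrow> evl P env (e # es) (x # xs) (k1 + k2)"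
  unfolding ev_def evl_def
  by (elim exE conjE, rule exI, rule conjI[rotated], rule eval_evals.Args_Cons, assumption+) simp

lemmas ev_rules = ev_Args ev_ENil ev_ECons ev_ECar ev_ECdr ev_If ev_Call evl_Nil evl_Cons

text \<open>Provides the comparison with the constant \<open>K\<close> in a language without
  arithmetic: as \<open>cdr SNil = SNil\<close>, iterated \<open>cdr\<close> is truncated
  subtraction, and the result is \<open>SNil\<close> iff \<open>m \<le> K\<close>.\<close>

lemma ev_cdrs: "ev P env e (enc_nat m) k \<Longrightarrow> ev P env ((ECdr ^^ K) e) (enc_nat (m - K)) (K + k)"
proof (induction K)
  case (Suc K)
  then have IH: "ev P env ((ECdr ^^ K) e) (enc_nat (m - K)) (K + k)" by simp
  have "cdr (enc_nat i) = enc_nat (i - 1)" for i by (cases i) simp_all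
  then show ?case using ev_cdr[OF IH] by simp
qed simp

lemma enc_bool_SNil [simp]: "enc_bool b = SNil \<longleftrightarrow> \<not> b"
  by (simp add: enc_bool_def)

lemma enc_list_SNil [simp]: "enc_list f xs = SNil \<longleftrightarrow> xs = []"
  by (cases xs) simp_all

lemma enc_nat_SNil [simp]: "enc_nat i = SNil \<longleftrightarrow> i = 0"
  by (cases i) simp_all

subsection \<open>The program\<close>

text \<open>Functions are called by their position in \<open>prog\<close>. The last argument \<open>M\<close> is the adjacency
  matrix; the order of the arguments of each function can be read off its evaluation lemma, e.g.
  \<open>evc_hasnb\<close> for \<open>hasnb_body\<close>.\<close>

abbreviation ETrue :: expr where
  "ETrue \<equiv> ECons ENil ENil"

text \<open>Existential quantification over the list in argument 0: \<open>f\<close> is the index of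
  the loop itself, \<open>g\<close> that of the predicate, and \<open>es\<close> passes on the other
  arguments.\<close>

definition any_loop :: "nat \<Rightarrow> nat \<Rightarrow> expr list \<Rightarrow> expr" where
  "any_loop f g es = EIf (Arg 0)
     (EIf (Call g (ECar (Arg 0) # es)) ETrue (Call f (ECdr (Arg 0) # es))) ENil"

definition main_body :: expr where
  "main_body =
   Call 22 [Call 24 [ECdr (Arg 0)], ECar (Arg 0)]"

definition nth_body :: expr where
  "nth_body =
   EIf (Arg 0) (Call 1 [ECdr (Arg 0), ECdr (Arg 1)]) (ECar (Arg 1))"

definition adj_body :: expr where
  "adj_body =
   Call 1 [Arg 0, Call 1 [Arg 1, Arg 2]]"

definition hasnb_body :: expr where
  "hasnb_body =
   any_loop 3 2 [Arg 1, Arg 2]"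

definition hasnbs_body :: expr where
  "hasnbs_body =
   any_loop 4 3 [Arg 1, Arg 2]"

definition first_nb_body :: expr where
  "first_nb_body =
   EIf (Call 3 [Arg 1, Arg 0, Arg 3]) (EIf (Call 4 [Arg 2, Arg 0, Arg 3]) ENil ETrue) ENil"

definition start_body :: expr where
  "start_body =
   any_loop 6 5 [Arg 1, Arg 2, Arg 3]"

definition dbl_body :: expr where
  "dbl_body =
   EIf (Call 6 [Arg 0, Arg 1, Arg 2, Arg 3]) (Call 6 [Arg 1, Arg 0, Arg 2, Arg 3]) ENil"

definition cnt_body :: expr where
  "cnt_body =
   EIf (Arg 0)
     (EIf (Call 6 [Arg 1, ECar (ECar (Arg 0)), Arg 2, Arg 3])
       (ECons ENil (Call 8 [ECdr (Arg 0), Arg 1, ECons (ECar (ECar (Arg 0))) (Arg 2), Arg 3]))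
       (Call 8 [ECdr (Arg 0), Arg 1, ECons (ECar (ECar (Arg 0))) (Arg 2), Arg 3]))
     ENil"

definition append_body :: expr where
  "append_body =
   EIf (Arg 0) (ECons (ECar (Arg 0)) (Call 9 [ECdr (Arg 0), Arg 1])) (Arg 1)"

definition rev_append_body :: expr where
  "rev_append_body =
   EIf (Arg 0) (Call 10 [ECdr (Arg 0), ECons (ECar (Arg 0)) (Arg 1)]) (Arg 1)"

definition merge_step_body :: expr where
  "merge_step_body =
   EIf (Arg 1) (EIf (ECdr (Arg 1))
     (Call 12 [Call 9 [ECar (ECar (Arg 1)), ECar (ECar (ECdr (Arg 1)))], Arg 0, Arg 1, Arg 2]) ENil) ENil"

text \<open>There are no local bindings, so the merged interval, which is needed several times, is
  bound by being passed to this auxiliary function. The condition is true iff the right or the left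
  count exceeds \<open>K\<close>, and then the search moves on.\<close>

definition merge_or_skip_body :: "nat \<Rightarrow> expr" where
  "merge_or_skip_body K =
   EIf (EIf ((ECdr ^^ K) (Call 8 [ECdr (ECdr (Arg 2)), Arg 0, ENil, Arg 3])) ETrue
            ((ECdr ^^ K) (Call 8 [Arg 1, Arg 0, ENil, Arg 3])))
     (Call 11 [ECons (ECar (Arg 2)) (Arg 1), ECdr (Arg 2), Arg 3])
     (Call 10 [Arg 1,
        ECons (ECons (Arg 0) (Call 9 [ECdr (ECar (Arg 2)), ECdr (ECar (ECdr (Arg 2)))])) (ECdr (ECdr (Arg 2)))])"

definition differ_at_body :: expr where
  "differ_at_body =
   EIf (Call 2 [Arg 0, Arg 1, Arg 3]) (EIf (Call 2 [Arg 0, Arg 2, Arg 3]) ENil ETrue) (Call 2 [Arg 0, Arg 2, Arg 3])"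

definition differ_on_body :: expr where
  "differ_on_body =
   any_loop 14 13 [Arg 1, Arg 2, Arg 3]"

definition differ_body :: expr where
  "differ_body =
   EIf (Arg 0)
     (EIf (Call 7 [Arg 1, ECar (ECar (Arg 0)), Arg 2, Arg 5])
       (Call 15 [ECdr (Arg 0), Arg 1, ECons (ECar (ECar (Arg 0))) (Arg 2), Arg 3, Arg 4, Arg 5])
       (EIf (Call 14 [ECar (ECar (Arg 0)), Arg 3, Arg 4, Arg 5]) ETrue
         (Call 15 [ECdr (Arg 0), Arg 1, ECons (ECar (ECar (Arg 0))) (Arg 2), Arg 3, Arg 4, Arg 5])))
     ENil"

definition not_eqv_body :: expr where
  "not_eqv_body =
   EIf (Call 15 [Arg 4, Arg 2, ENil, Arg 0, Arg 1, Arg 5]) ETrue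
     (Call 15 [Arg 3, Arg 2, ENil, Arg 0, Arg 1, Arg 5])"

text \<open>The vertex found is returned in a singleton list: vertex 0 itself is encoded as
  \<open>SNil\<close> and could not be told from failure.\<close>

definition find_eqv_body :: expr where
  "find_eqv_body =
   EIf (Arg 0)
     (EIf (Call 16 [ECar (Arg 0), Arg 1, Arg 2, Arg 3, Arg 4, Arg 5])
       (Call 17 [ECdr (Arg 0), Arg 1, Arg 2, Arg 3, Arg 4, Arg 5])
       (ECons (ECar (Arg 0)) ENil))
     ENil"

text \<open>The search is run once as a test and once more for its result, which explains the factor
  2 in front of \<open>cost_find\<close>.\<close>

definition part_outs_body :: expr where
  "part_outs_body =
   EIf (Arg 0)
     (EIf (Call 17 [Arg 1, ECar (Arg 0), Arg 2, Arg 3, Arg 4, Arg 5])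
       (ECons (ECons (ECar (Call 17 [Arg 1, ECar (Arg 0), Arg 2, Arg 3, Arg 4, Arg 5])) (ECar (Arg 0)))
         (Call 18 [ECdr (Arg 0), Arg 1, Arg 2, Arg 3, Arg 4, Arg 5]))
       (Call 18 [ECdr (Arg 0), ECons (ECar (Arg 0)) (Arg 1), Arg 2, Arg 3, Arg 4, Arg 5]))
     ENil"

definition part_reps_body :: expr where
  "part_reps_body =
   EIf (Arg 0)
     (EIf (Call 17 [Arg 1, ECar (Arg 0), Arg 2, Arg 3, Arg 4, Arg 5])
       (Call 19 [ECdr (Arg 0), Arg 1, Arg 2, Arg 3, Arg 4, Arg 5])
       (Call 19 [ECdr (Arg 0), ECons (ECar (Arg 0)) (Arg 1), Arg 2, Arg 3, Arg 4, Arg 5]))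
     (Arg 1)"

definition outs_body :: expr where
  "outs_body =
   EIf (Arg 1)
     (Call 9 [Call 18 [ECdr (ECar (Arg 1)), ENil, ECar (ECar (Arg 1)), Arg 0, ECdr (Arg 1), Arg 2],
              Call 20 [ECons (ECar (Arg 1)) (Arg 0), ECdr (Arg 1), Arg 2]])
     ENil"

definition reps_body :: expr where
  "reps_body =
   EIf (Arg 1)
     (ECons (ECons (ECar (ECar (Arg 1)))
              (Call 19 [ECdr (ECar (Arg 1)), ENil, ECar (ECar (Arg 1)), Arg 0, ECdr (Arg 1), Arg 2]))
            (Call 21 [ECons (ECar (Arg 1)) (Arg 0), ECdr (Arg 1), Arg 2]))
     ENil"

definition contractions_body :: expr where
  "contractions_body =
   EIf (Arg 0) (EIf (ECdr (Arg 0)) (Call 23 [Call 11 [ENil, Arg 0, Arg 1], Arg 1]) ENil) ENil"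

definition outs_and_continue_body :: expr where
  "outs_and_continue_body =
   Call 9 [Call 20 [ENil, Arg 0, Arg 1], Call 22 [Call 21 [ENil, Arg 0, Arg 1], Arg 1]]"

definition singletons_body :: expr where
  "singletons_body =
   EIf (Arg 0)
     (ECons (ECons (ECons (ECar (Arg 0)) ENil) (ECons (ECar (Arg 0)) ENil)) (Call 24 [ECdr (Arg 0)]))
     ENil"

definition prog :: "nat \<Rightarrow> program" where
  "prog K =
    [main_body,
     nth_body,
     adj_body,
     hasnb_body,
     hasnbs_body,
     first_nb_body,
     start_body,
     dbl_body,
     cnt_body,
     append_body,
     rev_append_body,
     merge_step_body,
     merge_or_skip_body K,
     differ_at_body,
     differ_on_body,
     differ_body,
     not_eqv_body,
     find_eqv_body,
     part_outs_body,
     part_reps_body,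
     outs_body,
     reps_body,
     contractions_body,
     outs_and_continue_body,
     singletons_body]"

section \<open>Symbolic execution of the program\<close>

lemma evc_prog:
  "evc (prog K) 0 xs y c \<longleftrightarrow> ev (prog K) xs main_body y c"
  "evc (prog K) 1 xs y c \<longleftrightarrow> ev (prog K) xs nth_body y c"
  "evc (prog K) 2 xs y c \<longleftrightarrow> ev (prog K) xs adj_body y c"
  "evc (prog K) 3 xs y c \<longleftrightarrow> ev (prog K) xs hasnb_body y c"
  "evc (prog K) 4 xs y c \<longleftrightarrow> ev (prog K) xs hasnbs_body y c"
  "evc (prog K) 5 xs y c \<longleftrightarrow> ev (prog K) xs first_nb_body y c"
  "evc (prog K) 6 xs y c \<longleftrightarrow> ev (prog K) xs start_body y c"
  "evc (prog K) 7 xs y c \<longleftrightarrow> ev (prog K) xs dbl_body y c"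
  "evc (prog K) 8 xs y c \<longleftrightarrow> ev (prog K) xs cnt_body y c"
  "evc (prog K) 9 xs y c \<longleftrightarrow> ev (prog K) xs append_body y c"
  "evc (prog K) 10 xs y c \<longleftrightarrow> ev (prog K) xs rev_append_body y c"
  "evc (prog K) 11 xs y c \<longleftrightarrow> ev (prog K) xs merge_step_body y c"
  "evc (prog K) 12 xs y c \<longleftrightarrow> ev (prog K) xs (merge_or_skip_body K) y c"
  "evc (prog K) 13 xs y c \<longleftrightarrow> ev (prog K) xs differ_at_body y c"
  "evc (prog K) 14 xs y c \<longleftrightarrow> ev (prog K) xs differ_on_body y c"
  "evc (prog K) 15 xs y c \<longleftrightarrow> ev (prog K) xs differ_body y c"
  "evc (prog K) 16 xs y c \<longleftrightarrow> ev (prog K) xs not_eqv_body y c"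
  "evc (prog K) 17 xs y c \<longleftrightarrow> ev (prog K) xs find_eqv_body y c"
  "evc (prog K) 18 xs y c \<longleftrightarrow> ev (prog K) xs part_outs_body y c"
  "evc (prog K) 19 xs y c \<longleftrightarrow> ev (prog K) xs part_reps_body y c"
  "evc (prog K) 20 xs y c \<longleftrightarrow> ev (prog K) xs outs_body y c"
  "evc (prog K) 21 xs y c \<longleftrightarrow> ev (prog K) xs reps_body y c"
  "evc (prog K) 22 xs y c \<longleftrightarrow> ev (prog K) xs contractions_body y c"
  "evc (prog K) 23 xs y c \<longleftrightarrow> ev (prog K) xs outs_and_continue_body y c"
  "evc (prog K) 24 xs y c \<longleftrightarrow> ev (prog K) xs singletons_body y c"
  by (simp_all add: evc_def prog_def)

lemma any_loop:
  assumes "f < length P" "P ! f = any_loop f g es"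
    and es: "\<And>a. evl P (a # xs) es xs k"
    and g: "\<And>x. x \<in> set l \<Longrightarrow> evc P g (enc x # xs) (enc_bool (p x)) c"
  shows "evc P f (enc_list enc l # xs) (enc_bool (\<exists>x\<in>set l. p x)) ((c + 2 * k + 10) * Suc (length l))"
  using g
proof (induction l)
  case Nil
  \<comment> \<open>The pattern of all evaluation proofs: \<open>ev_weaken\<close> leaves value and
    cost schematic, the rules execute the body and accumulate the cost, \<open>ev_ifs\<close>
    selects a branch once \<open>simp\<close> decides its test, and the final
    \<open>simp_all\<close> compares value and cost with the claim.\<close>
  have "ev P (SNil # xs) (P ! f) SNil 10"
    unfolding assms(2) any_loop_def by - (rule ev_weaken, (rule ev_rules | (rule ev_ifs, (simp; fail)))+, simp_all)
  then show ?case using assms(1) by (auto simp: evc_def enc_bool_def intro: ev_weaken)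
next
  case (Cons x l)
  then have g: "evc P g (enc x # xs) (enc_bool (p x)) c"
    and IH: "evc P f (enc_list enc l # xs) (enc_bool (\<exists>x\<in>set l. p x)) ((c + 2 * k + 10) * Suc (length l))"
    by simp_all
  have "ev P (enc_list enc (x # l) # xs) (P ! f) (enc_bool (\<exists>x\<in>set (x # l). p x)) ((c + 2 * k + 10) * Suc (length (x # l)))"
  proof (cases "p x")
    case True
    then show ?thesis unfolding assms(2) any_loop_def enc_list.simps
      by - (rule ev_weaken, (rule ev_rules es g | (rule ev_ifs, (simp add: enc_bool_def; fail)))+, simp_all add: enc_bool_def)
  next
    case False
    then show ?thesis unfolding assms(2) any_loop_def enc_list.simps
      by - (rule ev_weaken, (rule ev_rules es g IH | (rule ev_ifs, (simp add: enc_bool_def; fail)))+, simp_all add: enc_bool_def)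
  qed
  then show ?case using assms(1) by (simp add: evc_def)
qed

abbreviation "enc_vs \<equiv> enc_list enc_nat"
abbreviation "enc_parts \<equiv> enc_list (enc_pair enc_vs enc_vs)"

lemma evc_nth:
  assumes "i < length l"
  shows "evc (prog K) 1 [enc_nat i, enc_list f l] (f (l ! i)) (10 * Suc i)"
  using assms
proof (induction i arbitrary: l)
  case 0
  then obtain x l' where l: "l = x # l'" by (cases l) auto
  show ?case unfolding l enc_list.simps enc_nat.simps
    evc_prog nth_body_def by - (rule ev_weaken, (rule ev_rules | (rule ev_ifs, (simp; fail)))+, simp_all)
next
  case (Suc i)
  then obtain x l' where l: "l = x # l'" "i < length l'" by (cases l) auto
  note IH = Suc.IH[OF l(2)]
  show ?case unfolding l(1) enc_list.simps enc_nat.simps evc_prog nth_body_def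
    by - (rule ev_weaken, (rule ev_rules IH | (rule ev_ifs, (simp; fail)))+, simp_all)
qed

lemma evc_append: "evc (prog K) 9 [enc_list f xs, enc_list f ys] (enc_list f (xs @ ys)) (20 * Suc (length xs))"
proof (induction xs)
  case Nil
  show ?case unfolding enc_list.simps evc_prog append_body_def by - (rule ev_weaken, (rule ev_rules | (rule ev_ifs, (simp; fail)))+, simp_all)
next
  case (Cons x xs)
  show ?case unfolding enc_list.simps evc_prog append_body_def by - (rule ev_weaken, (rule ev_rules Cons | (rule ev_ifs, (simp; fail)))+, simp_all)
qed

lemma evc_rev_append: "evc (prog K) 10 [enc_list f xs, enc_list f ys] (enc_list f (rev xs @ ys)) (20 * Suc (length xs))"
proof (induction xs arbitrary: ys)
  case Nil
  show ?case unfolding enc_list.simps evc_prog rev_append_body_def by - (rule ev_weaken, (rule ev_rules | (rule ev_ifs, (simp; fail)))+, simp_all)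
next
  case (Cons x xs)
  note IH = Cons[of "x # ys", unfolded enc_list.simps]
  show ?case unfolding enc_list.simps evc_prog rev_append_body_def by - (rule ev_weaken, (rule ev_rules IH | (rule ev_ifs, (simp; fail)))+, simp_all)
qed

lemma enc_pair_simp: "enc_pair f g (x, y) = SCons (f x) (g y)"
  by (simp add: enc_pair_def)

lemma enc_parts_Cons: "enc_parts (p # P) = SCons (SCons (enc_vs (fst p)) (enc_vs (snd p))) (enc_parts P)"
  by (simp add: enc_pair_def)

lemma evc_singletons: "evc (prog K) 24 [enc_vs vs] (enc_parts (map (\<lambda>v. ([v], [v])) vs)) (30 * Suc (length vs))"
proof (induction vs)
  case Nil
  show ?case unfolding enc_list.simps evc_prog singletons_body_def by - (rule ev_weaken, (rule ev_rules | (rule ev_ifs, (simp; fail)))+, simp_all)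
next
  case (Cons x xs)
  show ?case unfolding enc_list.simps evc_prog singletons_body_def by - (rule ev_weaken, (rule ev_rules Cons | (rule ev_ifs, (simp add: enc_pair_simp; fail)))+, simp_all add: enc_pair_simp)
qed

section \<open>Size and cost bounds for the intermediate lists\<close>

definition small :: "nat \<Rightarrow> nat list \<Rightarrow> bool" where
  "small n I \<longleftrightarrow> length I \<le> n \<and> set I \<subseteq> {..<n}"

text \<open>The total lengths are bounded rather than those of the single intervals, because totals
  are what a merge preserves.\<close>

definition well_sized :: "nat \<Rightarrow> nat part list \<Rightarrow> bool" where
  "well_sized n P \<longleftrightarrow> length P \<le> n \<and> length (concat (map fst P)) \<le> n \<and> length (concat (map snd P)) \<le> n \<and>
     (\<forall>p\<in>set P. set (fst p) \<union> set (snd p) \<subseteq> {..<n})"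

lemma length_le_concat: "I \<in> set P \<Longrightarrow> length I \<le> length (concat P)"
  by (induction P) auto

lemma well_sized_small: "well_sized n P \<Longrightarrow> p \<in> set P \<Longrightarrow> small n (fst p) \<and> small n (snd p)"
  using length_le_concat[of "fst p" "map fst P"] length_le_concat[of "snd p" "map snd P"]
  unfolding well_sized_def small_def by force

lemma well_sized_merge:
  "well_sized n (L @ p # q # R) \<Longrightarrow> well_sized n (L @ (fst p @ fst q, snd p @ snd q) # R)"
  unfolding well_sized_def by auto

lemma length_part_reps: "length (part_reps r acc A) \<le> length acc + length A"
proof (induction A arbitrary: acc)
  case (Cons c A)
  show ?case using Cons[of "c # acc"] Cons[of acc] by (auto split: list.split)
qed simp

lemma set_part_reps: "set (part_reps r acc A) \<subseteq> set acc \<union> set A"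
proof (induction A arbitrary: acc)
  case (Cons c A)
  show ?case using Cons[of "c # acc"] Cons[of acc] by (auto split: list.split)
qed simp

lemma length_part_outs: "length (part_outs r acc A) \<le> length A"
proof (induction A arbitrary: acc)
  case (Cons c A)
  show ?case using Cons[of "c # acc"] Cons[of acc] by (auto split: list.split)
qed simp

lemma length_outs: "length (outs E L R) \<le> length (concat (map snd R))"
proof (induction R arbitrary: L)
  case (Cons p R)
  show ?case using Cons[of "p # L"] length_part_outs[of "eqv E (map fst L) (fst p) (map fst R)" "[]" "snd p"] by simp
qed simp

lemma reps_bounds: "length (concat (map snd (reps E L R))) \<le> length (concat (map snd R)) \<and>
    (\<forall>p\<in>set (reps E L R). \<exists>q\<in>set R. fst p = fst q \<and> set (snd p) \<subseteq> set (snd q))"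
proof (induction R arbitrary: L)
  case (Cons p R)
  let ?r = "eqv E (map fst L) (fst p) (map fst R)"
  show ?case using Cons[of "p # L"] length_part_reps[of ?r "[]" "snd p"] set_part_reps[of ?r "[]" "snd p"] by auto
qed simp

lemma well_sized_reps: "well_sized n P \<Longrightarrow> well_sized n (reps E L P)"
  using reps_bounds[of E L P] unfolding well_sized_def map_fst_reps by fastforce

lemma well_sized_merge_step: "well_sized n (rev L @ R) \<Longrightarrow> well_sized n (merge_step E K L R)"
proof (cases "merge_step E K L R = []")
  case False
  then obtain L' p q R' where "rev L @ R = rev L' @ p # q # R'"
    "merge_step E K L R = rev L' @ (fst p @ fst q, snd p @ snd q) # R'"
    using merge_step_spec by blast
  then show "well_sized n (rev L @ R) \<Longrightarrow> well_sized n (merge_step E K L R)"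
    using well_sized_merge[of n "rev L'" p q R'] by simp
qed (simp add: well_sized_def)

text \<open>The cost functions follow the nesting of the loops in the program, with each list length
  rounded up to \<open>n\<close>; sharpness is not intended.\<close>

definition cost_start :: "nat \<Rightarrow> nat" where
  "cost_start n = (((30 * Suc n + 14) * Suc n + ((30 * Suc n + 14) * Suc n + 14) * Suc n + 40) + 16) * Suc n"

definition cost_cnt :: "nat \<Rightarrow> nat" where
  "cost_cnt n = (cost_start n + 50) * Suc n"

definition cost_eqv :: "nat \<Rightarrow> nat" where
  "cost_eqv n = 2 * (2 * cost_start n + (60 * Suc n + 56) * Suc n + 90) * Suc n + 40"

definition cost_find :: "nat \<Rightarrow> nat" where
  "cost_find n = (cost_eqv n + 40) * Suc n"

definition cost_stage :: "nat \<Rightarrow> nat \<Rightarrow> nat" where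
  "cost_stage K n = (2 * cost_cnt n + 80 * Suc n + 2 * K + 100) * Suc n +
     2 * ((2 * cost_find n + 80) * Suc n + 20 * Suc n + 60) * Suc n + 20 * Suc n + 100"

text \<open>The matrix is accessed only through the adjacency test, so nothing else needs to be
  known about its encoding \<open>M\<close>.\<close>

locale program_graph =
  fixes K n :: nat and E :: "nat \<Rightarrow> nat \<Rightarrow> bool" and M :: sexp
  assumes adj: "c < n \<Longrightarrow> v < n \<Longrightarrow>
    evc (prog K) 2 [enc_nat v, enc_nat c, M] (enc_bool (E c v)) (30 * Suc n)"
begin

lemma evc_any_loop:
  assumes "f < 25" "prog K ! f = any_loop f g es" "\<And>a. evl (prog K) (a # xs) es xs k" "length l \<le> n"
    and "\<And>x. x \<in> set l \<Longrightarrow> evc (prog K) g (enc x # xs) (enc_bool (p x)) c"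
  shows "evc (prog K) f (enc_list enc l # xs) (enc_bool (\<exists>x\<in>set l. p x)) ((c + 2 * k + 10) * Suc n)"
proof (rule evc_weaken)
  show "evc (prog K) f (enc_list enc l # xs) (enc_bool (\<exists>x\<in>set l. p x)) ((c + 2 * k + 10) * Suc (length l))"
    using assms by (intro any_loop) (simp_all add: prog_def)
qed (use assms(4) in \<open>simp add: mult_le_mono\<close>)

lemma evl_Args: "evl P [a, x, y] [Arg 1, Arg 2] [x, y] 2"
  "evl P [a, x, y, z] [Arg 1, Arg 2, Arg 3] [x, y, z] 3"
proof -
  have "evl P [a, x, y] [Arg 1, Arg 2] [x, y] (1 + (1 + 0))" by (rule ev_rules)+
  then show "evl P [a, x, y] [Arg 1, Arg 2] [x, y] 2" by (simp add: numeral_2_eq_2)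
  have "evl P [a, x, y, z] [Arg 1, Arg 2, Arg 3] [x, y, z] (1 + (1 + (1 + 0)))" by (rule ev_rules)+
  then show "evl P [a, x, y, z] [Arg 1, Arg 2, Arg 3] [x, y, z] 3" by (simp add: numeral_3_eq_3)
qed

lemma evc_hasnb:
  assumes "c < n" "small n J"
  shows "evc (prog K) 3 [enc_vs J, enc_nat c, M] (enc_bool (hasnb E c J)) ((30 * Suc n + 14) * Suc n)"
  unfolding hasnb_def
  by (rule evc_weaken[OF evc_any_loop[OF _ _ evl_Args(1)]])
    (use assms adj in \<open>auto simp: prog_def hasnb_body_def small_def\<close>)

lemma evc_hasnbs:
  assumes "c < n" "length B \<le> n" "\<forall>J\<in>set B. small n J"
  shows "evc (prog K) 4 [enc_list enc_vs B, enc_nat c, M] (enc_bool (hasnbs E c B))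
    (((30 * Suc n + 14) * Suc n + 14) * Suc n)"
  unfolding hasnbs_def
  by (rule evc_weaken[OF evc_any_loop[OF _ _ evl_Args(1)]])
    (use assms evc_hasnb in \<open>auto simp: prog_def hasnbs_body_def\<close>)

lemma evc_first_nb:
  assumes "c < n" "small n J" "length B \<le> n" "\<forall>J\<in>set B. small n J"
  shows "evc (prog K) 5 [enc_nat c, enc_vs J, enc_list enc_vs B, M] (enc_bool (hasnb E c J \<and> \<not> hasnbs E c B))
    ((30 * Suc n + 14) * Suc n + ((30 * Suc n + 14) * Suc n + 14) * Suc n + 40)"
proof -
  note calls = evc_hasnb[OF assms(1,2)] evc_hasnbs[OF assms(1,3,4)]
  consider "hasnb E c J" "hasnbs E c B" | "hasnb E c J" "\<not> hasnbs E c B" | "\<not> hasnb E c J" by blast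
  then show ?thesis
    unfolding evc_prog first_nb_body_def
    by cases ((rule ev_weaken, (rule ev_rules calls | (rule ev_ifs, (simp add: enc_bool_def; fail)))+, simp_all add: enc_bool_def)[1])+
qed

lemma evc_start:
  assumes "small n I" "small n J" "length B \<le> n" "\<forall>J\<in>set B. small n J"
  shows "evc (prog K) 6 [enc_vs I, enc_vs J, enc_list enc_vs B, M] (enc_bool (start E I B J)) (cost_start n)"
  unfolding start_def cost_start_def
  by (rule evc_weaken[OF evc_any_loop[OF _ _ evl_Args(2) _ evc_first_nb]])
    (use assms in \<open>auto simp: prog_def start_body_def small_def\<close>)

lemma evc_dbl:
  assumes "small n I" "small n J" "length B \<le> n" "\<forall>J\<in>set B. small n J"
  shows "evc (prog K) 7 [enc_vs I, enc_vs J, enc_list enc_vs B, M] (enc_bool (dbl E I B J)) (2 * cost_start n + 20)"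
proof -
  note calls = evc_start[OF assms] evc_start[OF assms(2,1,3,4)]
  show ?thesis
    unfolding evc_prog dbl_body_def
    by (cases "start E I B J") ((rule ev_weaken, (rule ev_rules calls | (rule ev_ifs, (simp add: dbl_def enc_bool_def; fail)))+, simp_all add: dbl_def enc_bool_def)[1])+
qed

lemma evc_cnt:
  assumes "small n I" "length B + length R \<le> n" "\<forall>J\<in>set B. small n J" "\<forall>p\<in>set R. small n (fst p)"
  shows "evc (prog K) 8 [enc_parts R, enc_vs I, enc_list enc_vs B, M] (enc_nat (cnt E I B (map fst R)))
    ((cost_start n + 50) * Suc (length R))"
  using assms(2-)
proof (induction R arbitrary: B)
  case Nil
  show ?case unfolding enc_list.simps evc_prog cnt_body_def by - (rule ev_weaken, (rule ev_rules | (rule ev_ifs, (simp; fail)))+, simp_all)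
next
  case (Cons p R)
  have IH: "evc (prog K) 8 [enc_parts R, enc_vs I, SCons (enc_vs (fst p)) (enc_list enc_vs B), M]
      (enc_nat (cnt E I (fst p # B) (map fst R))) ((cost_start n + 50) * Suc (length R))"
    using Cons.IH[of "fst p # B"] Cons.prems by simp
  have st: "evc (prog K) 6 [enc_vs I, enc_vs (fst p), enc_list enc_vs B, M] (enc_bool (start E I B (fst p))) (cost_start n)"
    using assms(1) Cons.prems by (intro evc_start) auto
  show ?case
    unfolding enc_parts_Cons evc_prog cnt_body_def
    by (cases "start E I B (fst p)") ((rule ev_weaken, (rule ev_rules st IH | (rule ev_ifs, (simp; fail)))+, simp_all)[1])+
qed

lemma evc_cnt_Nil:
  assumes "small n I" "length R \<le> n" "\<forall>p\<in>set R. small n (fst p)"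
  shows "evc (prog K) 8 [enc_parts R, enc_vs I, SNil, M] (enc_nat (cnt E I [] (map fst R))) (cost_cnt n)"
proof (rule evc_weaken)
  show "evc (prog K) 8 [enc_parts R, enc_vs I, SNil, M] (enc_nat (cnt E I [] (map fst R)))
      ((cost_start n + 50) * Suc (length R))"
    using evc_cnt[of I "[]" R] assms by simp
qed (use assms(2) in \<open>simp add: cost_cnt_def del: mult_Suc_right\<close>)

lemma evc_differ_at:
  assumes "y < n" "c < n" "c' < n"
  shows "evc (prog K) 13 [enc_nat y, enc_nat c, enc_nat c', M] (enc_bool (E c y \<noteq> E c' y)) (60 * Suc n + 40)"
proof -
  note calls = adj[OF assms(2,1)] adj[OF assms(3,1)]
  consider "E c y" "E c' y" | "E c y" "\<not> E c' y" | "\<not> E c y" by blast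
  then show ?thesis
    unfolding evc_prog differ_at_body_def
    by cases ((rule ev_weaken, (rule ev_rules calls | (rule ev_ifs, (simp add: enc_bool_def; fail)))+, simp_all add: enc_bool_def)[1])+
qed

lemma evc_differ_on:
  assumes "small n J" "c < n" "c' < n"
  shows "evc (prog K) 14 [enc_vs J, enc_nat c, enc_nat c', M] (enc_bool (\<exists>y\<in>set J. E c y \<noteq> E c' y)) ((60 * Suc n + 56) * Suc n)"
  by (rule evc_weaken[OF evc_any_loop[OF _ _ evl_Args(2) _ evc_differ_at]])
    (use assms in \<open>auto simp: prog_def differ_on_body_def small_def\<close>)

lemma evc_differ:
  assumes "small n I" "c < n" "c' < n"
    and "length B + length R \<le> n" "\<forall>J\<in>set B. small n J" "\<forall>p\<in>set R. small n (fst p)"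
  shows "evc (prog K) 15 [enc_parts R, enc_vs I, enc_list enc_vs B, enc_nat c, enc_nat c', M]
    (enc_bool (\<exists>y\<in>req E I B (map fst R). E c y \<noteq> E c' y))
    ((2 * cost_start n + (60 * Suc n + 56) * Suc n + 90) * Suc (length R))"
  using assms(4-)
proof (induction R arbitrary: B)
  case Nil
  show ?case unfolding enc_list.simps evc_prog differ_body_def by - (rule ev_weaken, (rule ev_rules | (rule ev_ifs, (simp add: enc_bool_def; fail)))+, simp_all add: enc_bool_def)
next
  case (Cons p R)
  have IH: "evc (prog K) 15 [enc_parts R, enc_vs I, SCons (enc_vs (fst p)) (enc_list enc_vs B), enc_nat c, enc_nat c', M]
      (enc_bool (\<exists>y\<in>req E I (fst p # B) (map fst R). E c y \<noteq> E c' y))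
      ((2 * cost_start n + (60 * Suc n + 56) * Suc n + 90) * Suc (length R))"
    using Cons.IH[of "fst p # B"] Cons.prems by simp
  have db: "evc (prog K) 7 [enc_vs I, enc_vs (fst p), enc_list enc_vs B, M] (enc_bool (dbl E I B (fst p))) (2 * cost_start n + 20)"
    using assms(1) Cons.prems by (intro evc_dbl) auto
  define D where "D \<longleftrightarrow> (\<exists>y\<in>set (fst p). E c y \<noteq> E c' y)"
  have di: "evc (prog K) 14 [enc_vs (fst p), enc_nat c, enc_nat c', M] (enc_bool D) ((60 * Suc n + 56) * Suc n)"
    unfolding D_def using assms(2,3) Cons.prems(3) by (intro evc_differ_on) auto
  consider "dbl E I B (fst p)" | "\<not> dbl E I B (fst p)" D | "\<not> dbl E I B (fst p)" "\<not> D" by blast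
  then show ?case
  proof cases
    case 1
    then show ?thesis unfolding enc_parts_Cons evc_prog differ_body_def by - (rule ev_weaken, (rule ev_rules db di IH | (rule ev_ifs, (simp; fail)))+, simp_all)
  next
    case 2
    then have eq: "enc_bool (\<exists>y\<in>req E I B (map fst (p # R)). E c y \<noteq> E c' y) = SCons SNil SNil"
      by (auto simp: enc_bool_def D_def)
    show ?thesis unfolding eq unfolding enc_parts_Cons evc_prog differ_body_def by - (rule ev_weaken, (rule ev_rules db di IH | (rule ev_ifs, (simp add: 2; fail)))+, simp_all add: 2)
  next
    case 3
    then have eq: "(\<exists>y\<in>req E I B (map fst (p # R)). E c y \<noteq> E c' y) = (\<exists>y\<in>req E I (fst p # B) (map fst R). E c y \<noteq> E c' y)"
      by (auto simp: D_def)
    show ?thesis unfolding eq unfolding enc_parts_Cons evc_prog differ_body_def by - (rule ev_weaken, (rule ev_rules db di IH | (rule ev_ifs, (simp add: 3; fail)))+, simp_all add: 3)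
  qed
qed

definition small_parts :: "nat part list \<Rightarrow> bool" where
  "small_parts P \<longleftrightarrow> length P \<le> n \<and> (\<forall>p\<in>set P. small n (fst p))"

lemma evc_not_eqv:
  assumes "small n I" "c < n" "c' < n" "small_parts L" "small_parts R"
  shows "evc (prog K) 16 [enc_nat c, enc_nat c', enc_vs I, enc_parts L, enc_parts R, M]
    (enc_bool (\<not> eqv E (map fst L) I (map fst R) c c')) (cost_eqv n)"
proof -
  let ?c = "2 * cost_start n + (60 * Suc n + 56) * Suc n + 90"
  define D where "D P \<longleftrightarrow> (\<exists>y\<in>req E I [] (map fst P). E c y \<noteq> E c' y)" for P :: "nat part list"
  have differ: "evc (prog K) 15 [enc_parts P, enc_vs I, SNil, enc_nat c, enc_nat c', M]
      (enc_bool (D P)) (?c * Suc n)" if "small_parts P" for P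
  proof (rule evc_weaken)
    show "evc (prog K) 15 [enc_parts P, enc_vs I, SNil, enc_nat c, enc_nat c', M]
      (enc_bool (D P)) (?c * Suc (length P))"
      using evc_differ[OF assms(1-3), of "[]" P] that by (simp add: small_parts_def D_def)
    show "?c * Suc (length P) \<le> ?c * Suc n" using that by (intro mult_le_mono2) (simp add: small_parts_def)
  qed
  have cost: "cost_eqv n = ?c * Suc n + ?c * Suc n + 40" by (simp only: cost_eqv_def mult_2 add_mult_distrib)
  note calls = differ[OF assms(5)] differ[OF assms(4)]
  show ?thesis
  proof (cases "D R")
    case True
    then have eq: "enc_bool (\<not> eqv E (map fst L) I (map fst R) c c') = SCons SNil SNil"
      by (auto simp: eqv_def enc_bool_def D_def)
    show ?thesis unfolding eq cost evc_prog not_eqv_body_def by - (rule ev_weaken, (rule ev_rules calls | (rule ev_ifs, (simp add: True; fail)))+, simp_all add: True)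
  next
    case False
    then have eq: "(\<not> eqv E (map fst L) I (map fst R) c c') = D L"
      by (auto simp: eqv_def D_def)
    show ?thesis unfolding eq cost evc_prog not_eqv_body_def by - (rule ev_weaken, (rule ev_rules calls | (rule ev_ifs, (simp add: False; fail)))+, simp_all add: False)
  qed
qed

lemma evc_find_eqv:
  assumes "small n I" "c < n" "small_parts L" "small_parts R" "set xs \<subseteq> {..<n}"
  shows "evc (prog K) 17 [enc_vs xs, enc_nat c, enc_vs I, enc_parts L, enc_parts R, M]
    (enc_vs (take 1 (filter (\<lambda>u. eqv E (map fst L) I (map fst R) u c) xs))) ((cost_eqv n + 40) * Suc (length xs))"
  using assms(5)
proof (induction xs)
  case Nil
  show ?case unfolding enc_list.simps evc_prog find_eqv_body_def by - (rule ev_weaken, (rule ev_rules | (rule ev_ifs, (simp; fail)))+, simp_all)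
next
  case (Cons u xs)
  then have IH: "evc (prog K) 17 [enc_vs xs, enc_nat c, enc_vs I, enc_parts L, enc_parts R, M]
    (enc_vs (take 1 (filter (\<lambda>u. eqv E (map fst L) I (map fst R) u c) xs))) ((cost_eqv n + 40) * Suc (length xs))" by simp
  have ne: "evc (prog K) 16 [enc_nat u, enc_nat c, enc_vs I, enc_parts L, enc_parts R, M]
    (enc_bool (\<not> eqv E (map fst L) I (map fst R) u c)) (cost_eqv n)"
    using Cons.prems assms by (intro evc_not_eqv) simp_all
  show ?case
    unfolding enc_list.simps evc_prog find_eqv_body_def
    by (cases "eqv E (map fst L) I (map fst R) u c") ((rule ev_weaken, (rule ev_rules ne IH | (rule ev_ifs, (simp; fail)))+, simp_all)[1])+
qed

lemma evc_find_eqv':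
  assumes "small n I" "c < n" "small_parts L" "small_parts R" "small n xs"
  shows "evc (prog K) 17 [enc_vs xs, enc_nat c, enc_vs I, enc_parts L, enc_parts R, M]
    (enc_vs (take 1 (filter (\<lambda>u. eqv E (map fst L) I (map fst R) u c) xs))) (cost_find n)"
proof (rule evc_weaken[OF evc_find_eqv[OF assms(1-4)]])
  show "(cost_eqv n + 40) * Suc (length xs) \<le> cost_find n"
    using assms(5) unfolding cost_find_def small_def by (intro mult_le_mono2) simp
qed (use assms(5) in \<open>simp add: small_def\<close>)

lemma evc_part_outs:
  assumes "small n I" "small_parts L" "small_parts R" "length acc + length A \<le> n" "set acc \<union> set A \<subseteq> {..<n}"
  shows "evc (prog K) 18 [enc_vs A, enc_vs acc, enc_vs I, enc_parts L, enc_parts R, M]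
    (enc_contractions (part_outs (eqv E (map fst L) I (map fst R)) acc A)) ((2 * cost_find n + 80) * Suc (length A))"
  using assms(4,5)
proof (induction A arbitrary: acc)
  case Nil
  show ?case unfolding enc_list.simps evc_prog part_outs_body_def by - (rule ev_weaken, (rule ev_rules | (rule ev_ifs, (simp add: enc_contractions_def; fail)))+, simp_all add: enc_contractions_def)
next
  case (Cons c A)
  let ?r = "eqv E (map fst L) I (map fst R)"
  have find: "evc (prog K) 17 [enc_vs acc, enc_nat c, enc_vs I, enc_parts L, enc_parts R, M]
      (enc_vs (take 1 (filter (\<lambda>u. ?r u c) acc))) (cost_find n)"
    using Cons.prems assms(1-3) by (intro evc_find_eqv') (simp_all add: small_def)
  show ?case
  proof (cases "filter (\<lambda>u. ?r u c) acc")
    case Nil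
    have IH: "evc (prog K) 18 [enc_vs A, SCons (enc_nat c) (enc_vs acc), enc_vs I, enc_parts L, enc_parts R, M]
        (enc_contractions (part_outs ?r (c # acc) A)) ((2 * cost_find n + 80) * Suc (length A))"
      using Cons.IH[of "c # acc"] Cons.prems by simp
    note find' = find[unfolded Nil, simplified]
    show ?thesis unfolding enc_list.simps evc_prog part_outs_body_def by - (rule ev_weaken, (rule ev_rules find' IH | (rule ev_ifs, (simp add: Nil; fail)))+, simp_all add: Nil)
  next
    case (Cons u us)
    have IH: "evc (prog K) 18 [enc_vs A, enc_vs acc, enc_vs I, enc_parts L, enc_parts R, M]
        (enc_contractions (part_outs ?r acc A)) ((2 * cost_find n + 80) * Suc (length A))"
      using Cons.IH[of acc] Cons.prems by simp
    note find' = find[unfolded Cons, simplified]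
    show ?thesis unfolding enc_list.simps evc_prog part_outs_body_def
      by - (rule ev_weaken, (rule ev_rules find' IH | (rule ev_ifs, (simp add: Cons enc_contractions_def enc_pair_simp; fail)))+, simp_all add: Cons enc_contractions_def enc_pair_simp)
  qed
qed

lemma evc_part_reps:
  assumes "small n I" "small_parts L" "small_parts R" "length acc + length A \<le> n" "set acc \<union> set A \<subseteq> {..<n}"
  shows "evc (prog K) 19 [enc_vs A, enc_vs acc, enc_vs I, enc_parts L, enc_parts R, M]
    (enc_vs (part_reps (eqv E (map fst L) I (map fst R)) acc A)) ((2 * cost_find n + 80) * Suc (length A))"
  using assms(4,5)
proof (induction A arbitrary: acc)
  case Nil
  show ?case unfolding enc_list.simps evc_prog part_reps_body_def by - (rule ev_weaken, (rule ev_rules | (rule ev_ifs, (simp; fail)))+, simp_all)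
next
  case (Cons c A)
  let ?r = "eqv E (map fst L) I (map fst R)"
  have find: "evc (prog K) 17 [enc_vs acc, enc_nat c, enc_vs I, enc_parts L, enc_parts R, M]
      (enc_vs (take 1 (filter (\<lambda>u. ?r u c) acc))) (cost_find n)"
    using Cons.prems assms(1-3) by (intro evc_find_eqv') (simp_all add: small_def)
  show ?case
  proof (cases "filter (\<lambda>u. ?r u c) acc")
    case Nil
    have IH: "evc (prog K) 19 [enc_vs A, SCons (enc_nat c) (enc_vs acc), enc_vs I, enc_parts L, enc_parts R, M]
        (enc_vs (part_reps ?r (c # acc) A)) ((2 * cost_find n + 80) * Suc (length A))"
      using Cons.IH[of "c # acc"] Cons.prems by simp
    note find' = find[unfolded Nil, simplified]
    show ?thesis unfolding enc_list.simps evc_prog part_reps_body_def by - (rule ev_weaken, (rule ev_rules find' IH | (rule ev_ifs, (simp add: Nil; fail)))+, simp_all add: Nil)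
  next
    case (Cons u us)
    have IH: "evc (prog K) 19 [enc_vs A, enc_vs acc, enc_vs I, enc_parts L, enc_parts R, M]
        (enc_vs (part_reps ?r acc A)) ((2 * cost_find n + 80) * Suc (length A))"
      using Cons.IH[of acc] Cons.prems by simp
    note find' = find[unfolded Cons, simplified]
    show ?thesis unfolding enc_list.simps evc_prog part_reps_body_def by - (rule ev_weaken, (rule ev_rules find' IH | (rule ev_ifs, (simp add: Cons; fail)))+, simp_all add: Cons)
  qed
qed

lemma small_parts_well_sized: "well_sized n (rev L @ p # R) \<Longrightarrow> small_parts L \<and> small_parts R \<and> small n (fst p) \<and> small n (snd p)"
  using well_sized_small[of n "rev L @ p # R"] unfolding small_parts_def well_sized_def by auto

lemma evc_outs:
  assumes "well_sized n (rev L @ R)"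
  shows "evc (prog K) 20 [enc_parts L, enc_parts R, M] (enc_contractions (outs E L R))
    (((2 * cost_find n + 80) * Suc n + 20 * Suc n + 60) * Suc (length R))"
  using assms
proof (induction R arbitrary: L)
  case Nil
  show ?case unfolding enc_list.simps evc_prog outs_body_def by - (rule ev_weaken, (rule ev_rules | (rule ev_ifs, (simp add: enc_contractions_def; fail)))+, simp_all add: enc_contractions_def)
next
  case (Cons p R)
  let ?o = "part_outs (eqv E (map fst L) (fst p) (map fst R)) [] (snd p)"
  note sp = small_parts_well_sized[OF Cons.prems]
  have po: "evc (prog K) 18 [enc_vs (snd p), SNil, enc_vs (fst p), enc_parts L, enc_parts R, M]
      (enc_contractions ?o) ((2 * cost_find n + 80) * Suc n)"
    by (rule evc_weaken[OF evc_part_outs[of "fst p" L R "[]" "snd p", unfolded enc_list.simps]])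
      (use sp in \<open>auto simp: small_def simp del: mult_Suc_right intro!: mult_le_mono2\<close>)
  have "well_sized n (rev (p # L) @ R)" using Cons.prems by simp
  note IH = Cons.IH[OF this, unfolded enc_parts_Cons]
  have "length ?o \<le> length (snd p)" by (rule length_part_outs)
  then have "length ?o \<le> n" using sp by (simp add: small_def)
  then have ap: "evc (prog K) 9 [enc_contractions ?o, enc_contractions (outs E (p # L) R)]
      (enc_contractions (outs E L (p # R))) (20 * Suc n)"
    unfolding enc_contractions_def outs.simps by (intro evc_weaken[OF evc_append]) simp
  show ?case unfolding enc_parts_Cons evc_prog outs_body_def by - (rule ev_weaken, (rule ev_rules po IH ap | (rule ev_ifs, (simp; fail)))+, simp_all)
qed

lemma evc_reps:
  assumes "well_sized n (rev L @ R)"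
  shows "evc (prog K) 21 [enc_parts L, enc_parts R, M] (enc_parts (reps E L R))
    (((2 * cost_find n + 80) * Suc n + 20 * Suc n + 60) * Suc (length R))"
  using assms
proof (induction R arbitrary: L)
  case Nil
  show ?case unfolding enc_list.simps evc_prog reps_body_def by - (rule ev_weaken, (rule ev_rules | (rule ev_ifs, (simp; fail)))+, simp_all)
next
  case (Cons p R)
  let ?A = "part_reps (eqv E (map fst L) (fst p) (map fst R)) [] (snd p)"
  note sp = small_parts_well_sized[OF Cons.prems]
  have po: "evc (prog K) 19 [enc_vs (snd p), SNil, enc_vs (fst p), enc_parts L, enc_parts R, M]
      (enc_vs ?A) ((2 * cost_find n + 80) * Suc n)"
    by (rule evc_weaken[OF evc_part_reps[of "fst p" L R "[]" "snd p", unfolded enc_list.simps]])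
      (use sp in \<open>auto simp: small_def simp del: mult_Suc_right intro!: mult_le_mono2\<close>)
  have "well_sized n (rev (p # L) @ R)" using Cons.prems by simp
  note IH = Cons.IH[OF this, unfolded enc_parts_Cons]
  show ?case unfolding enc_parts_Cons reps.simps evc_prog reps_body_def by - (rule ev_weaken, (rule ev_rules po IH | (rule ev_ifs, (simp; fail)))+, simp_all)
qed

lemma evc_merge_step:
  assumes "well_sized n (rev L @ R)"
  shows "evc (prog K) 11 [enc_parts L, enc_parts R, M] (enc_parts (merge_step E K L R))
    ((2 * cost_cnt n + 80 * Suc n + 2 * K + 100) * Suc (length R))"
  using assms
proof (induction R arbitrary: L)
  case Nil
  show ?case unfolding enc_list.simps evc_prog merge_step_body_def by - (rule ev_weaken, (rule ev_rules | (rule ev_ifs, (simp; fail)))+, simp_all)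
next
  case (Cons p R')
  show ?case
  proof (cases R')
    case Nil
    show ?thesis unfolding Nil enc_list.simps(1) enc_parts_Cons evc_prog merge_step_body_def by - (rule ev_weaken, (rule ev_rules | (rule ev_ifs, (simp; fail)))+, simp_all)
  next
    case R': (Cons q R)
    let ?J = "fst p @ fst q" and ?c = "2 * cost_cnt n + 80 * Suc n + 2 * K + 100"
    have ws: "well_sized n (rev L @ p # q # R)" using Cons.prems R' by simp
    have sp: "small_parts L" "small_parts R" "small n (fst p)" "small n (snd p)" "small n ?J"
      using small_parts_well_sized[OF ws] well_sized_merge[OF ws, THEN small_parts_well_sized]
      by (simp_all add: small_parts_def)
    have app: "evc (prog K) 9 [enc_vs (fst p), enc_vs (fst q)] (enc_vs ?J) (20 * Suc n)"
      "evc (prog K) 9 [enc_vs (snd p), enc_vs (snd q)] (enc_vs (snd p @ snd q)) (20 * Suc n)"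
      using sp(3,4) by (intro evc_weaken[OF evc_append]; simp add: small_def)+
    have cR: "evc (prog K) 8 [enc_parts R, enc_vs ?J, SNil, M] (enc_nat (cnt E ?J [] (map fst R))) (cost_cnt n)"
      and cL: "evc (prog K) 8 [enc_parts L, enc_vs ?J, SNil, M] (enc_nat (cnt E ?J [] (map fst L))) (cost_cnt n)"
      using sp by (intro evc_cnt_Nil; simp add: small_parts_def)+
    have "well_sized n (rev (p # L) @ R')" using Cons.prems by simp
    note IH = Cons.IH[OF this, unfolded R' enc_parts_Cons]
    have ra: "evc (prog K) 10 [enc_parts L, SCons (SCons (enc_vs ?J) (enc_vs (snd p @ snd q))) (enc_parts R)]
        (enc_parts (rev L @ (?J, snd p @ snd q) # R)) (20 * Suc n)"
      using evc_rev_append[of K "enc_pair enc_vs enc_vs" L "(?J, snd p @ snd q) # R"] sp(1)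
      by (auto simp: enc_pair_def small_parts_def intro: evc_weaken)
    let ?env = "[enc_vs ?J, enc_parts L, enc_parts (p # q # R), M]"
    have cut1: "ev (prog K) ?env ((ECdr ^^ K) (Call 8 [ECdr (ECdr (Arg 2)), Arg 0, ENil, Arg 3]))
        (enc_nat (cnt E ?J [] (map fst R) - K)) (K + (cost_cnt n + 10))"
      unfolding enc_parts_Cons by (rule ev_cdrs, rule ev_weaken, (rule ev_rules cR cL)+, simp_all)
    have cut2: "ev (prog K) ?env ((ECdr ^^ K) (Call 8 [Arg 1, Arg 0, ENil, Arg 3]))
        (enc_nat (cnt E ?J [] (map fst L) - K)) (K + (cost_cnt n + 10))"
      unfolding enc_parts_Cons by (rule ev_cdrs, rule ev_weaken, (rule ev_rules cR cL)+, simp_all)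
    note cut = cut1[unfolded enc_parts_Cons] cut2[unfolded enc_parts_Cons]
    have 12: "evc (prog K) 12 ?env (enc_parts (merge_step E K L (p # q # R))) (2 * cost_cnt n + 40 * Suc n + 2 * K + 80 + ?c * Suc (length (q # R)))"
    proof -
      consider "K < cnt E ?J [] (map fst R)" | "cnt E ?J [] (map fst R) \<le> K" "K < cnt E ?J [] (map fst L)"
        | "cnt E ?J [] (map fst R) \<le> K" "cnt E ?J [] (map fst L) \<le> K" by linarith
      then show ?thesis
      proof cases
        case 1
        then show ?thesis unfolding enc_parts_Cons evc_prog merge_or_skip_body_def by - (rule ev_weaken, (rule cut | rule ev_rules IH | (rule ev_ifs, (simp; fail)))+, simp_all)
      next
        case 2
        then show ?thesis unfolding enc_parts_Cons evc_prog merge_or_skip_body_def by - (rule ev_weaken, (rule cut | rule ev_rules IH | (rule ev_ifs, (simp; fail)))+, simp_all)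
      next
        case 3
        then show ?thesis unfolding enc_parts_Cons evc_prog merge_or_skip_body_def by - (rule ev_weaken, (rule cut | rule ev_rules app ra | (rule ev_ifs, (simp; fail)))+, simp_all)
      qed
    qed
    show ?thesis using 12 unfolding R' enc_parts_Cons evc_prog merge_step_body_def by - (rule ev_weaken, (rule ev_rules app 12[unfolded enc_parts_Cons] | (rule ev_ifs, (simp; fail)))+, simp_all)
  qed
qed

end

context program_graph
begin

text \<open>Every round shortens the list of parts and keeps it well sized, so there are at most
  \<open>length P\<close> rounds of cost \<open>cost_stage K n\<close> each.\<close>

lemma evc_contractions:
  assumes "well_sized n P"
  shows "evc (prog K) 22 [enc_parts P, M] (enc_contractions (contractions E K P)) (cost_stage K n * Suc (length P))"
  using assms
proof (induction "length P" arbitrary: P rule: less_induct)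
  case less
  let ?mc = "2 * cost_cnt n + 80 * Suc n + 2 * K + 100"
    and ?oc = "(2 * cost_find n + 80) * Suc n + 20 * Suc n + 60"
  have cost: "cost_stage K n = ?mc * Suc n + (?oc * Suc n + ?oc * Suc n) + 20 * Suc n + 100"
    by (simp only: cost_stage_def mult_2 add_mult_distrib)
  consider "P = []" | p where "P = [p]" | p q R where "P = p # q # R" by (metis list.exhaust)
  then show ?case
  proof cases
    case 1
    have eq: "contractions E K [] = []" by (simp add: contractions.simps)
    show ?thesis unfolding 1 eq enc_list.simps evc_prog contractions_body_def cost by - (rule ev_weaken, (rule ev_rules | (rule ev_ifs, (simp add: enc_contractions_def; fail)))+, simp_all add: enc_contractions_def)
  next
    case 2
    have eq: "contractions E K [p] = []" by (simp add: contractions.simps)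
    show ?thesis unfolding 2 eq enc_list.simps(1) enc_parts_Cons evc_prog contractions_body_def cost by - (rule ev_weaken, (rule ev_rules | (rule ev_ifs, (simp add: enc_contractions_def; fail)))+, simp_all add: enc_contractions_def)
  next
    case 3
    define P1 where "P1 = merge_step E K [] P"
    have eq: "contractions E K P = outs E [] P1 @ contractions E K (reps E [] P1)"
      using 3 by (subst contractions.simps) (simp add: P1_def)
    have ws: "well_sized n P1" unfolding P1_def using less.prems by (intro well_sized_merge_step) simp
    have len: "length P1 < length P" unfolding P1_def using length_merge_step[of P E K "[]"] 3 by simp
    have "length P \<le> n" "length P1 \<le> n" using less.prems ws by (simp_all add: well_sized_def)
    have merge: "evc (prog K) 11 [SNil, enc_parts P, M] (enc_parts P1) (?mc * Suc n)"
    proof (rule evc_weaken)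
      show "evc (prog K) 11 [SNil, enc_parts P, M] (enc_parts P1) (?mc * Suc (length P))"
        using evc_merge_step[of "[]" P] less.prems by (simp add: P1_def)
    qed (rule mult_le_mono2, use \<open>length P \<le> n\<close> in simp)
    have outs: "evc (prog K) 20 [SNil, enc_parts P1, M] (enc_contractions (outs E [] P1)) (?oc * Suc n)"
    proof (rule evc_weaken)
      show "evc (prog K) 20 [SNil, enc_parts P1, M] (enc_contractions (outs E [] P1)) (?oc * Suc (length P1))"
        using evc_outs[of "[]" P1] ws by simp
    qed (rule mult_le_mono2, use \<open>length P1 \<le> n\<close> in simp)
    have reps: "evc (prog K) 21 [SNil, enc_parts P1, M] (enc_parts (reps E [] P1)) (?oc * Suc n)"
    proof (rule evc_weaken)
      show "evc (prog K) 21 [SNil, enc_parts P1, M] (enc_parts (reps E [] P1)) (?oc * Suc (length P1))"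
        using evc_reps[of "[]" P1] ws by simp
    qed (rule mult_le_mono2, use \<open>length P1 \<le> n\<close> in simp)
    have IH: "evc (prog K) 22 [enc_parts (reps E [] P1), M] (enc_contractions (contractions E K (reps E [] P1)))
        (cost_stage K n * length P)"
    proof (rule evc_weaken)
      show "evc (prog K) 22 [enc_parts (reps E [] P1), M] (enc_contractions (contractions E K (reps E [] P1)))
        (cost_stage K n * Suc (length (reps E [] P1)))"
        by (rule less.hyps) (use len ws in \<open>simp_all add: well_sized_reps\<close>)
    qed (rule mult_le_mono2, use len in simp)
    have "length (outs E [] P1) \<le> n" using length_outs[of E "[]" P1] ws by (simp add: well_sized_def)
    then have app: "evc (prog K) 9 [enc_contractions (outs E [] P1), enc_contractions (contractions E K (reps E [] P1))]
        (enc_contractions (contractions E K P)) (20 * Suc n)"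
      unfolding eq enc_contractions_def by (intro evc_weaken[OF evc_append]) simp
    have 23: "evc (prog K) 23 [enc_parts P1, M] (enc_contractions (contractions E K P))
        (?oc * Suc n + ?oc * Suc n + 20 * Suc n + cost_stage K n * length P + 50)"
      unfolding evc_prog outs_and_continue_body_def by - (rule ev_weaken, (rule ev_rules outs reps IH app | (rule ev_ifs, (simp; fail)))+, simp_all)
    have "?mc * Suc n + (?oc * Suc n + ?oc * Suc n + 20 * Suc n + cost_stage K n * length P + 50) + 40
        \<le> cost_stage K n * Suc (length P)"
      unfolding mult_Suc_right[of "cost_stage K n"] by (subst (2) cost) simp
    note cost' = this
    note merge' = merge[unfolded 3 enc_parts_Cons]
    have "ev (prog K) [enc_parts P, M] contractions_body (enc_contractions (contractions E K P))
        (?mc * Suc n + (?oc * Suc n + ?oc * Suc n + 20 * Suc n + cost_stage K n * length P + 50) + 40)"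
      unfolding 3 enc_parts_Cons contractions_body_def by - (rule ev_weaken, (rule ev_rules merge' 23[unfolded 3] | (rule ev_ifs, (simp; fail)))+, simp_all)
    then show ?thesis unfolding evc_prog using cost' by (rule ev_weaken[OF _ refl])
  qed
qed

end

section \<open>Polynomial bound for the complete run\<close>

definition cost_main :: "nat \<Rightarrow> nat \<Rightarrow> nat" where
  "cost_main K n = cost_stage K n * Suc n + 30 * Suc n + 50"

lemma size_enc_list: "length xs \<le> size (enc_list f xs)"
  by (induction xs) auto

text \<open>With natural coefficients polynomials are monotone, so a cost bound in the number
  \<open>n\<close> of vertices carries over to the input size.\<close>

lemma poly_nat_mono: "m \<le> n \<Longrightarrow> poly p m \<le> poly p n" for m n :: nat
  by (induction p) (auto intro: add_mono mult_mono)

definition polynomial :: "(nat \<Rightarrow> nat) \<Rightarrow> bool" where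
  "polynomial f \<longleftrightarrow> (\<exists>p. \<forall>n. f n = poly p n)"

lemma polynomial_intros:
  "polynomial (\<lambda>_. c)" "polynomial (\<lambda>n. n)"
  "polynomial f \<Longrightarrow> polynomial g \<Longrightarrow> polynomial (\<lambda>n. f n + g n)"
  "polynomial f \<Longrightarrow> polynomial g \<Longrightarrow> polynomial (\<lambda>n. f n * g n)"
  "polynomial f \<Longrightarrow> polynomial (\<lambda>n. Suc (f n))"
proof -
  show "polynomial (\<lambda>_. c)" unfolding polynomial_def by (intro exI[of _ "[:c:]"]) simp
  show "polynomial (\<lambda>n. n)" unfolding polynomial_def by (intro exI[of _ "[:0, 1:]"]) simp
  show "polynomial f \<Longrightarrow> polynomial g \<Longrightarrow> polynomial (\<lambda>n. f n + g n)"
    unfolding polynomial_def by (metis poly_add)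
  show "polynomial f \<Longrightarrow> polynomial g \<Longrightarrow> polynomial (\<lambda>n. f n * g n)"
    unfolding polynomial_def by (metis poly_mult)
  show "polynomial (\<lambda>n. Suc (f n))" if "polynomial f"
  proof -
    obtain p where "\<forall>n. f n = poly p n" using \<open>polynomial f\<close> by (auto simp: polynomial_def)
    then show ?thesis unfolding polynomial_def by (intro exI[of _ "p + [:1:]"]) simp
  qed
qed

lemma polynomial_cost_main: "polynomial (cost_main K)"
  unfolding cost_main_def[abs_def] cost_stage_def cost_find_def cost_eqv_def cost_cnt_def cost_start_def
  by (intro polynomial_intros)

lemma runs_prog:
  assumes "pverts G = {..<n}" "distinct vs" "set vs = {..<n}"
  shows "\<exists>k \<le> cost_main K n. runs (prog K) (enc_ordered_graph (G, vs))
    (enc_contractions (contractions (\<lambda>a b. (a, b) \<in> parcs G) K (map (\<lambda>v. ([v], [v])) vs))) k"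
proof -
  define mat where "mat = map (\<lambda>i. map (\<lambda>j. (i, j) \<in> parcs G) [0..<n]) [0..<n]"
  let ?M = "enc_list (enc_list enc_bool) mat" and ?E = "\<lambda>a b. (a, b) \<in> parcs G"
    and ?P = "map (\<lambda>v. ([v], [v])) vs"
  have len: "length vs = n" using distinct_card[OF assms(2)] assms(3) by simp
  interpret program_graph K n ?E ?M
  proof
    fix c v assume cv: "c < n" "v < n"
    have row: "evc (prog K) 1 [enc_nat c, ?M] (enc_list enc_bool (mat ! c)) (10 * Suc c)"
      using cv by (intro evc_nth) (simp add: mat_def)
    have "evc (prog K) 1 [enc_nat v, enc_list enc_bool (mat ! c)] (enc_bool (mat ! c ! v)) (10 * Suc v)"
      using cv by (intro evc_nth) (simp add: mat_def)
    moreover have "mat ! c ! v = ((c, v) \<in> parcs G)" using cv by (simp add: mat_def)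
    ultimately have entry: "evc (prog K) 1 [enc_nat v, enc_list enc_bool (mat ! c)] (enc_bool ((c, v) \<in> parcs G)) (10 * Suc v)"
      by simp
    show "evc (prog K) 2 [enc_nat v, enc_nat c, ?M] (enc_bool ((c, v) \<in> parcs G)) (30 * Suc n)"
      using cv unfolding evc_prog adj_body_def by - (rule ev_weaken, (rule ev_rules row entry | (rule ev_ifs, (simp; fail)))+, simp_all)
  qed
  have "well_sized n ?P"
    using assms(3) len by (auto simp: well_sized_def comp_def concat_map_singleton)
  from evc_contractions[OF this] have main: "evc (prog K) 22 [enc_parts ?P, ?M]
      (enc_contractions (contractions ?E K ?P)) (cost_stage K n * Suc n)" by (simp add: len)
  note init = evc_singletons[of K vs, unfolded len]
  have inp: "enc_ordered_graph (G, vs) = SCons ?M (enc_vs vs)"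
    using assms(1) by (simp add: enc_ordered_graph_def enc_pair_def adjacency_matrix_def mat_def)
  have "evc (prog K) 0 [enc_ordered_graph (G, vs)] (enc_contractions (contractions ?E K ?P)) (cost_main K n)"
    unfolding inp evc_prog main_body_def cost_main_def by - (rule ev_weaken, (rule ev_rules init main | (rule ev_ifs, (simp; fail)))+, simp_all)
  then show ?thesis by (auto simp: evc_def ev_def runs_def prog_def)
qed

theorem theorem5p3:
  fixes t :: nat
  assumes "t \<ge> 1"
  shows "(\<exists>d. \<forall>ps. terrain ps \<longrightarrow> H_free t (visibility_graph ps) \<longrightarrow>
              twin_width (visibility_graph ps) \<le> d) \<and>
         (\<exists>d. poly_time_solvable (H_free_ordered_visibility_graphs t)
                enc_ordered_graph enc_contractions (\<lambda>(G, vs) cs. d_sequence d G cs))"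
proof
  obtain K d where d: "\<And>(G :: (real \<times> real) pair_pre_digraph) vs. left_right_ordering G vs \<Longrightarrow> H_free t G \<Longrightarrow>
      d_sequence d G (contractions (\<lambda>a b. (a, b) \<in> parcs G) K (map (\<lambda>v. ([v], [v])) vs))"
    using d_sequence_contractions[OF assms] by blast
  have "twin_width (visibility_graph ps) \<le> d" if "terrain ps" "H_free t (visibility_graph ps)" for ps
    unfolding twin_width_def
    using d[OF left_right_ordering_visibility_graph[OF that(1)] that(2)] by (intro Least_le exI)
  then show "\<exists>d. \<forall>ps. terrain ps \<longrightarrow> H_free t (visibility_graph ps) \<longrightarrow> twin_width (visibility_graph ps) \<le> d"
    by blast
next
  obtain K d where d: "\<And>(G :: nat pair_pre_digraph) vs. left_right_ordering G vs \<Longrightarrow> H_free t G \<Longrightarrow>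
      d_sequence d G (contractions (\<lambda>a b. (a, b) \<in> parcs G) K (map (\<lambda>v. ([v], [v])) vs))"
    using d_sequence_contractions[OF assms] by blast
  obtain p where p: "\<And>n. cost_main K n = poly p n"
    using polynomial_cost_main[of K] by (auto simp: polynomial_def)
  have "\<exists>y k. (case x of (G, vs) \<Rightarrow> \<lambda>cs. d_sequence d G cs) y \<and>
      runs (prog K) (enc_ordered_graph x) (enc_contractions y) k \<and> k \<le> poly p (size (enc_ordered_graph x))"
    if x: "x \<in> H_free_ordered_visibility_graphs t" for x
  proof -
    obtain G vs n where G: "x = (G, vs)" "pverts G = {..<n}" "left_right_ordering G vs" "H_free t G"
      using x unfolding H_free_ordered_visibility_graphs_def by auto
    then have vs: "distinct vs" "set vs = {..<n}" by (auto simp: left_right_ordering_def)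
    obtain k where k: "k \<le> cost_main K n" "runs (prog K) (enc_ordered_graph (G, vs))
        (enc_contractions (contractions (\<lambda>a b. (a, b) \<in> parcs G) K (map (\<lambda>v. ([v], [v])) vs))) k"
      using runs_prog[OF G(2) vs] by blast
    \<comment> \<open>The encoded ordering alone contributes one inner node per vertex.\<close>
    have "n \<le> size (enc_ordered_graph x)"
      using size_enc_list[of vs enc_nat] distinct_card[OF vs(1)] vs(2)
      by (simp add: G(1) enc_ordered_graph_def enc_pair_def)
    then have "k \<le> poly p (size (enc_ordered_graph x))"
      using k(1) poly_nat_mono[of n _ p] unfolding p by (meson le_trans)
    then show ?thesis using k(2) d[OF G(3,4)] unfolding G(1) by auto
  qed
  then show "\<exists>d. poly_time_solvable (H_free_ordered_visibility_graphs t)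
      enc_ordered_graph enc_contractions (\<lambda>(G, vs) cs. d_sequence d G cs)"
    unfolding poly_time_solvable_def by (intro exI[of _ d] exI[of _ "prog K"] exI[of _ p] ballI)
qed

end
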